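(* If $(G,K)$ is one of the $10$ symmetric pairs of non-unitary type (listed in the context), then all continuous unitary representations of $G$ on separable Hilbert spaces are trivial.
   Context: $\mathcal H$ is an infinite-dimensional separable Hilbert space over $\mathbb K\in\{\mathbb R,\mathbb C,\mathbb H\}$, $\mathrm U_{\mathbb K}(\mathcal H)$ is its unitary group, $\mathrm O(\mathcal H)=\mathrm U_{\mathbb R}(\mathcal H)$. The $10$ pairs $(G,K)$ of non-unitary type, where $G$ is a group of bounded invertible operators with the operator norm topology and $K=\{g\in G: g^*=g^{-1}\}$, are: (1) $(\mathrm{GL}(\mathcal H),\mathrm U(\mathcal H))$, $\mathbb K=\mathbb C$. (2) $(\mathrm O(\mathcal H)_{\mathbb C},\mathrm O(\mathcal H))$, $\mathbb K=\mathbb R$, where $\mathrm O(\mathcal H)_{\mathbb C}\subseteq\mathrm{GL}(\mathcal H_{\mathbb C})$ is the group of complex linear isomorphisms of the complexification $\mathcal H_{\mathbb C}$ preserving the complex bilinear extension of the inner product of $\mathcal H$. (3) $(\mathrm U_{\mathbb H}(\mathcal H)_{\mathbb C},\mathrm U_{\mathbb H}(\mathcal H))$, $\mathbb K=\mathbb H$, where $\mathrm U_{\mathbb H}(\mathcal H)_{\mathbb C}\subseteq\mathrm{GL}(\mathcal H^{\mathbb C})$ is the group of complex linear isomorphisms of the underlying complex Hilbert space $\mathcal H^{\mathbb C}$ preserving the complex bilinear skew form $\omega(v,w)=\langle v,\mathcal Jw\rangle$, with $\langle\cdot,\cdot\rangle$ linear in the first argument and $\mathcal J$ the antilinear complex structure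 on $\mathcal H^{\mathbb C}$ defining the quaternionic structure. (4), (5), (6) $(\mathrm U_{\mathbb K}(\mathcal H,\mathcal H),\mathrm U_{\mathbb K}(\mathcal H)^2)$ for $\mathbb K=\mathbb C,\mathbb R,\mathbb H$, respectively, where $\mathrm U_{\mathbb K}(\mathcal H,\mathcal H)\subseteq\mathrm{GL}_{\mathbb K}(\mathcal H\oplus\mathcal H)$ is the isometry group of the form $h((v_1,v_2),(w_1,w_2))=\langle v_1,w_1\rangle-\langle v_2,w_2\rangle$ (written $\mathrm O(\mathcal H,\mathcal H)$ for $\mathbb K=\mathbb R$). (7) $(\mathrm{Sp}(\mathcal H),\mathrm U(\mathcal H))$, $\mathbb K=\mathbb C$, where $\mathrm{Sp}(\mathcal H)$ is the group of bounded invertible real linear operators preserving the symplectic form $\mathrm{Im}\langle v,w\rangle$ on $\mathcal H$. (8) $(\mathrm O^*(\mathcal H_{\mathbb C}),\mathrm U(\mathcal H))$, $\mathbb K=\mathbb C$: here $\mathcal H_{\mathbb C}$ is the complexification of the real Hilbert space $\mathcal H^{\mathbb R}$ underlying $\mathcal H$, $I$ is the complex linear extension to $\mathcal H_{\mathbb C}$ of multiplication by $i$ on $\mathcal H$, $D=-iI$ (a unitary involution), $\mathrm U(\mathcal H_{\mathbb C},D)=\{g\in\mathrm{GL}(\mathcal H_{\mathbb C}): Dg^*D^{-1}=g^{-1}\}$, and $\mathrm O^*(\mathcal H_{\mathbb C})=\mathrm U(\mathcal H_{\mathbb C},D)\cap\mathrm O(\mathcal H^{\mathbb R})_{\mathbb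 C}$. (9) $(\mathrm{GL}(\mathcal H),\mathrm O(\mathcal H))$, $\mathbb K=\mathbb R$. (10) $(\mathrm{GL}_{\mathbb H}(\mathcal H),\mathrm U_{\mathbb H}(\mathcal H))$, $\mathbb K=\mathbb H$. A unitary representation $\pi$ of $G$ is continuous if all orbit maps $g\mapsto\pi(g)v$ are continuous. *)

theory Defs
  imports "HOL-Analysis.Analysis"
begin

section \<open>Scalars: real numbers, complex numbers and quaternions\<close>

class real_star_algebra = real_algebra_1 +
  fixes star :: "'a \<Rightarrow> 'a"
  assumes star_add: "star (x + y) = star x + star y"
    and star_mult: "star (x * y) = star y * star x"
    and star_scaleR: "star (r *\<^sub>R x) = r *\<^sub>R star x"
    and star_star: "star (star x) = x"

instantiation real :: real_star_algebra
begin
definition star_real :: "real \<Rightarrow> real" where "star_real x = x"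
instance by standard (simp_all add: star_real_def)
end

instantiation complex :: real_star_algebra
begin
definition star_complex :: "complex \<Rightarrow> complex" where "star_complex = cnj"
instance by standard (simp_all add: star_complex_def)
end

text \<open>\<open>Quat z w\<close> is the quaternion \<open>z + w j\<close>, where \<open>j z = cnj z j\<close> and \<open>j\<^sup>2 = -1\<close>.\<close>

datatype quat = Quat (cpart: complex) (jpart: complex)

instantiation quat :: real_star_algebra
begin

definition "0 = Quat 0 0"
definition "1 = Quat 1 0"
definition "p + q = Quat (cpart p + cpart q) (jpart p + jpart q)"
definition "p - q = Quat (cpart p - cpart q) (jpart p - jpart q)"
definition "- p = Quat (- cpart p) (- jpart p)"
definition "r *\<^sub>R p = Quat (r *\<^sub>R cpart p) (r *\<^sub>R jpart p)"
definition "p * q =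
  Quat (cpart p * cpart q - jpart p * cnj (jpart q))
       (cpart p * jpart q + jpart p * cnj (cpart q))"
definition "star p = Quat (cnj (cpart p)) (- jpart p)"

instance
  by standard
    (auto simp: zero_quat_def one_quat_def plus_quat_def minus_quat_def uminus_quat_def
       scaleR_quat_def times_quat_def star_quat_def algebra_simps intro!: quat.expand)

end

definition quat_j :: quat where "quat_j = Quat 0 1"


section \<open>Hilbert spaces over the real numbers, the complex numbers and the quaternions\<close>

text \<open>
  The space carries its underlying real Hilbert space structure by its type; the scalars act
  from the left and the inner product is linear in the first argument. The last axiom says that
  both structures have the same norm; by polarization the real inner product is then the real
  part of \<open>ip\<close>.
\<close>

locale hilbert_space =
  fixes sc :: "'k::real_star_algebra \<Rightarrow> 'h::{real_inner,complete_space} \<Rightarrow> 'h"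
    and ip :: "'h \<Rightarrow> 'h \<Rightarrow> 'k"
  assumes sc_add_right: "sc a (v + w) = sc a v + sc a w"
    and sc_add_left: "sc (a + b) v = sc a v + sc b v"
    and sc_sc: "sc a (sc b v) = sc (a * b) v"
    and sc_of_real: "sc (of_real r) v = r *\<^sub>R v"
    and ip_add_left: "ip (u + v) w = ip u w + ip v w"
    and ip_sc_left: "ip (sc a v) w = a * ip v w"
    and ip_star: "ip w v = star (ip v w)"
    and ip_self: "ip v v = of_real ((norm v)\<^sup>2)"

definition separable :: "'h::topological_space set \<Rightarrow> bool" where
  "separable S \<longleftrightarrow> (\<exists>D. countable D \<and> D \<subseteq> S \<and> S \<subseteq> closure D)"

locale separable_infinite_dim_hilbert_space = hilbert_space sc ip
  for sc :: "'k::real_star_algebra \<Rightarrow> 'h::{real_inner,complete_space} \<Rightarrow> 'h"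
    and ip :: "'h \<Rightarrow> 'h \<Rightarrow> 'k" +
  assumes separable: "separable (UNIV :: 'h set)"
    and infinite_dim: "\<not> (\<exists>B. finite B \<and> (\<forall>v. \<exists>c. v = (\<Sum>b\<in>B. sc (c b) b)))"

lemma hilbert_space_real:
  "hilbert_space scaleR (inner :: 'h::{real_inner,complete_space} \<Rightarrow> 'h \<Rightarrow> real)"
  by unfold_locales
    (simp_all add: star_real_def inner_commute algebra_simps power2_norm_eq_inner)


section \<open>Operator groups\<close>

text \<open>
  Groups of operators are sets of bounded operators; the topology of the type \<open>'h \<Rightarrow>\<^sub>L 'h\<close> is the
  operator norm topology.
\<close>

definition GL :: "('k \<Rightarrow> 'h \<Rightarrow> 'h) \<Rightarrow> ('h::real_normed_vector \<Rightarrow>\<^sub>L 'h) set" where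
  "GL sc = {g. (\<forall>a v. blinfun_apply g (sc a v) = sc a (blinfun_apply g v)) \<and>
               (\<exists>h. g o\<^sub>L h = id_blinfun \<and> h o\<^sub>L g = id_blinfun)}"

definition preserves :: "('h \<Rightarrow> 'h \<Rightarrow> 'k) \<Rightarrow> ('h::real_normed_vector \<Rightarrow>\<^sub>L 'h) \<Rightarrow> bool" where
  "preserves f g \<longleftrightarrow> (\<forall>v w. f (blinfun_apply g v) (blinfun_apply g w) = f v w)"

definition unitary_group ::
  "('k \<Rightarrow> 'h \<Rightarrow> 'h) \<Rightarrow> ('h \<Rightarrow> 'h \<Rightarrow> 'k) \<Rightarrow> ('h::real_normed_vector \<Rightarrow>\<^sub>L 'h) set" where
  "unitary_group sc ip = {g \<in> GL sc. preserves ip g}"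

text \<open>
  The adjoint with respect to the real inner product is also the adjoint with respect to the
  complex or quaternionic inner product whenever the operator is linear over these scalars.
\<close>

definition unitary_part :: "('h::real_inner \<Rightarrow>\<^sub>L 'h) set \<Rightarrow> ('h \<Rightarrow>\<^sub>L 'h) set" where
  "unitary_part G = {g \<in> G. adjoint (blinfun_apply g) = inv (blinfun_apply g)}"

definition Sp_group :: "('h \<Rightarrow> 'h \<Rightarrow> complex) \<Rightarrow> ('h::real_normed_vector \<Rightarrow>\<^sub>L 'h) set" where
  "Sp_group ip = {g \<in> GL scaleR. preserves (\<lambda>v w. Im (ip v w)) g}"

text \<open>The complex scalars and the skew form \<open>\<omega>\<close> on the complex Hilbert space underlying a quaternionic
  one. Its complex inner product is the \<open>\<complex>\<close>-component of the quaternionic inner product, and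
  the antilinear complex structure is multiplication by \<open>j\<close>.\<close>

definition restrict_scalars :: "(quat \<Rightarrow> 'h \<Rightarrow> 'h) \<Rightarrow> complex \<Rightarrow> 'h \<Rightarrow> 'h" where
  "restrict_scalars sc z v = sc (Quat z 0) v"

definition restrict_ip :: "('h \<Rightarrow> 'h \<Rightarrow> quat) \<Rightarrow> 'h \<Rightarrow> 'h \<Rightarrow> complex" where
  "restrict_ip ip v w = cpart (ip v w)"

definition skew_form ::
  "(quat \<Rightarrow> 'h \<Rightarrow> 'h) \<Rightarrow> ('h \<Rightarrow> 'h \<Rightarrow> quat) \<Rightarrow> 'h \<Rightarrow> 'h \<Rightarrow> complex" where
  "skew_form sc ip v w = restrict_ip ip v (sc quat_j w)"

definition U_quat_complexified ::
  "(quat \<Rightarrow> 'h \<Rightarrow> 'h) \<Rightarrow> ('h \<Rightarrow> 'h \<Rightarrow> quat) \<Rightarrow> ('h::real_normed_vector \<Rightarrow>\<^sub>L 'h) set" where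
  "U_quat_complexified sc ip = {g \<in> GL (restrict_scalars sc). preserves (skew_form sc ip) g}"

definition sum_scale :: "('k \<Rightarrow> 'h \<Rightarrow> 'h) \<Rightarrow> 'k \<Rightarrow> 'h \<times> 'h \<Rightarrow> 'h \<times> 'h" where
  "sum_scale sc a v = (sc a (fst v), sc a (snd v))"

definition indefinite_form ::
  "('h \<Rightarrow> 'h \<Rightarrow> 'k::minus) \<Rightarrow> 'h \<times> 'h \<Rightarrow> 'h \<times> 'h \<Rightarrow> 'k" where
  "indefinite_form ip v w = ip (fst v) (fst w) - ip (snd v) (snd w)"

definition U_indefinite ::
  "('k::real_star_algebra \<Rightarrow> 'h \<Rightarrow> 'h) \<Rightarrow> ('h \<Rightarrow> 'h \<Rightarrow> 'k) \<Rightarrow>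
    (('h::real_normed_vector \<times> 'h) \<Rightarrow>\<^sub>L ('h \<times> 'h)) set" where
  "U_indefinite sc ip = {g \<in> GL (sum_scale sc). preserves (indefinite_form ip) g}"

text \<open>
  The complexification of a real Hilbert space: the pair \<open>(x, y)\<close> stands for \<open>x + i y\<close>. The
  real inner product of the product type is the real part of the complex inner product.
\<close>

definition cx_scale :: "complex \<Rightarrow> 'h \<times> 'h \<Rightarrow> 'h \<times> 'h::real_vector" where
  "cx_scale z v = (Re z *\<^sub>R fst v - Im z *\<^sub>R snd v, Re z *\<^sub>R snd v + Im z *\<^sub>R fst v)"

definition cx_bilinear :: "'h \<times> 'h \<Rightarrow> 'h \<times> 'h::real_inner \<Rightarrow> complex" where
  "cx_bilinear v w =
     Complex (inner (fst v) (fst w) - inner (snd v) (snd w))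
             (inner (fst v) (snd w) + inner (snd v) (fst w))"

definition O_complexified :: "(('h::real_inner \<times> 'h) \<Rightarrow>\<^sub>L ('h \<times> 'h)) set" where
  "O_complexified = {g \<in> GL cx_scale. preserves cx_bilinear g}"

definition I_ext :: "(complex \<Rightarrow> 'h \<Rightarrow> 'h) \<Rightarrow> 'h \<times> 'h \<Rightarrow> 'h \<times> 'h" where
  "I_ext sc v = (sc \<i> (fst v), sc \<i> (snd v))"

definition D_op :: "(complex \<Rightarrow> 'h \<Rightarrow> 'h) \<Rightarrow> 'h \<times> 'h \<Rightarrow> 'h \<times> 'h::real_vector" where
  "D_op sc v = cx_scale (- \<i>) (I_ext sc v)"

definition U_D :: "(complex \<Rightarrow> 'h \<Rightarrow> 'h) \<Rightarrow> (('h::real_inner \<times> 'h) \<Rightarrow>\<^sub>L ('h \<times> 'h)) set" where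
  "U_D sc = {g \<in> GL cx_scale.
     D_op sc \<circ> adjoint (blinfun_apply g) \<circ> inv (D_op sc) = inv (blinfun_apply g)}"

definition O_star :: "(complex \<Rightarrow> 'h \<Rightarrow> 'h) \<Rightarrow> (('h::real_inner \<times> 'h) \<Rightarrow>\<^sub>L ('h \<times> 'h)) set" where
  "O_star sc = U_D sc \<inter> O_complexified"


section \<open>The symmetric pairs of non-unitary type\<close>

text \<open>
  The ten pairs are split according to whether the group acts on \<open>H\<close> itself (or its underlying
  real or complex space) or on \<open>H \<times> H\<close> (the complexification or the direct sum \<open>H \<oplus> H\<close>).
\<close>

inductive nonunitary_pair ::
  "('h::{real_inner,complete_space} \<Rightarrow>\<^sub>L 'h) set \<Rightarrow> ('h \<Rightarrow>\<^sub>L 'h) set \<Rightarrow> bool" where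
  GL_complex:
    "separable_infinite_dim_hilbert_space (sc :: complex \<Rightarrow> 'h \<Rightarrow> 'h) ip \<Longrightarrow>
      nonunitary_pair (GL sc) (unitary_part (GL sc))"
| U_quat_complexified:
    "separable_infinite_dim_hilbert_space (sc :: quat \<Rightarrow> 'h \<Rightarrow> 'h) ip \<Longrightarrow>
      nonunitary_pair (U_quat_complexified sc ip) (unitary_part (U_quat_complexified sc ip))"
| Sp:
    "separable_infinite_dim_hilbert_space (sc :: complex \<Rightarrow> 'h \<Rightarrow> 'h) ip \<Longrightarrow>
      nonunitary_pair (Sp_group ip) (unitary_part (Sp_group ip))"
| GL_real:
    "separable_infinite_dim_hilbert_space scaleR (inner :: 'h \<Rightarrow> 'h \<Rightarrow> real) \<Longrightarrow>
      nonunitary_pair (GL scaleR) (unitary_part (GL scaleR))"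
| GL_quat:
    "separable_infinite_dim_hilbert_space (sc :: quat \<Rightarrow> 'h \<Rightarrow> 'h) ip \<Longrightarrow>
      nonunitary_pair (GL sc) (unitary_part (GL sc))"

inductive nonunitary_pair_double ::
  "(('h::{real_inner,complete_space} \<times> 'h) \<Rightarrow>\<^sub>L ('h \<times> 'h)) set \<Rightarrow>
    (('h \<times> 'h) \<Rightarrow>\<^sub>L ('h \<times> 'h)) set \<Rightarrow> bool" where
  O_complexified:
    "separable_infinite_dim_hilbert_space scaleR (inner :: 'h \<Rightarrow> 'h \<Rightarrow> real) \<Longrightarrow>
      nonunitary_pair_double O_complexified (unitary_part O_complexified)"
| U_indefinite_complex:
    "separable_infinite_dim_hilbert_space (sc :: complex \<Rightarrow> 'h \<Rightarrow> 'h) ip \<Longrightarrow>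
      nonunitary_pair_double (U_indefinite sc ip) (unitary_part (U_indefinite sc ip))"
| U_indefinite_real:
    "separable_infinite_dim_hilbert_space scaleR (inner :: 'h \<Rightarrow> 'h \<Rightarrow> real) \<Longrightarrow>
      nonunitary_pair_double (U_indefinite scaleR inner) (unitary_part (U_indefinite scaleR inner))"
| U_indefinite_quat:
    "separable_infinite_dim_hilbert_space (sc :: quat \<Rightarrow> 'h \<Rightarrow> 'h) ip \<Longrightarrow>
      nonunitary_pair_double (U_indefinite sc ip) (unitary_part (U_indefinite sc ip))"
| O_star:
    "separable_infinite_dim_hilbert_space (sc :: complex \<Rightarrow> 'h \<Rightarrow> 'h) ip \<Longrightarrow>
      nonunitary_pair_double (O_star sc) (unitary_part (O_star sc))"


section \<open>Continuous unitary representations\<close>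

definition continuous_unitary_rep ::
  "(complex \<Rightarrow> 'v \<Rightarrow> 'v) \<Rightarrow> ('v \<Rightarrow> 'v \<Rightarrow> complex) \<Rightarrow> ('e::real_normed_vector \<Rightarrow>\<^sub>L 'e) set \<Rightarrow>
    (('e \<Rightarrow>\<^sub>L 'e) \<Rightarrow> ('v::real_normed_vector \<Rightarrow>\<^sub>L 'v)) \<Rightarrow> bool" where
  "continuous_unitary_rep vsc vip G \<pi> \<longleftrightarrow>
     (\<forall>g\<in>G. \<pi> g \<in> unitary_group vsc vip) \<and>
     (\<forall>g\<in>G. \<forall>h\<in>G. \<pi> (g o\<^sub>L h) = \<pi> g o\<^sub>L \<pi> h) \<and>
     (\<forall>v. continuous_on G (\<lambda>g. blinfun_apply (\<pi> g) v))"

definition trivial_rep ::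
  "('e::real_normed_vector \<Rightarrow>\<^sub>L 'e) set \<Rightarrow>
    (('e \<Rightarrow>\<^sub>L 'e) \<Rightarrow> ('v::real_normed_vector \<Rightarrow>\<^sub>L 'v)) \<Rightarrow> bool" where
  "trivial_rep G \<pi> \<longleftrightarrow> (\<forall>g\<in>G. \<pi> g = id_blinfun)"

end

(*
  Only separability, norm continuity and the contraction of unipotents are used. By separability, among
  uncountably many diagonal elements two have nearby values on a given vector v; their quotient d is a
  diagonal element almost fixing v. Unipotents that d contracts to the identity (Mautner phenomenon) then
  almost fix v, and so do signed permutations built from them, which conjugate d to a prescribed diagonal
  element. Hence the kernel contains all diagonal elements that are equal to 2 on an infinite and
  co-infinite part of a basis, and therefore all unipotents contracted by these. An Eilenberg swindle puts
  every element supported on a co-infinite part into the kernel. Finally, by multiplication with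
  unipotents, a general g becomes an element fixing an infinite part of a basis, and contraction by
  diagonal elements of the kernel removes its off-diagonal blocks.
*)
theory Submission
  imports Defs
begin

section \<open>Strong sums of operators with orthogonal ranges\<close>

text \<open>The set scaled by \<open>d\<close> comes out of a pigeonhole argument and depends on the
  vector and on the tolerance, so separability alone puts no single element into the kernel. Every
  estimate is therefore kept as a bound on the displacement of one vector; only after the transport
  to a scaling fixed beforehand does it hold for all vectors and tolerances. The diagonal elements
  are indexed by nested Dedekind cuts because the quotient of two of them is then again a scaling,
  on an infinite band. Norm continuity enters through one large factor that contracts infinitely
  many transvections at the same rate. The swindle is needed because contraction reaches unipotents
  only, whereas the block left at the end commutes with the scalings used. Infinitely many copies of
  a block form a strong sum, not a norm limit, so their membership in the group is verified by hand.
  In the last reduction the obstacle is that the images \<open>g p\<close> and the vectors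
  \<open>p\<close> need not be orthogonal, so no transvection joins them directly; a third system
  orthogonal to both serves as a stopover.\<close>

lemmas blin_simps = blinfun.bilinear_simps

lemma norm_sum_orthogonal:
  fixes x :: "'i \<Rightarrow> 'e::real_inner"
  assumes "finite F" and "\<And>i j. i \<in> F \<Longrightarrow> j \<in> F \<Longrightarrow> i \<noteq> j \<Longrightarrow> x i \<bullet> x j = 0"
  shows "(norm (sum x F))\<^sup>2 = (\<Sum>i\<in>F. (norm (x i))\<^sup>2)"
proof -
  have "(norm (sum x F))\<^sup>2 = (\<Sum>i\<in>F. \<Sum>j\<in>F. x i \<bullet> x j)"
    unfolding power2_norm_eq_inner inner_sum_left unfolding inner_sum_right ..
  also have "\<dots> = (\<Sum>i\<in>F. \<Sum>j\<in>F. if i = j then x i \<bullet> x i else 0)"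
    using assms(2) by (intro sum.cong refl) auto
  also have "\<dots> = (\<Sum>i\<in>F. (norm (x i))\<^sup>2)"
    using assms(1) by (simp add: power2_norm_eq_inner)
  finally show ?thesis .
qed

text \<open>The bound makes the squared norms summable. By Pythagoras, enlarging a partial sum
  changes it by at most the tail of that real series, so the net of partial sums is Cauchy although
  it need not converge absolutely.\<close>

lemma
  fixes x :: "'i \<Rightarrow> 'e::{real_inner,complete_space}"
  assumes orth: "\<And>i j. i \<in> I \<Longrightarrow> j \<in> I \<Longrightarrow> i \<noteq> j \<Longrightarrow> x i \<bullet> x j = 0"
    and bd: "\<And>F. finite F \<Longrightarrow> F \<subseteq> I \<Longrightarrow> (\<Sum>i\<in>F. (norm (x i))\<^sup>2) \<le> C"
  shows summable_on_orthogonal: "x summable_on I"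
    and norm_infsum_orthogonal: "(norm (infsum x I))\<^sup>2 \<le> C"
proof -
  let ?n = "\<lambda>i. (norm (x i))\<^sup>2"
  have sn: "?n summable_on I"
    by (rule nonneg_bdd_above_summable_on) (use bd in \<open>auto intro!: bdd_aboveI[of _ C]\<close>)
  have "\<exists>P. eventually P (finite_subsets_at_top I) \<and>
              (\<forall>F F'. P F \<and> P F' \<longrightarrow> dist (sum x F) (sum x F') < e)" if "e > 0" for e
  proof -
    \<comment> \<open>The tolerance is squared because it is compared with squared norms; two sums
      close to \<open>sum x F0\<close> then differ by at most 2e/3.\<close>
    obtain F0 where F0: "finite F0" "F0 \<subseteq> I" "dist (sum ?n F0) (infsum ?n I) \<le> (e/3)\<^sup>2"
      using infsum_finite_approximation[OF sn, of "(e/3)\<^sup>2"] \<open>e > 0\<close> by auto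
    define P where "P F \<longleftrightarrow> finite F \<and> F0 \<subseteq> F \<and> F \<subseteq> I" for F
    have ev: "eventually P (finite_subsets_at_top I)"
      using F0 unfolding P_def eventually_finite_subsets_at_top by auto
    have near: "dist (sum x F) (sum x F0) \<le> e/3" if "P F" for F
    proof -
      have F: "finite F" "F0 \<subseteq> F" "F \<subseteq> I" using that by (auto simp: P_def)
      have "(norm (sum x F - sum x F0))\<^sup>2 = (norm (sum x (F - F0)))\<^sup>2"
        using F by (subst sum_diff) auto
      also have "\<dots> = sum ?n (F - F0)"
        using F by (intro norm_sum_orthogonal orth) auto
      also have "\<dots> = sum ?n F - sum ?n F0"
        using F by (subst sum_diff) auto
      also have "\<dots> \<le> infsum ?n I - sum ?n F0"
        using finite_sum_le_infsum[OF sn F(1,3)] by auto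
      also have "\<dots> \<le> (e/3)\<^sup>2"
        using F0(3) by (auto simp: dist_real_def)
      finally show ?thesis
        using \<open>e > 0\<close> by (simp add: dist_norm power2_le_iff_abs_le)
    qed
    have "dist (sum x F) (sum x F') < e" if "P F" "P F'" for F F'
      using near[OF that(1)] near[OF that(2)] dist_triangle2[of "sum x F" "sum x F'" "sum x F0"] \<open>e > 0\<close>
      by linarith
    then show ?thesis using ev by blast
  qed
  then have "cauchy_filter (filtermap (sum x) (finite_subsets_at_top I))"
    by (simp add: cauchy_filter_metric_filtermap)
  moreover have "complete (UNIV::'e set)"
    by (meson Cauchy_convergent UNIV_I complete_def convergent_def)
  ultimately obtain L' where "(sum x \<longlongrightarrow> L') (finite_subsets_at_top I)"
    using complete_uniform[where S=UNIV] by (force simp add: filterlim_def)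
  then show s: "x summable_on I"
    using summable_on_def has_sum_def by blast
  have "((\<lambda>F. (norm (sum x F))\<^sup>2) \<longlongrightarrow> (norm (infsum x I))\<^sup>2) (finite_subsets_at_top I)"
    by (intro tendsto_intros infsum_tendsto s)
  moreover have "\<forall>\<^sub>F F in finite_subsets_at_top I. (norm (sum x F))\<^sup>2 \<le> C"
  proof (rule eventually_finite_subsets_at_top_weakI)
    fix F assume F: "finite F" "F \<subseteq> I"
    have "(norm (sum x F))\<^sup>2 = sum ?n F"
      by (intro norm_sum_orthogonal orth) (use F in auto)
    then show "(norm (sum x F))\<^sup>2 \<le> C" using bd[OF F] by simp
  qed
  ultimately show "(norm (infsum x I))\<^sup>2 \<le> C"
    by (rule tendsto_upperbound) simp
qed

lemma infsum_bounded_linear: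
  fixes L :: "'a::real_normed_vector \<Rightarrow> 'b::real_normed_vector"
  assumes "bounded_linear L" "x summable_on I"
  shows "L (infsum x I) = (\<Sum>\<^sub>\<infinity>i\<in>I. L (x i))"
    and "(\<lambda>i. L (x i)) summable_on I"
proof -
  interpret bounded_linear L by fact
  have "(L \<circ> x has_sum L (infsum x I)) I"
    by (rule has_sum_comm_additive_general) (use linear_continuous_at[OF assms(1)] in \<open>auto simp: sum o_def assms(2) isCont_def\<close>)
  then show "L (infsum x I) = (\<Sum>\<^sub>\<infinity>i\<in>I. L (x i))" "(\<lambda>i. L (x i)) summable_on I"
    by (auto simp: o_def has_sum_iff)
qed

text \<open>The sum is formed pointwise because infinitely many blocks of comparable size do not add
  up in the operator norm.\<close>

definition strong_sum :: "'i set \<Rightarrow> ('i \<Rightarrow> 'e \<Rightarrow>\<^sub>L 'e) \<Rightarrow> 'e::{real_inner,complete_space} \<Rightarrow>\<^sub>L 'e" where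
  "strong_sum I A = Blinfun (\<lambda>v. \<Sum>\<^sub>\<infinity>i\<in>I. A i v)"

text \<open>Orthogonal ranges together with a Bessel-type bound: exactly what yields pointwise
  convergence and norm at most \<open>C\<close> for the sum.\<close>

definition orth_family :: "'i set \<Rightarrow> ('i \<Rightarrow> 'e \<Rightarrow>\<^sub>L 'e) \<Rightarrow> real \<Rightarrow> 'e::{real_inner,complete_space} itself \<Rightarrow> bool" where
  "orth_family I A C _ \<longleftrightarrow> (\<forall>i\<in>I. \<forall>j\<in>I. i \<noteq> j \<longrightarrow> (\<forall>v w. A i v \<bullet> A j w = 0)) \<and>
    (\<forall>F v. finite F \<longrightarrow> F \<subseteq> I \<longrightarrow> (\<Sum>i\<in>F. (norm (A i v))\<^sup>2) \<le> (C * norm v)\<^sup>2) \<and> 0 \<le> C"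

lemma
  fixes A :: "'i \<Rightarrow> 'e::{real_inner,complete_space} \<Rightarrow>\<^sub>L 'e"
  assumes "orth_family I A C TYPE('e)"
  shows strong_sum_summable: "(\<lambda>i. A i v) summable_on I"
    and strong_sum_apply: "strong_sum I A v = (\<Sum>\<^sub>\<infinity>i\<in>I. A i v)"
    and norm_strong_sum: "norm (strong_sum I A) \<le> C"
proof -
  have s: "(\<lambda>i. A i v) summable_on I" and n: "(norm (\<Sum>\<^sub>\<infinity>i\<in>I. A i v))\<^sup>2 \<le> (C * norm v)\<^sup>2" for v
  proof -
    have orth: "A i v \<bullet> A j v = 0" if "i \<in> I" "j \<in> I" "i \<noteq> j" for i j
      using assms that unfolding orth_family_def by blast
    have bd: "(\<Sum>i\<in>F. (norm (A i v))\<^sup>2) \<le> (C * norm v)\<^sup>2" if "finite F" "F \<subseteq> I" for F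
      using assms that unfolding orth_family_def by blast
    show "(\<lambda>i. A i v) summable_on I" by (rule summable_on_orthogonal[OF orth bd])
    show "(norm (\<Sum>\<^sub>\<infinity>i\<in>I. A i v))\<^sup>2 \<le> (C * norm v)\<^sup>2" by (rule norm_infsum_orthogonal[OF orth bd])
  qed
  have C: "0 \<le> C" using assms by (simp add: orth_family_def)
  have n': "norm (\<Sum>\<^sub>\<infinity>i\<in>I. A i v) \<le> C * norm v" for v
    using n[of v] C by (simp add: power2_le_iff_abs_le)
  have bl: "bounded_linear (\<lambda>v. \<Sum>\<^sub>\<infinity>i\<in>I. A i v)"
  proof (rule bounded_linear_intro[where K = C])
    show "(\<Sum>\<^sub>\<infinity>i\<in>I. A i (v + w)) = (\<Sum>\<^sub>\<infinity>i\<in>I. A i v) + (\<Sum>\<^sub>\<infinity>i\<in>I. A i w)" for v w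
      by (simp add: blinfun.add_right infsum_add s)
    show "(\<Sum>\<^sub>\<infinity>i\<in>I. A i (r *\<^sub>R v)) = r *\<^sub>R (\<Sum>\<^sub>\<infinity>i\<in>I. A i v)" for r v
      by (simp add: blinfun.scaleR_right infsum_scaleR_right)
    show "norm (\<Sum>\<^sub>\<infinity>i\<in>I. A i v) \<le> norm v * C" for v
      using n'[of v] by (simp add: mult.commute)
  qed
  show "(\<lambda>i. A i v) summable_on I" by fact
  show ap: "strong_sum I A v = (\<Sum>\<^sub>\<infinity>i\<in>I. A i v)" for v
    unfolding strong_sum_def by (simp add: bounded_linear_Blinfun_apply[OF bl])
  show "norm (strong_sum I A) \<le> C"
    by (rule norm_blinfun_bound) (use C n' ap in auto)
qed

section \<open>Bessel's inequality and weighted partial isometries between orthonormal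
  systems\<close>

definition ons :: "'i set \<Rightarrow> ('i \<Rightarrow> 'e::real_inner) \<Rightarrow> bool" where
  "ons I u \<longleftrightarrow> (\<forall>i\<in>I. \<forall>j\<in>I. u i \<bullet> u j = (if i = j then 1 else 0))"

lemma Bessel_inequality:
  fixes u :: "'i \<Rightarrow> 'e::real_inner"
  assumes "ons F u" "finite F"
  shows "(\<Sum>i\<in>F. (v \<bullet> u i)\<^sup>2) \<le> (norm v)\<^sup>2"
proof -
  let ?p = "\<Sum>i\<in>F. (v \<bullet> u i) *\<^sub>R u i"
  have 1: "v \<bullet> ?p = (\<Sum>i\<in>F. (v \<bullet> u i)\<^sup>2)"
    by (simp add: inner_sum_right power2_eq_square)
  have "(norm ?p)\<^sup>2 = (\<Sum>i\<in>F. (norm ((v \<bullet> u i) *\<^sub>R u i))\<^sup>2)"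
    using assms by (intro norm_sum_orthogonal) (auto simp: ons_def)
  also have "\<dots> = (\<Sum>i\<in>F. (v \<bullet> u i)\<^sup>2)"
    using assms by (intro sum.cong refl) (auto simp: ons_def power_mult_distrib power2_norm_eq_inner)
  finally have 2: "?p \<bullet> ?p = (\<Sum>i\<in>F. (v \<bullet> u i)\<^sup>2)" by (simp add: power2_norm_eq_inner)
  have "0 \<le> (v - ?p) \<bullet> (v - ?p)" by simp
  also have "\<dots> = v \<bullet> v - (v \<bullet> ?p) - (?p \<bullet> v) + ?p \<bullet> ?p"
    unfolding inner_diff_left inner_diff_right by simp
  also have "\<dots> = v \<bullet> v - (\<Sum>i\<in>F. (v \<bullet> u i)\<^sup>2)"
    using 1 2 by (simp only: inner_commute[of ?p v])
  finally show ?thesis by (simp add: power2_norm_eq_inner)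
qed

text \<open>A real weighted partial isometry, \<open>u i\<close> \<mapsto> \<open>c i\<close> times
  \<open>w i\<close>, zero on the orthogonal complement of the \<open>u i\<close>. Linearity over
  larger scalars is obtained later by averaging.\<close>

definition Kop :: "'i set \<Rightarrow> ('i \<Rightarrow> real) \<Rightarrow> ('i \<Rightarrow> 'e) \<Rightarrow> ('i \<Rightarrow> 'e) \<Rightarrow> 'e::{real_inner,complete_space} \<Rightarrow>\<^sub>L 'e" where
  "Kop I c u w = strong_sum I (\<lambda>i. Blinfun (\<lambda>v. (c i * (v \<bullet> u i)) *\<^sub>R w i))"

definition bounded_on :: "'i set \<Rightarrow> ('i \<Rightarrow> real) \<Rightarrow> bool" where
  "bounded_on I c \<longleftrightarrow> (\<exists>C. \<forall>i\<in>I. \<bar>c i\<bar> \<le> C)"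

lemma bounded_onD:
  assumes "bounded_on I c"
  shows "\<exists>C\<ge>0. \<forall>i\<in>I. \<bar>c i\<bar> \<le> C"
proof -
  obtain C where "\<forall>i\<in>I. \<bar>c i\<bar> \<le> C" using assms unfolding bounded_on_def by blast
  then have "\<forall>i\<in>I. \<bar>c i\<bar> \<le> max 0 C" by fastforce
  then show ?thesis using max.cobounded1 by blast
qed

lemma bounded_on_const[simp]: "bounded_on I (\<lambda>i. r)"
  unfolding bounded_on_def by auto

lemma bounded_on_mult: "bounded_on I c \<Longrightarrow> bounded_on I c' \<Longrightarrow> bounded_on I (\<lambda>i. c i * c' i)"
proof -
  assume "bounded_on I c" "bounded_on I c'"
  then obtain C C' where C: "0 \<le> C" "\<forall>i\<in>I. \<bar>c i\<bar> \<le> C" and C': "0 \<le> C'" "\<forall>i\<in>I. \<bar>c' i\<bar> \<le> C'"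
    by (blast dest: bounded_onD)
  have "\<bar>c i * c' i\<bar> \<le> C * C'" if "i \<in> I" for i
    unfolding abs_mult by (rule mult_mono) (use C C' that in simp_all)
  then show ?thesis unfolding bounded_on_def by blast
qed

lemma rank_one_apply: "blinfun_apply (Blinfun (\<lambda>v. (r * (v \<bullet> u)) *\<^sub>R w)) v = (r * (v \<bullet> u)) *\<^sub>R w"
proof -
  have "bounded_linear (\<lambda>v. (r * (v \<bullet> u)) *\<^sub>R w)"
    by (intro bounded_linear_scaleR_const bounded_linear_const_mult bounded_linear_inner_left)
  then show ?thesis by (simp add: bounded_linear_Blinfun_apply)
qed

lemma Kop_orth_family:
  fixes u w :: "'i \<Rightarrow> 'e::{real_inner,complete_space}"
  assumes "ons I u" "ons I w" "0 \<le> C" "\<And>i. i \<in> I \<Longrightarrow> \<bar>c i\<bar> \<le> C"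
  shows "orth_family I (\<lambda>i. Blinfun (\<lambda>v. (c i * (v \<bullet> u i)) *\<^sub>R w i)) C TYPE('e)"
  unfolding orth_family_def rank_one_apply
proof (intro conjI ballI impI allI)
  fix F v assume F: "finite F" "F \<subseteq> I"
  have "(\<Sum>i\<in>F. (norm ((c i * (v \<bullet> u i)) *\<^sub>R w i))\<^sup>2) = (\<Sum>i\<in>F. (c i)\<^sup>2 * (v \<bullet> u i)\<^sup>2)"
    using assms(2) F by (intro sum.cong refl) (auto simp: ons_def power_mult_distrib power2_norm_eq_inner subset_iff)
  also have "\<dots> \<le> (\<Sum>i\<in>F. C\<^sup>2 * (v \<bullet> u i)\<^sup>2)"
    using assms(3,4) F by (intro sum_mono mult_right_mono) (auto simp: power2_le_iff_abs_le subset_iff)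
  also have "\<dots> \<le> C\<^sup>2 * (norm v)\<^sup>2"
    unfolding sum_distrib_left[symmetric]
    by (intro mult_left_mono Bessel_inequality) (use assms F in \<open>auto simp: ons_def subset_iff\<close>)
  finally show "(\<Sum>i\<in>F. (norm ((c i * (v \<bullet> u i)) *\<^sub>R w i))\<^sup>2) \<le> (C * norm v)\<^sup>2"
    by (simp add: power_mult_distrib)
qed (use assms in \<open>auto simp: ons_def\<close>)

lemma
  fixes u w :: "'i \<Rightarrow> 'e::{real_inner,complete_space}"
  assumes "ons I u" "ons I w" "bounded_on I c"
  shows Kop_summable: "(\<lambda>i. (c i * (v \<bullet> u i)) *\<^sub>R w i) summable_on I"
    and Kop_apply: "Kop I c u w v = (\<Sum>\<^sub>\<infinity>i\<in>I. (c i * (v \<bullet> u i)) *\<^sub>R w i)"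
proof -
  obtain C where C: "0 \<le> C" "\<forall>i\<in>I. \<bar>c i\<bar> \<le> C"
    using bounded_onD[OF assms(3)] by blast
  note o = Kop_orth_family[OF assms(1,2) C(1) bspec[OF C(2)]]
  show "(\<lambda>i. (c i * (v \<bullet> u i)) *\<^sub>R w i) summable_on I"
    using strong_sum_summable[OF o] by (simp add: rank_one_apply)
  show "Kop I c u w v = (\<Sum>\<^sub>\<infinity>i\<in>I. (c i * (v \<bullet> u i)) *\<^sub>R w i)"
    using strong_sum_apply[OF o] by (simp add: rank_one_apply Kop_def)
qed

lemma norm_Kop:
  fixes u w :: "'i \<Rightarrow> 'e::{real_inner,complete_space}"
  assumes "ons I u" "ons I w" "0 \<le> C" "\<And>i. i \<in> I \<Longrightarrow> \<bar>c i\<bar> \<le> C"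
  shows "norm (Kop I c u w) \<le> C"
  unfolding Kop_def by (rule norm_strong_sum[OF Kop_orth_family[OF assms]])

lemma blinfun_Kop:
  fixes u w :: "'i \<Rightarrow> 'e::{real_inner,complete_space}" and L :: "'e \<Rightarrow>\<^sub>L 'b::real_normed_vector"
  assumes "ons I u" "ons I w" "bounded_on I c"
  shows "L (Kop I c u w v) = (\<Sum>\<^sub>\<infinity>i\<in>I. (c i * (v \<bullet> u i)) *\<^sub>R L (w i))"
  unfolding Kop_apply[OF assms] using infsum_bounded_linear(1)[OF blinfun.bounded_linear_right Kop_summable[OF assms]]
  by (simp add: blinfun.scaleR_right)

lemma Kop_inner:
  fixes u w :: "'i \<Rightarrow> 'e::{real_inner,complete_space}"
  assumes "ons I u" "ons I w" "bounded_on I c"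
  shows "Kop I c u w v \<bullet> z = (\<Sum>\<^sub>\<infinity>i\<in>I. c i * (v \<bullet> u i) * (w i \<bullet> z))"
  unfolding Kop_apply[OF assms]
    using infsum_bounded_linear(1)[OF bounded_linear_inner_left Kop_summable[OF assms]]
  by simp

lemma Kop_adjoint:
  fixes u w :: "'i \<Rightarrow> 'e::{real_inner,complete_space}"
  assumes "ons I u" "ons I w" "bounded_on I c"
  shows "Kop I c u w v \<bullet> z = v \<bullet> Kop I c w u z"
  using Kop_inner[OF assms, of v z] Kop_inner[OF assms(2,1,3), of z v]
  by (simp add: inner_commute mult_ac)

lemma infsum_single:
  assumes "\<And>i. i \<in> I \<Longrightarrow> i \<noteq> j \<Longrightarrow> f i = 0" "j \<in> I"
  shows "infsum f I = (f j :: 'a::{comm_monoid_add,t2_space})"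
proof -
  have "infsum f I = infsum f {j}"
    by (rule infsum_cong_neutral) (use assms in auto)
  then show ?thesis by simp
qed

lemma Kop_inner_basis:
  fixes u w :: "'i \<Rightarrow> 'e::{real_inner,complete_space}"
  assumes "ons I u" "ons I w" "bounded_on I c" "j \<in> I"
  shows "Kop I c u w v \<bullet> w j = c j * (v \<bullet> u j)"
  unfolding Kop_inner[OF assms(1,2,3)]
  by (subst infsum_single[where j = j]) (use assms in \<open>auto simp: ons_def\<close>)

lemma Kop_inner_orth:
  fixes u w :: "'i \<Rightarrow> 'e::{real_inner,complete_space}"
  assumes "ons I u" "ons I w" "bounded_on I c" "\<And>i. i \<in> I \<Longrightarrow> w i \<bullet> z = 0"
  shows "Kop I c u w v \<bullet> z = 0"
  unfolding Kop_inner[OF assms(1,2,3)] using assms(4) by (simp cong: infsum_cong)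

lemma Kop_basis:
  fixes u w :: "'i \<Rightarrow> 'e::{real_inner,complete_space}"
  assumes "ons I u" "ons I w" "bounded_on I c" "j \<in> I"
  shows "Kop I c u w (u j) = c j *\<^sub>R w j"
  unfolding Kop_apply[OF assms(1,2,3)]
  by (subst infsum_single[where j = j]) (use assms in \<open>auto simp: ons_def\<close>)

lemma Kop_orth:
  fixes u w :: "'i \<Rightarrow> 'e::{real_inner,complete_space}"
  assumes "ons I u" "ons I w" "bounded_on I c" "\<And>i. i \<in> I \<Longrightarrow> v \<bullet> u i = 0"
  shows "Kop I c u w v = 0"
  unfolding Kop_apply[OF assms(1,2,3)] using assms(4) by (simp cong: infsum_cong)

lemma Kop_Kop:
  fixes u w u' :: "'i \<Rightarrow> 'e::{real_inner,complete_space}"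
  assumes "ons I u" "ons I w" "ons I u'" "bounded_on I c" "bounded_on I c'"
  shows "Kop I c u w (Kop I c' u' u v) = Kop I (\<lambda>i. c i * c' i) u' w v"
  unfolding Kop_apply[OF assms(1,2,4)] Kop_apply[OF assms(3,2) bounded_on_mult[OF assms(4,5)]]
  by (intro infsum_cong) (simp add: Kop_inner_basis assms)

lemma Kop_minus:
  "Kop I c (\<lambda>i. - u i) (\<lambda>i. - w i) = Kop I c u (w :: 'i \<Rightarrow> 'e::{real_inner,complete_space})"
  unfolding Kop_def by simp

lemma Kop_reindex:
  assumes "bij_betw h J I"
  shows "Kop I c u w = Kop J (c \<circ> h) (u \<circ> h) (w \<circ> h :: _ \<Rightarrow> 'e::{real_inner,complete_space})"
  unfolding Kop_def strong_sum_def
  by (intro arg_cong[where f = Blinfun] ext)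
    (simp add: infsum_reindex_bij_betw[OF assms, symmetric])

lemma Kop_Un:
  fixes u w :: "'i \<Rightarrow> 'e::{real_inner,complete_space}"
  assumes "ons (I \<union> J) u" "ons (I \<union> J) w" "bounded_on (I \<union> J) c" "I \<inter> J = {}"
  shows "Kop (I \<union> J) c u w v = Kop I c u w v + Kop J c u w v"
proof -
  have *: "ons I u" "ons I w" "bounded_on I c" "ons J u" "ons J w" "bounded_on J c"
    using assms by (auto simp: ons_def bounded_on_def)
  show ?thesis
    unfolding Kop_apply[OF assms(1,2,3)] Kop_apply[OF *(1,2,3)] Kop_apply[OF *(4,5,6)]
    by (rule infsum_Un_disjoint) (use Kop_summable * assms in auto)
qed

lemma isometry_Kop:
  fixes u w :: "'i \<Rightarrow> 'e::{real_inner,complete_space}" and a :: "'e \<Rightarrow>\<^sub>L 'e"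
  assumes "ons I u" "ons I w" "bounded_on I c" "\<And>v w. a v \<bullet> a w = v \<bullet> w"
  shows "a (Kop I c u w v) = Kop I c (\<lambda>i. a (u i)) (\<lambda>i. a (w i)) (a v)"
proof -
  have "ons I (\<lambda>i. a (u i))" "ons I (\<lambda>i. a (w i))" using assms by (auto simp: ons_def)
  then show ?thesis
    unfolding blinfun_Kop[OF assms(1,2,3)] using assms by (simp add: Kop_apply)
qed

section \<open>Finite groups of isometries and the groups they define\<close>

lemma blinfun_compose_assoc: "(a o\<^sub>L b) o\<^sub>L c = a o\<^sub>L (b o\<^sub>L c)"
  by (rule blinfun_eqI) simp

definition act :: "('a::real_normed_vector \<Rightarrow>\<^sub>L 'b::real_normed_vector) \<Rightarrow> ('i \<Rightarrow> 'a) \<Rightarrow> 'i \<Rightarrow> 'b" where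
  "act a u = (\<lambda>i. blinfun_apply a (u i))"

lemma act_apply[simp]: "act a u i = a (u i)"
  by (simp add: act_def)

lemma act_id[simp]: "act id_blinfun u = u"
  by (simp add: act_def)

lemma act_uminus: "act (- a) u = (\<lambda>i. - act a u i)"
  by (simp add: act_def blinfun.minus_left)

lemma Kop_act_uminus[simp]: "Kop I c (act (- a) u) (act (- a) w) = Kop I c (act a u) (act a w)"
  by (simp only: act_uminus Kop_minus)

lemma act_o: "act a u \<circ> h = act a (u \<circ> h)"
  by (simp add: act_def o_def)

lemma blinfun_compose_id[simp]: "id_blinfun o\<^sub>L a = a" "a o\<^sub>L id_blinfun = a"
  by (auto intro: blinfun_eqI)

text \<open>The ten groups share one description. A finite group \<open>Z\<close> of isometries of the real Hilbert space \<open>E\<close>,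
  containing \<open>-1\<close>, has a subgroup \<open>U\<close> of index at most two; the group \<open>Gr\<close> below consists of the
  invertible operators that commute with \<open>U\<close> (linearity over the scalars) and preserve the forms
  \<open>v \<bullet> a w\<close> for \<open>a \<in> Z - U\<close>. The case \<open>Z = U\<close> gives the general linear groups.\<close>

locale free_action =
  fixes Z U :: "('e::{real_inner,complete_space} \<Rightarrow>\<^sub>L 'e) set"
  assumes finite_Z: "finite Z" and U_subset: "U \<subseteq> Z"
    and id_U: "id_blinfun \<in> U"
    and uminus_U: "a \<in> U \<Longrightarrow> - a \<in> U" and uminus_Z: "a \<in> Z \<Longrightarrow> - a \<in> Z"
    and compose_U: "a \<in> U \<Longrightarrow> c \<in> U \<Longrightarrow> a o\<^sub>L c \<in> U"
    and compose_Z: "a \<in> Z \<Longrightarrow> c \<in> Z \<Longrightarrow> a o\<^sub>L c \<in> Z"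
    and compose_V: "a \<in> Z - U \<Longrightarrow> c \<in> Z - U \<Longrightarrow> a o\<^sub>L c \<in> U"
    and isometry_Z: "a \<in> Z \<Longrightarrow> a v \<bullet> a w = v \<bullet> w"
    and skew_U: "a \<in> U \<Longrightarrow> a \<noteq> id_blinfun \<Longrightarrow> a \<noteq> - id_blinfun \<Longrightarrow> v \<bullet> a v = 0"
    and nontrivial: "id_blinfun \<noteq> (- id_blinfun :: 'e \<Rightarrow>\<^sub>L 'e)"
begin

definition V where "V = Z - U"

lemma V_subset: "V \<subseteq> Z" and U_V_disjoint: "U \<inter> V = {}" "V \<inter> U = {}" and Z_eq: "Z = U \<union> V"
  using U_subset by (auto simp: V_def)

lemma id_Z: "id_blinfun \<in> Z" using id_U U_subset by blast

lemma uminus_V: "a \<in> V \<Longrightarrow> - a \<in> V"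
  unfolding V_def using uminus_Z uminus_U[of "- a"] by auto

text \<open>Isometries are left cancellable, and between finite sets of equal size an injection is a
  bijection.\<close>

lemma compose_bij:
  assumes "a \<in> Z" "X \<subseteq> Z" "Y \<subseteq> Z" "card X = card Y" "\<And>x. x \<in> X \<Longrightarrow> a o\<^sub>L x \<in> Y"
  shows "bij_betw (\<lambda>x. a o\<^sub>L x) X Y"
proof -
  have inj: "inj_on (\<lambda>x. a o\<^sub>L x) X"
  proof (rule inj_onI)
    fix x y assume eq: "a o\<^sub>L x = a o\<^sub>L y"
    show "x = y"
    proof (rule blinfun_eqI)
      fix v
      have "a (x v - y v) = 0"
        using arg_cong[OF eq, of "\<lambda>z. z v"] by (simp add: blinfun.diff_right)
      then have "(x v - y v) \<bullet> (x v - y v) = 0"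
        using isometry_Z[OF assms(1), of "x v - y v" "x v - y v"] by simp
      then show "x v = y v" by simp
    qed
  qed
  have fin: "finite Y" using assms finite_Z finite_subset by blast
  have "(\<lambda>x. a o\<^sub>L x) ` X \<subseteq> Y" using assms by auto
  then have "(\<lambda>x. a o\<^sub>L x) ` X = Y"
    using card_image[OF inj] assms(4) by (intro card_subset_eq fin) auto
  then show ?thesis using inj by (simp add: bij_betw_def)
qed

text \<open>In a finite set closed under products, left multiplication by \<open>a\<close> is onto
  and hence reaches the identity. This right inverse is also a left inverse because the isometry
  \<open>a\<close> is injective.\<close>

lemma inverse_in:
  assumes "a \<in> X" "X = U \<or> X = Z"
  obtains x where "x \<in> X" "a o\<^sub>L x = id_blinfun" "x o\<^sub>L a = id_blinfun"
proof -
  have aZ: "a \<in> Z" using assms U_subset by auto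
  have "bij_betw (\<lambda>x. a o\<^sub>L x) X X"
    using assms compose_U compose_Z U_subset aZ by (intro compose_bij) auto
  moreover have "id_blinfun \<in> X" using assms id_U id_Z by auto
  ultimately obtain x where x: "x \<in> X" "a o\<^sub>L x = id_blinfun" unfolding bij_betw_def by force
  have "a (x (a v) - v) = 0" for v
    using arg_cong[OF x(2), of "\<lambda>z. z (a v)"] by (simp add: blinfun.diff_right)
  then have "(x (a v) - v) \<bullet> (x (a v) - v) = 0" for v
    using isometry_Z[OF aZ, of "x (a v) - v" "x (a v) - v"] by simp
  then have "x o\<^sub>L a = id_blinfun" by (intro blinfun_eqI) simp
  then show thesis using x that by blast
qed

text \<open>If the product were in \<open>U\<close>, cancelling \<open>a\<close> would put
  \<open>c\<close> into \<open>U\<close>.\<close>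

lemma compose_UV: "a \<in> U \<Longrightarrow> c \<in> V \<Longrightarrow> a o\<^sub>L c \<in> V"
proof -
  assume a: "a \<in> U" and c: "c \<in> V"
  obtain x where x: "x \<in> U" "x o\<^sub>L a = id_blinfun" using inverse_in[of a U] a by blast
  have "c = x o\<^sub>L (a o\<^sub>L c)"
    using arg_cong[OF x(2), of "\<lambda>z. z o\<^sub>L c"] by (auto simp: blinfun_compose_assoc intro!: blinfun_eqI)
  then have "a o\<^sub>L c \<notin> U" using compose_U[OF x(1), of "a o\<^sub>L c"] c by (auto simp: V_def)
  then show "a o\<^sub>L c \<in> V" using a c compose_Z U_subset by (auto simp: V_def)
qed

lemma compose_VU: "a \<in> V \<Longrightarrow> c \<in> U \<Longrightarrow> a o\<^sub>L c \<in> V"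
proof -
  assume a: "a \<in> V" and c: "c \<in> U"
  obtain x where x: "x \<in> U" "c o\<^sub>L x = id_blinfun" using inverse_in[of c U] c by blast
  have "a = (a o\<^sub>L c) o\<^sub>L x"
    using x(2) by (simp add: blinfun_compose_assoc)
  then have "a o\<^sub>L c \<notin> U" using compose_U[of "a o\<^sub>L c" x] x(1) a by (auto simp: V_def)
  then show "a o\<^sub>L c \<in> V" using a c compose_Z U_subset by (auto simp: V_def)
qed

lemma bij_UU: "a \<in> U \<Longrightarrow> bij_betw (\<lambda>x. a o\<^sub>L x) U U"
  and bij_UV: "a \<in> U \<Longrightarrow> bij_betw (\<lambda>x. a o\<^sub>L x) V V"
  using U_subset V_subset compose_U compose_UV by (auto intro!: compose_bij)

text \<open>Multiplication by an element of \<open>V\<close> injects \<open>U\<close> into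
  \<open>V\<close> and \<open>V\<close> into \<open>U\<close>, so the index is exactly two once
  \<open>V\<close> is inhabited.\<close>

lemma card_U_V: "a \<in> V \<Longrightarrow> card U = card V"
proof -
  assume a: "a \<in> V"
  then have aZ: "a \<in> Z" using V_subset by blast
  have inj: "inj_on (\<lambda>x. a o\<^sub>L x) Z"
    using compose_bij[OF aZ, of Z Z] compose_Z aZ by (auto simp: bij_betw_def)
  have fin: "finite U" "finite V" using finite_Z finite_subset U_subset V_subset by blast+
  have "card U \<le> card V"
    using inj_on_subset[OF inj U_subset] compose_VU[OF a] fin by (intro card_inj_on_le) auto
  moreover have "card V \<le> card U"
    using inj_on_subset[OF inj V_subset] compose_V a fin by (intro card_inj_on_le) (auto simp: V_def)
  ultimately show ?thesis by simp
qed

lemma bij_VU: "a \<in> V \<Longrightarrow> bij_betw (\<lambda>x. a o\<^sub>L x) U V"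
  and bij_VV: "a \<in> V \<Longrightarrow> bij_betw (\<lambda>x. a o\<^sub>L x) V U"
  using U_subset V_subset compose_V compose_VU card_U_V unfolding V_def
  by (auto intro!: compose_bij)

text \<open>A family \<open>u\<close> is a \<open>fons\<close> (free orthonormal system) if \<open>Z\<close> acts freely on it up to sign and all vectors
  \<open>a (u i)\<close> are orthonormal up to sign. \<open>zorth\<close> is orthogonality of the \<open>Z\<close>-invariant spans.\<close>

definition fons :: "'i set \<Rightarrow> ('i \<Rightarrow> 'e) \<Rightarrow> bool" where
  "fons I u \<longleftrightarrow> (\<forall>i\<in>I. \<forall>j\<in>I. \<forall>a\<in>Z. u i \<bullet> act a u j =
     (if i = j then if a = id_blinfun then 1 else if a = - id_blinfun then - 1 else 0 else 0))"

definition zorth :: "'i set \<Rightarrow> ('i \<Rightarrow> 'e) \<Rightarrow> 'j set \<Rightarrow> ('j \<Rightarrow> 'e) \<Rightarrow> bool" where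
  "zorth I u J w \<longleftrightarrow> (\<forall>i\<in>I. \<forall>j\<in>J. \<forall>a\<in>Z. u i \<bullet> act a w j = 0)"

text \<open>The witness is the inverse of \<open>a\<close> times \<open>c\<close>. Moving isometries
  to one side reduces products of two translates to the one-sided conditions in \<open>fons\<close>
  and \<open>zorth\<close>.\<close>

lemma inner_move:
  assumes "a \<in> Z" "c \<in> Z"
  shows "\<exists>x\<in>Z. (\<forall>v w. a v \<bullet> c w = v \<bullet> blinfun_apply x w) \<and> (x = id_blinfun \<longleftrightarrow> c = a) \<and> (x = - id_blinfun \<longleftrightarrow> c = - a)"
proof -
  obtain y where y: "y \<in> Z" "a o\<^sub>L y = id_blinfun" "y o\<^sub>L a = id_blinfun" using inverse_in[of a Z] assms by blast
  have ay: "a (y v) = v" "y (a v) = v" for v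
    using arg_cong[OF y(2), of "\<lambda>z. z v"] arg_cong[OF y(3), of "\<lambda>z. z v"] by simp_all
  have "a v \<bullet> c w = v \<bullet> (y o\<^sub>L c) w" for v w
    using isometry_Z[OF y(1), of "a v" "c w"] ay by simp
  moreover have "y o\<^sub>L c = id_blinfun \<longleftrightarrow> c = a"
    by (metis y(2,3) blinfun_compose_assoc blinfun_compose_id)
  moreover have "y o\<^sub>L c = - id_blinfun \<longleftrightarrow> c = - a"
  proof
    assume h: "y o\<^sub>L c = - id_blinfun"
    show "c = - a"
      using arg_cong[OF h, of "\<lambda>z. a (z v)" for v] ay
      by (intro blinfun_eqI) (simp add: blin_simps)
  next
    assume "c = - a"
    then show "y o\<^sub>L c = - id_blinfun" by (intro blinfun_eqI) (simp add: blin_simps ay)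
  qed
  ultimately show ?thesis using compose_Z[OF y(1) assms(2)] by blast
qed

lemma fons_inner:
  assumes "fons I u" "a \<in> Z" "c \<in> Z" "i \<in> I" "j \<in> I"
  shows "a (u i) \<bullet> c (u j) = (if i = j then if c = a then 1 else if c = - a then - 1 else 0 else 0)"
proof -
  obtain x where "x \<in> Z" "\<forall>v w. a v \<bullet> c w = v \<bullet> blinfun_apply x w" "x = id_blinfun \<longleftrightarrow> c = a" "x = - id_blinfun \<longleftrightarrow> c = - a"
    using inner_move[OF assms(2,3)] by blast
  then show ?thesis using assms by (auto simp: fons_def)
qed

lemma zorth_inner:
  assumes "zorth I u J w" "a \<in> Z" "c \<in> Z" "i \<in> I" "j \<in> J"
  shows "a (u i) \<bullet> c (w j) = 0"
proof -
  obtain x where "x \<in> Z" "\<forall>v w. a v \<bullet> c w = v \<bullet> blinfun_apply x w"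
    using inner_move[OF assms(2,3)] by blast
  then show ?thesis using assms by (auto simp: zorth_def)
qed

lemma zorth_sym: "zorth I u J w \<Longrightarrow> zorth J w I u"
  unfolding zorth_def[of J w I u]
  using zorth_inner[OF _ _ id_Z] by (auto simp: inner_commute)

lemma fons_ons: "fons I u \<Longrightarrow> a \<in> Z \<Longrightarrow> ons I (act a u)"
  by (auto simp: ons_def fons_inner)

lemma fons_ons': "fons I u \<Longrightarrow> ons I u"
  using fons_ons[OF _ id_Z] by simp

lemma neq_uminus: "a \<in> Z \<Longrightarrow> a \<noteq> - a"
proof
  assume "a \<in> Z" and eq: "a = - a"
  then obtain y where y: "y o\<^sub>L a = id_blinfun" using inverse_in[of a Z] by blast
  have "id_blinfun = - (id_blinfun :: 'e \<Rightarrow>\<^sub>L 'e)"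
  proof (rule blinfun_eqI)
    fix v
    have "a v = - a v" using arg_cong[OF eq, of "\<lambda>z. z v"] by (simp add: blin_simps)
    then have "y (a v) = - y (a v)" by (metis blinfun.minus_right)
    then show "id_blinfun v = (- id_blinfun) v" using arg_cong[OF y, of "\<lambda>z. z v"]
      by (simp add: blin_simps)
  qed
  then show False using nontrivial by simp
qed

text \<open>\<open>Kop I c u w\<close> averaged over \<open>X\<close>, where \<open>X\<close> is \<open>U\<close> or its complement \<open>V\<close>. The factor \<open>1/2\<close> occurs because
  \<open>a\<close> and \<open>- a\<close> contribute the same term. Operators with \<open>X = U\<close> and \<open>X = V\<close> act on the two halves of a
  hyperbolic space \<open>W \<oplus> W'\<close>; if \<open>Z = U\<close> the second half is absent.\<close>

definition KX :: "('e \<Rightarrow>\<^sub>L 'e) set \<Rightarrow> 'i set \<Rightarrow> ('i \<Rightarrow> real) \<Rightarrow> ('i \<Rightarrow> 'e) \<Rightarrow> ('i \<Rightarrow> 'e) \<Rightarrow> 'e \<Rightarrow>\<^sub>L 'e" where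
  "KX X I c u w = (1/2) *\<^sub>R (\<Sum>a\<in>X. Kop I c (act a u) (act a w))"

lemma KX_apply: "KX X I c u w v = (1/2) *\<^sub>R (\<Sum>a\<in>X. Kop I c (act a u) (act a w) v)"
  by (simp add: KX_def blin_simps)

lemma KX_adjoint:
  assumes "X \<subseteq> Z" "fons I u" "fons I w" "bounded_on I c"
  shows "KX X I c u w v \<bullet> z = v \<bullet> KX X I c w u z"
  unfolding KX_apply inner_sum_left inner_scaleR_left inner_sum_right inner_scaleR_right
  using assms by (intro arg_cong[where f = "(*) (1/2)"] sum.cong refl Kop_adjoint) (auto intro: fons_ons)

lemma KX_orth:
  assumes "X \<subseteq> Z" "fons I u" "fons I w" "bounded_on I c" "\<And>i a. i \<in> I \<Longrightarrow> a \<in> X \<Longrightarrow> v \<bullet> a (u i) = 0"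
  shows "KX X I c u w v = 0"
  unfolding KX_apply
  using assms by (subst sum.neutral) (auto intro!: Kop_orth fons_ons)

lemma KX_KX_orth:
  assumes "X \<subseteq> Z" "Y \<subseteq> Z" "fons I u" "fons I w" "fons J u'" "fons J w'" "bounded_on I c" "bounded_on J c'"
    "zorth J w' I u"
  shows "KX X I c u w (KX Y J c' u' w' v) = 0"
proof (rule KX_orth[OF assms(1,3,4,7)])
  fix i a assume i: "i \<in> I" "a \<in> X"
  have "Kop J c' (act b u') (act b w') v \<bullet> a (u i) = 0" if "b \<in> Y" for b
    by (rule Kop_inner_orth) (use assms that i in \<open>auto intro: fons_ons zorth_inner\<close>)
  then show "KX Y J c' u' w' v \<bullet> a (u i) = 0"
    unfolding KX_apply by (simp add: inner_sum_left)
qed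

text \<open>Two translates of a free system agree up to sign or are orthogonal, so only the pairs
  with \<open>b = a\<close> or \<open>b = - a\<close> survive in a product of two averages.\<close>

lemma Kop_Kop_aux:
  assumes "fons I u" "fons I w" "fons I u'" "bounded_on I c" "bounded_on I c'" "a \<in> Z" "b \<in> Z"
  shows "Kop I c (act a u) (act a w) (Kop I c' (act b u') (act b u) v) =
    (if b = a \<or> b = - a then Kop I (\<lambda>i. c i * c' i) (act a u') (act a w) v else 0)"
proof -
  have same: "Kop I c (act a u) (act a w) (Kop I c' (act a u') (act a u) v) =
     Kop I (\<lambda>i. c i * c' i) (act a u') (act a w) v"
    using assms by (intro Kop_Kop) (auto intro: fons_ons)
  show ?thesis
  proof (cases "b = a \<or> b = - a")
    case True
    then show ?thesis using same
      by auto
  next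
    case False
    have "Kop I c (act a u) (act a w) (Kop I c' (act b u') (act b u) v) = 0"
    proof (rule Kop_orth)
      fix i assume "i \<in> I"
      have ne: "a \<noteq> b" "a \<noteq> - b" using False by auto
      show "Kop I c' (act b u') (act b u) v \<bullet> act a u i = 0"
        by (rule Kop_inner_orth) (use assms \<open>i \<in> I\<close> ne in \<open>auto intro: fons_ons simp: fons_inner\<close>)
    qed (use assms in \<open>auto intro: fons_ons\<close>)
    then show ?thesis using False by auto
  qed
qed

text \<open>Every \<open>a\<close> meets exactly two partners, \<open>a\<close> and
  \<open>- a\<close>, and the resulting 2 turns the product 1/4 of the normalizations back into
  1/2.\<close>

lemma KX_KX_same:
  assumes "X \<subseteq> Z" "\<And>a. a \<in> X \<Longrightarrow> - a \<in> X" "fons I u" "fons I w" "fons I u'" "bounded_on I c" "bounded_on I c'"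
  shows "KX X I c u w (KX X I c' u' u v) = KX X I (\<lambda>i. c i * c' i) u' w v"
proof -
  have fin: "finite X" using assms(1) finite_Z finite_subset by blast
  let ?T = "\<lambda>a. Kop I (\<lambda>i. c i * c' i) (act a u') (act a w) v"
  have "KX X I c u w (KX X I c' u' u v) = (1/4) *\<^sub>R (\<Sum>a\<in>X. \<Sum>b\<in>X. if b = a \<or> b = - a then ?T a else 0)"
    unfolding KX_apply blin_simps scaleR_sum_right scaleR_scaleR
    using assms Kop_Kop_aux[OF assms(3-7)] by (intro sum.cong refl) (auto simp: subset_iff)
  also have "(\<Sum>a\<in>X. \<Sum>b\<in>X. if b = a \<or> b = - a then ?T a else 0) = (\<Sum>a\<in>X. 2 *\<^sub>R ?T a)"
  proof (rule sum.cong[OF refl])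
    fix a assume a: "a \<in> X"
    have "(\<Sum>b\<in>X. if b = a \<or> b = - a then ?T a else 0) = (\<Sum>b\<in>{a, - a}. ?T a)"
      using fin a assms(2)[OF a] by (intro sum.mono_neutral_cong_right) auto
    also have "\<dots> = 2 *\<^sub>R ?T a"
      using neq_uminus[of a] assms(1) a by (auto simp: scaleR_2)
    finally show "(\<Sum>b\<in>X. if b = a \<or> b = - a then ?T a else 0) = 2 *\<^sub>R ?T a" .
  qed
  finally show ?thesis
    by (simp add: KX_apply scaleR_sum_right)
qed

lemma KX_KX_diff:
  assumes "X \<subseteq> Z" "Y \<subseteq> Z" "\<And>a. a \<in> X \<Longrightarrow> - a \<in> X" "X \<inter> Y = {}"
    "fons I u" "fons I w" "fons I u'" "bounded_on I c" "bounded_on I c'"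
  shows "KX X I c u w (KX Y I c' u' u v) = 0"
proof -
  have "Kop I c (act a u) (act a w) (Kop I c' (act b u') (act b u) v) = 0"
    if "a \<in> X" "b \<in> Y" for a b
  proof -
    have "b \<noteq> a" "b \<noteq> - a" using that assms(3,4) by auto
    then show ?thesis using Kop_Kop_aux[OF assms(5-9), of a b] that assms(1,2) by auto
  qed
  then show ?thesis
    unfolding KX_apply blin_simps scaleR_sum_right by simp
qed

text \<open>Conjugation by \<open>a\<close> only relabels the translates. Elements of
  \<open>U\<close> therefore commute with both averages, while elements of \<open>V\<close> exchange
  them.\<close>

lemma Z_KX:
  assumes "a \<in> Z" "X \<subseteq> Z" "bij_betw (\<lambda>x. a o\<^sub>L x) X Y" "fons I u" "fons I w" "bounded_on I c"
  shows "a (KX X I c u w v) = KX Y I c u w (a v)"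
proof -
  have "a (KX X I c u w v) = (1/2) *\<^sub>R (\<Sum>x\<in>X. Kop I c (act (a o\<^sub>L x) u) (act (a o\<^sub>L x) w) (a v))"
    unfolding KX_apply blin_simps
  proof (intro arg_cong[where f = "(*\<^sub>R) (1/2)"] sum.cong refl)
    fix x assume "x \<in> X"
    then have "x \<in> Z" using assms(2) by blast
    then show "a (Kop I c (act x u) (act x w) v) = Kop I c (act (a o\<^sub>L x) u) (act (a o\<^sub>L x) w) (a v)"
      using isometry_Kop[of I "act x u" "act x w" c a v] fons_ons[of I u x] fons_ons[of I w x] assms isometry_Z
      by (simp add: act_def)
  qed
  also have "(\<Sum>x\<in>X. Kop I c (act (a o\<^sub>L x) u) (act (a o\<^sub>L x) w) (a v)) =
     (\<Sum>x\<in>Y. Kop I c (act x u) (act x w) (a v))"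
    by (rule sum.reindex_bij_betw[OF assms(3)])
  finally show ?thesis by (simp add: KX_apply)
qed

lemma norm_KX:
  assumes "X \<subseteq> Z" "fons I u" "fons I w" "0 \<le> C" "\<And>i. i \<in> I \<Longrightarrow> \<bar>c i\<bar> \<le> C"
  shows "norm (KX X I c u w) \<le> C * card Z"
proof -
  have "norm (KX X I c u w) \<le> (1/2) * (\<Sum>a\<in>X. norm (Kop I c (act a u) (act a w)))"
    unfolding KX_def norm_scaleR by (simp add: norm_sum)
  also have "\<dots> \<le> 1 * (\<Sum>a\<in>X. C)"
    using assms by (intro mult_mono sum_mono norm_Kop) (auto intro: fons_ons sum_nonneg)
  also have "\<dots> = C * card X" by simp
  also have "\<dots> \<le> C * card Z"
    using assms finite_Z by (intro mult_left_mono) (auto intro: card_mono)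
  finally show ?thesis .
qed

lemma KX_reindex:
  assumes "bij_betw h J I"
  shows "KX X I c u w = KX X J (c \<circ> h) (u \<circ> h) (w \<circ> h)"
  unfolding KX_def Kop_reindex[OF assms] act_o ..

lemma KX_Un:
  assumes "X \<subseteq> Z" "fons (I \<union> J) u" "fons (I \<union> J) w" "bounded_on (I \<union> J) c" "I \<inter> J = {}"
  shows "KX X (I \<union> J) c u w v = KX X I c u w v + KX X J c u w v"
proof -
  have "(\<Sum>a\<in>X. Kop (I \<union> J) c (act a u) (act a w) v) =
    (\<Sum>a\<in>X. Kop I c (act a u) (act a w) v + Kop J c (act a u) (act a w) v)"
    using assms by (intro sum.cong refl Kop_Un) (auto intro!: fons_ons)
  then show ?thesis
    unfolding KX_apply scaleR_add_right[symmetric] sum.distrib[symmetric] by simp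
qed

lemma KX_U_basis:
  assumes "fons I u" "fons I w" "bounded_on I c" "j \<in> I"
  shows "KX U I c u w (u j) = c j *\<^sub>R w j"
proof -
  let ?f = "\<lambda>a. Kop I c (act a u) (act a w) (u j)"
  have fin: "finite U" using finite_Z U_subset finite_subset by blast
  have z: "?f a = 0" if "a \<in> U - {id_blinfun, - id_blinfun}" for a
    using that assms U_subset by (intro Kop_orth) (auto intro!: fons_ons simp: fons_def)
  have 1: "?f id_blinfun = c j *\<^sub>R w j"
    using Kop_basis[OF fons_ons' fons_ons' assms(3,4), OF assms(1,2)] by simp
  have 2: "?f (- id_blinfun) = c j *\<^sub>R w j"
    using 1 by simp
  have "(\<Sum>a\<in>U. ?f a) = (\<Sum>a\<in>{id_blinfun, - id_blinfun}. ?f a)"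
    using z fin id_U uminus_U[OF id_U] by (intro sum.mono_neutral_right) auto
  also have "\<dots> = 2 *\<^sub>R (c j *\<^sub>R w j)"
    using nontrivial 1 2 by (simp add: scaleR_2[symmetric])
  finally show ?thesis by (simp add: KX_apply)
qed

lemma KX_V_basis:
  assumes "fons I u" "fons I w" "bounded_on I c" "j \<in> I"
  shows "KX V I c u w (u j) = 0"
proof (rule KX_orth)
  fix i a assume "i \<in> I" "a \<in> V"
  then have "a \<noteq> id_blinfun" "a \<noteq> - id_blinfun" "a \<in> Z"
    using id_U uminus_U[OF id_U] V_subset by (auto simp: V_def)
  then show "u j \<bullet> a (u i) = 0" using assms \<open>i \<in> I\<close> by (auto simp: fons_def)
qed (use assms V_subset in auto)

end

section \<open>The operator group and its elementary elements\<close>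

lemma blinfun_inverseD: "g o\<^sub>L h = id_blinfun \<Longrightarrow> g (h v) = v"
  by (metis blinfun_apply_blinfun_compose blinfun_apply_id_blinfun id_apply)

context free_action
begin

lemma fons_compose:
  assumes "fons I b" "inj_on h J" "h ` J \<subseteq> I"
  shows "fons J (b \<circ> h)"
  unfolding fons_def
proof (intro ballI)
  fix i j a assume *: "i \<in> J" "j \<in> J" "a \<in> Z"
  then have "h i = h j \<longleftrightarrow> i = j" using assms(2) by (auto dest: inj_onD)
  then show "(b \<circ> h) i \<bullet> act a (b \<circ> h) j =
     (if i = j then if a = id_blinfun then 1 else if a = - id_blinfun then - 1 else 0 else 0)"
    using assms(1,3) * unfolding fons_def by (auto simp: image_subset_iff)
qed

lemma zorth_compose:
  assumes "fons I b" "h ` J \<subseteq> I" "h' ` J' \<subseteq> I" "h ` J \<inter> h' ` J' = {}"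
  shows "zorth J (b \<circ> h) J' (b \<circ> h')"
  unfolding zorth_def
proof (intro ballI)
  fix i j a assume *: "i \<in> J" "j \<in> J'" "a \<in> Z"
  then have "h i \<noteq> h' j" using assms(4) by blast
  then show "(b \<circ> h) i \<bullet> act a (b \<circ> h') j = 0"
    using assms(1-3) * unfolding fons_def by (auto simp: image_subset_iff)
qed

abbreviation "one \<equiv> (\<lambda>_. 1 :: real)"

lemma KX_one_left [simp]:
  assumes "fons I u" "fons I w" "fons I u'" "bounded_on I c"
  shows "KX U I one u w (KX U I c u' u v) = KX U I c u' w v"
    and "KX V I one u w (KX V I c u' u v) = KX V I c u' w v"
    and "KX U I c u w (KX U I one u' u v) = KX U I c u' w v"
    and "KX V I c u w (KX V I one u' u v) = KX V I c u' w v"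
  using KX_KX_same[OF U_subset uminus_U assms(1-3) bounded_on_const[of I 1] assms(4)]
    KX_KX_same[OF V_subset uminus_V assms(1-3) bounded_on_const[of I 1] assms(4)]
    KX_KX_same[OF U_subset uminus_U assms bounded_on_const[of I 1]]
    KX_KX_same[OF V_subset uminus_V assms bounded_on_const[of I 1]] by simp_all

lemma KX_diff_zero [simp]:
  assumes "fons I u" "fons I w" "fons I u'" "bounded_on I c" "bounded_on I c'"
  shows "KX U I c u w (KX V I c' u' u v) = 0" "KX V I c u w (KX U I c' u' u v) = 0"
  by (rule KX_KX_diff[OF U_subset V_subset uminus_U U_V_disjoint(1) assms]
      KX_KX_diff[OF V_subset U_subset uminus_V U_V_disjoint(2) assms]; assumption)+

lemma KX_orth_zero [simp]:
  assumes "zorth J w' I u" "fons I u" "fons I w" "fons J u'" "fons J w'" "bounded_on I c" "bounded_on J c'"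
  shows "KX U I c u w (KX U J c' u' w' v) = 0" "KX U I c u w (KX V J c' u' w' v) = 0"
    "KX V I c u w (KX U J c' u' w' v) = 0" "KX V I c u w (KX V J c' u' w' v) = 0"
  by (rule KX_KX_orth; (rule U_subset V_subset assms))+

definition Gr :: "('e \<Rightarrow>\<^sub>L 'e) set" where
  "Gr = {g. (\<exists>h. g o\<^sub>L h = id_blinfun \<and> h o\<^sub>L g = id_blinfun) \<and> (\<forall>a\<in>U. \<forall>v. g (blinfun_apply a v) = a (g v)) \<and>
     (\<forall>a\<in>V. \<forall>v w. g v \<bullet> blinfun_apply a (g w) = v \<bullet> a w)}"

lemma id_Gr: "id_blinfun \<in> Gr"
  unfolding Gr_def by (auto intro!: exI[of _ id_blinfun])

lemma compose_Gr: assumes "g \<in> Gr" "g' \<in> Gr" shows "g o\<^sub>L g' \<in> Gr"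
proof -
  obtain h h' where h: "g o\<^sub>L h = id_blinfun" "h o\<^sub>L g = id_blinfun" "g' o\<^sub>L h' = id_blinfun" "h' o\<^sub>L g' = id_blinfun"
    using assms by (auto simp: Gr_def)
  have p: "g (h v) = v" "h (g v) = v" "g' (h' v) = v" "h' (g' v) = v" for v
    using h by (simp_all add: blinfun_inverseD)
  have "\<exists>h. (g o\<^sub>L g') o\<^sub>L h = id_blinfun \<and> h o\<^sub>L (g o\<^sub>L g') = id_blinfun"
    by (rule exI[of _ "h' o\<^sub>L h"]) (auto intro!: blinfun_eqI simp: p)
  then show ?thesis using assms by (simp add: Gr_def)
qed

lemma inverse_Gr:
  assumes "g \<in> Gr"
  obtains h where "h \<in> Gr" "g o\<^sub>L h = id_blinfun" "h o\<^sub>L g = id_blinfun" "\<And>v. g (h v) = v" "\<And>v. h (g v) = v"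
proof -
  obtain h where h: "g o\<^sub>L h = id_blinfun" "h o\<^sub>L g = id_blinfun" using assms by (auto simp: Gr_def)
  have p: "g (h v) = v" "h (g v) = v" for v
    using h by (simp_all add: blinfun_inverseD)
  have "h (a v) = a (h v)" if "a \<in> U" for a v
  proof -
    have "a v = g (a (h v))" using assms that p by (simp add: Gr_def)
    then show ?thesis using p by simp
  qed
  moreover have "h v \<bullet> a (h w) = v \<bullet> a w" if "a \<in> V" for a v w
  proof -
    have "g (h v) \<bullet> a (g (h w)) = h v \<bullet> a (h w)" using assms that by (simp add: Gr_def)
    then show ?thesis using p by simp
  qed
  ultimately have "h \<in> Gr" using h by (auto simp: Gr_def)
  then show thesis using that h p by blast
qed

text \<open>Preserving v \<bullet> \<open>a\<close> w means that \<open>a\<close> intertwines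
  \<open>g\<close> with its inverse adjoint. Here \<open>gs\<close> is the adjoint of
  \<open>g\<close>, and \<open>g'\<close> is a right inverse of \<open>gs\<close>.\<close>

lemma GrI:
  fixes g h g' gs :: "'e \<Rightarrow>\<^sub>L 'e"
  assumes "\<And>v. g (h v) = v" "\<And>v. h (g v) = v" "\<And>a v. a \<in> U \<Longrightarrow> g (a v) = a (g v)"
    "\<And>a v. a \<in> V \<Longrightarrow> a (g v) = g' (a v)" "\<And>v w. g v \<bullet> w = v \<bullet> blinfun_apply gs w"
    "\<And>v. gs (blinfun_apply g' v) = v"
  shows "g \<in> Gr"
  unfolding Gr_def using assms by (auto intro!: exI[of _ h] blinfun_eqI)

lemma GrI_unitary:
  fixes g h :: "'e \<Rightarrow>\<^sub>L 'e"
  assumes "\<And>v. g (h v) = v" "\<And>v. h (g v) = v" "\<And>a v. a \<in> Z \<Longrightarrow> g (a v) = a (g v)"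
    "\<And>v w. g v \<bullet> w = v \<bullet> blinfun_apply h w"
  shows "g \<in> Gr"
  by (rule GrI[of g h g h]) (use assms U_subset V_subset in \<open>auto simp: subset_iff\<close>)

lemma U_KX:
  assumes "a \<in> U" "fons I u" "fons I w" "bounded_on I c"
  shows "a (KX U I c u w v) = KX U I c u w (a v)" "a (KX V I c u w v) = KX V I c u w (a v)"
  using assms U_subset V_subset by (auto intro!: Z_KX bij_UU bij_UV)

lemma V_KX:
  assumes "a \<in> V" "fons I u" "fons I w" "bounded_on I c"
  shows "a (KX U I c u w v) = KX V I c u w (a v)" "a (KX V I c u w v) = KX U I c u w (a v)"
  using assms U_subset V_subset by (auto intro!: Z_KX bij_VU bij_VV)

lemma KX_adjoint_U: "fons I u \<Longrightarrow> fons I w \<Longrightarrow> bounded_on I c \<Longrightarrow> KX U I c u w v \<bullet> z = v \<bullet> KX U I c w u z"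
  and KX_adjoint_V: "fons I u \<Longrightarrow> fons I w \<Longrightarrow> bounded_on I c \<Longrightarrow> KX V I c u w v \<bullet> z = v \<bullet> KX V I c w u z"
  using U_subset V_subset by (auto intro: KX_adjoint)

text \<open>On the hyperbolic space spanned by a free orthonormal system, \<open>dop\<close> is the Levi element
  \<open>t \<oplus> 1/t\<close>, \<open>Eop\<close> is the image of the transvection \<open>1 + s n\<close> with \<open>n: u i \<mapsto> c i w i\<close>, and \<open>Wop\<close> (below)
  is the signed permutation \<open>u i \<mapsto> - w i\<close>, \<open>w i \<mapsto> u i\<close>.\<close>

definition dop :: "'i set \<Rightarrow> ('i \<Rightarrow> 'e) \<Rightarrow> real \<Rightarrow> 'e \<Rightarrow>\<^sub>L 'e" where
  "dop I u t = id_blinfun + (t - 1) *\<^sub>R KX U I one u u + (1/t - 1) *\<^sub>R KX V I one u u"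

definition Eop :: "'i set \<Rightarrow> ('i \<Rightarrow> real) \<Rightarrow> real \<Rightarrow> ('i \<Rightarrow> 'e) \<Rightarrow> ('i \<Rightarrow> 'e) \<Rightarrow> 'e \<Rightarrow>\<^sub>L 'e" where
  "Eop I c s u w = id_blinfun + s *\<^sub>R (KX U I c u w - KX V I c w u)"

lemma dop_apply: "dop I u t v = v + (t - 1) *\<^sub>R KX U I one u u v + (1/t - 1) *\<^sub>R KX V I one u u v"
  by (simp add: dop_def blin_simps)

lemma Eop_apply: "Eop I c s u w v = v + s *\<^sub>R (KX U I c u w v - KX V I c w u v)"
  by (simp add: Eop_def blin_simps)

text \<open>Both directions of \<open>zorth\<close> are recorded so that the simplification rules
  for products of \<open>KX\<close> find their premise in either order.\<close>

definition jfons :: "'i set \<Rightarrow> ('i \<Rightarrow> 'e) \<Rightarrow> ('i \<Rightarrow> 'e) \<Rightarrow> bool" where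
  "jfons I u w \<longleftrightarrow> fons I u \<and> fons I w \<and> zorth I u I w \<and> zorth I w I u"

lemma jfons_sym: "jfons I u w \<Longrightarrow> jfons I w u" by (auto simp: jfons_def)

lemma jfonsI: "fons I u \<Longrightarrow> fons I w \<Longrightarrow> zorth I u I w \<Longrightarrow> jfons I u w"
  by (auto simp: jfons_def zorth_sym)

lemma dop_dop:
  assumes "fons I u"
  shows "dop I u s (dop I u t v) = dop I u (s * t) v"
  by (simp add: dop_apply blin_simps assms algebra_simps)

lemma dop_one: "dop I u 1 = id_blinfun"
  by (rule blinfun_eqI) (simp add: dop_apply)

lemma dop_inverse:
  assumes "fons I u" "t \<noteq> 0"
  shows "dop I u t (dop I u (1/t) v) = v" "dop I u (1/t) (dop I u t v) = v"
  using assms by (simp_all add: dop_dop dop_one)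

lemma dop_Gr:
  assumes "fons I u" "t \<noteq> 0"
  shows "dop I u t \<in> Gr"
proof (rule GrI[where h = "dop I u (1/t)" and g' = "dop I u (1/t)" and gs = "dop I u t"])
  show "dop I u t (a v) = a (dop I u t v)" if "a \<in> U" for a v
    using that assms by (simp add: dop_apply blin_simps U_KX)
  show "a (dop I u t v) = dop I u (1/t) (a v)" if "a \<in> V" for a v
    using that assms by (simp add: dop_apply blin_simps V_KX)
  show "dop I u t v \<bullet> w = v \<bullet> dop I u t w" for v w
    using assms by (simp add: dop_apply inner_add_left inner_add_right KX_adjoint_U KX_adjoint_V)
qed (use assms in \<open>auto simp: dop_inverse\<close>)

text \<open>The generator squares to zero because the two systems are mutually orthogonal; hence the
  transvections form a one-parameter group with inverse at \<open>- s\<close>.\<close>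

lemma Eop_Eop:
  assumes "jfons I u w" "bounded_on I c"
  shows "Eop I c s u w (Eop I c t u w v) = Eop I c (s + t) u w v"
  using assms by (simp add: jfons_def Eop_apply blin_simps algebra_simps)

lemma Eop_zero: "Eop I c 0 u w v = v" by (simp add: Eop_apply)

lemma Eop_Gr:
  assumes "jfons I u w" "bounded_on I c"
  shows "Eop I c s u w \<in> Gr"
proof (rule GrI)
  \<comment> \<open>\<open>?g'\<close> is the transvection with the roles of the two halves
    exchanged, as enforced by moving an element of \<open>V\<close> across; \<open>?gs\<close> is
    the adjoint, with \<open>u\<close> and \<open>w\<close> exchanged.\<close>
  let ?g' = "id_blinfun + s *\<^sub>R (KX V I c u w - KX U I c w u)"
  let ?gs = "id_blinfun + s *\<^sub>R (KX U I c w u - KX V I c u w)"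
  note f = assms(1)[unfolded jfons_def]
  show "Eop I c s u w (Eop I c (- s) u w v) = v" "Eop I c (- s) u w (Eop I c s u w v) = v" for v
    using assms by (simp_all add: Eop_Eop Eop_zero)
  show "Eop I c s u w (a v) = a (Eop I c s u w v)" if "a \<in> U" for a v
    using that f assms by (simp add: Eop_apply blin_simps U_KX)
  show "a (Eop I c s u w v) = ?g' (a v)" if "a \<in> V" for a v
    using that f assms by (simp add: Eop_apply blin_simps V_KX)
  show "Eop I c s u w v \<bullet> z = v \<bullet> ?gs z" for v z
    using f assms by (simp add: Eop_apply blin_simps inner_add_left inner_add_right
        inner_diff_left inner_diff_right KX_adjoint_U KX_adjoint_V)
  show "?gs (?g' v) = v" for v
    using f assms by (simp add: blin_simps algebra_simps)
qed

text \<open>On the \<open>U\<close>-half the source \<open>u\<close> is stretched by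
  \<open>t\<close>; on the \<open>V\<close>-half the target \<open>u\<close> is shrunk by
  \<open>t\<close>. Both divide the parameter by \<open>t\<close>, so one scaling contracts both
  halves.\<close>

lemma dop_Eop_conj:
  assumes "jfons I u w" "bounded_on I c" "t \<noteq> 0"
  shows "dop I u t (Eop I c s u w (dop I u (1/t) v)) = Eop I c (s / t) u w v"
  using assms by (simp add: jfons_def dop_apply Eop_apply blin_simps algebra_simps diff_divide_distrib)

lemma norm_Eop:
  assumes "jfons I u w" "0 \<le> C" "\<And>i. i \<in> I \<Longrightarrow> \<bar>c i\<bar> \<le> C"
  shows "norm (Eop I c s u w - id_blinfun) \<le> \<bar>s\<bar> * (2 * C * card Z)"
proof -
  have "norm (KX U I c u w - KX V I c w u) \<le> C * card Z + C * card Z"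
    using assms U_subset V_subset
    by (intro order_trans[OF norm_triangle_ineq4] add_mono norm_KX) (auto simp: jfons_def)
  then have "\<bar>s\<bar> * norm (KX U I c u w - KX V I c w u) \<le> \<bar>s\<bar> * (2 * C * card Z)"
    by (intro mult_left_mono) auto
  then show ?thesis by (simp add: Eop_def)
qed

definition Wop :: "'i set \<Rightarrow> ('i \<Rightarrow> 'e) \<Rightarrow> ('i \<Rightarrow> 'e) \<Rightarrow> 'e \<Rightarrow>\<^sub>L 'e" where
  "Wop I u w = Eop I one (-1) u w o\<^sub>L (Eop I one 1 w u o\<^sub>L Eop I one (-1) u w)"

lemma Wop_apply:
  assumes "jfons I u w"
  shows "Wop I u w v = v - KX U I one u u v - KX V I one u u v - KX U I one w w v - KX V I one w w v
     + KX U I one w u v + KX V I one w u v - KX U I one u w v - KX V I one u w v"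
  using assms by (simp add: jfons_def Wop_def Eop_apply blin_simps algebra_simps)

lemma Wop_Gr: "jfons I u w \<Longrightarrow> Wop I u w \<in> Gr"
  unfolding Wop_def by (intro compose_Gr Eop_Gr) (auto simp: jfons_sym)

end

section \<open>Approximately fixed vectors\<close>

text \<open>Rounding the pair of values to a countable dense set cannot be injective on the reals.
  Two maps are treated at once because the same two cuts must serve for the factor 2 and for the
  contracting factor.\<close>

lemma separable_pigeonhole:
  fixes F F' :: "real \<Rightarrow> 'v::metric_space"
  assumes "separable (UNIV :: 'v set)" "e > 0"
  obtains r s where "r < s" "dist (F r) (F s) < e" "dist (F' r) (F' s) < e"
proof -
  obtain D :: "'v set" where D: "countable D" "UNIV \<subseteq> closure D"
    using assms(1) by (auto simp: separable_def)
  have "\<exists>x\<in>D. dist x y < e/2" for y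
    using D(2) \<open>e > 0\<close> closure_approachable[of y D] by (metis UNIV_I half_gt_zero subsetD)
  then obtain p where p: "p y \<in> D" "dist (p y) y < e/2" for y by metis
  define q where "q r = (p (F r), p (F' r))" for r
  have "countable (range q)"
    by (rule countable_subset[of _ "D \<times> D"]) (use D p in \<open>auto simp: q_def\<close>)
  then have "\<not> inj q"
    using countable_image_inj_on uncountable_UNIV_real by blast
  then obtain r s where "q r = q s" "r \<noteq> s" by (auto simp: inj_def)
  then obtain r s where rs: "q r = q s" "r < s"
    by (metis linorder_less_linear)
  have d: "dist y z < e" if "p y = p z" for y z
    using p(2)[of y] p(2)[of z] that dist_triangle3[of y z "p y"] by simp
  show thesis
    by (rule that[OF rs(2)]) (use rs in \<open>auto simp: q_def intro: d\<close>)
qed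

lemma infinite_rat_between:
  fixes r s :: real
  assumes "r < s"
  shows "infinite {q :: rat. r \<le> of_rat q \<and> of_rat q < s}"
proof -
  obtain a :: rat where a: "r < of_rat a" "of_rat a < s" using of_rat_dense[OF assms] by blast
  obtain b :: rat where b: "of_rat a < (of_rat b :: real)" "of_rat b < s" using of_rat_dense[OF a(2)] by blast
  have "{a..b} \<subseteq> {q. r \<le> of_rat q \<and> of_rat q < s}"
  proof (clarsimp, intro conjI)
    fix x assume "a \<le> x" "x \<le> b"
    then have "(of_rat a :: real) \<le> of_rat x" "(of_rat x :: real) \<le> of_rat b" by (simp_all add: of_rat_less_eq)
    then show "r \<le> of_rat x" "of_rat x < s" using a b by linarith+
  qed
  moreover have "infinite {a..b}" using b(1) by (intro infinite_Icc) (simp add: of_rat_less)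
  ultimately show ?thesis using infinite_super by blast
qed

lemma infinite_enumeration:
  fixes Y :: "'a::countable set"
  assumes "infinite Y"
  obtains h :: "nat \<Rightarrow> 'a" where "bij_betw h UNIV Y"
  using bij_betw_from_nat_into[OF countableI_type assms] by blast

lemma (in free_action) fons_subset: "fons I u \<Longrightarrow> J \<subseteq> I \<Longrightarrow> fons J u"
  unfolding fons_def by blast

section \<open>Representations, displacement of vectors, and the kernel\<close>

locale separable_rep = free_action Z U
  for Z U :: "('e::{real_inner,complete_space} \<Rightarrow>\<^sub>L 'e) set" +
  fixes \<pi> :: "('e \<Rightarrow>\<^sub>L 'e) \<Rightarrow> 'v::real_normed_vector \<Rightarrow>\<^sub>L 'v"
  assumes \<pi>_compose: "g \<in> Gr \<Longrightarrow> h \<in> Gr \<Longrightarrow> \<pi> (g o\<^sub>L h) = \<pi> g o\<^sub>L \<pi> h"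
    and \<pi>_norm: "g \<in> Gr \<Longrightarrow> norm (\<pi> g v) = norm v"
    and \<pi>_continuous: "continuous_on Gr (\<lambda>g. \<pi> g v)"
    and \<pi>_separable: "separable (UNIV :: 'v set)"
begin

text \<open>The image of the identity is idempotent, and an idempotent that preserves norms is the
  identity.\<close>

lemma \<pi>_id: "\<pi> id_blinfun = id_blinfun"
proof (rule blinfun_eqI)
  fix v
  have "\<pi> id_blinfun (\<pi> id_blinfun v - v) = 0"
    using arg_cong[OF \<pi>_compose[OF id_Gr id_Gr], of "\<lambda>z. z v"] by (simp add: blinfun.diff_right)
  then have "norm (\<pi> id_blinfun v - v) = 0"
    using \<pi>_norm[OF id_Gr, of "\<pi> id_blinfun v - v"] by simp
  then show "\<pi> id_blinfun v = id_blinfun v" by simp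
qed

definition Ker :: "('e \<Rightarrow>\<^sub>L 'e) set" where "Ker = {g \<in> Gr. \<pi> g = id_blinfun}"

lemma Ker_Gr: "g \<in> Ker \<Longrightarrow> g \<in> Gr" by (simp add: Ker_def)

lemma compose_Ker: "g \<in> Ker \<Longrightarrow> h \<in> Ker \<Longrightarrow> g o\<^sub>L h \<in> Ker"
  by (simp add: Ker_def compose_Gr \<pi>_compose)

lemma \<pi>_Ker_left: "g \<in> Ker \<Longrightarrow> h \<in> Gr \<Longrightarrow> \<pi> (g o\<^sub>L h) = \<pi> h"
  and \<pi>_Ker_right: "g \<in> Ker \<Longrightarrow> h \<in> Gr \<Longrightarrow> \<pi> (h o\<^sub>L g) = \<pi> h"
  by (simp_all add: Ker_def \<pi>_compose)

lemma Ker_conj: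
  assumes "g \<in> Ker" "h \<in> Gr" "g' \<in> Gr" "h o\<^sub>L g = g' o\<^sub>L h"
  shows "g' \<in> Ker"
proof -
  obtain k where k: "k \<in> Gr" "h o\<^sub>L k = id_blinfun" using inverse_Gr[OF assms(2)] by blast
  have "g' = h o\<^sub>L (g o\<^sub>L k)"
    using k(2) assms(4) by (metis blinfun_compose_assoc blinfun_compose_id(2))
  then have "\<pi> g' = \<pi> h o\<^sub>L \<pi> k"
    using assms k by (simp add: Ker_def \<pi>_compose compose_Gr)
  also have "\<dots> = id_blinfun" using assms k by (simp add: \<pi>_compose[symmetric] \<pi>_id)
  finally show ?thesis using assms(3) by (simp add: Ker_def)
qed

definition disp :: "('e \<Rightarrow>\<^sub>L 'e) \<Rightarrow> 'v \<Rightarrow> real" where "disp g v = norm (\<pi> g v - v)"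

lemma disp_compose: assumes "g \<in> Gr" "h \<in> Gr" shows "disp (g o\<^sub>L h) v \<le> disp g v + disp h v"
proof -
  have "norm (\<pi> (g o\<^sub>L h) v - v) = norm (\<pi> g (\<pi> h v - v) + (\<pi> g v - v))"
    using assms by (simp add: \<pi>_compose blinfun.diff_right)
  also have "\<dots> \<le> norm (\<pi> g (\<pi> h v - v)) + norm (\<pi> g v - v)" by (rule norm_triangle_ineq)
  finally show ?thesis using assms by (simp add: \<pi>_norm disp_def)
qed

lemma disp_inverse:
  assumes "g \<in> Gr" "h \<in> Gr" "\<And>v. h (g v) = v"
  shows "disp h v = disp g v"
proof -
  have "h o\<^sub>L g = id_blinfun" using assms(3) by (intro blinfun_eqI) simp
  then have "\<pi> h (\<pi> g v) = v"
    using arg_cong[OF \<pi>_compose[OF assms(2,1)], of "\<lambda>z. z v"] by (simp add: \<pi>_id)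
  then have "norm (\<pi> h v - v) = norm (\<pi> h (v - \<pi> g v))" by (simp add: blinfun.diff_right)
  also have "\<dots> = norm (v - \<pi> g v)" using assms by (simp add: \<pi>_norm)
  finally show ?thesis by (simp add: disp_def norm_minus_commute)
qed

lemma disp_small:
  assumes "e > 0"
  obtains d where "d > 0" "\<And>g. g \<in> Gr \<Longrightarrow> norm (g - id_blinfun) < d \<Longrightarrow> disp g v < e"
proof -
  have "\<exists>d>0. \<forall>g\<in>Gr. dist g id_blinfun < d \<longrightarrow> dist (\<pi> g v) (\<pi> id_blinfun v) < e"
    using \<pi>_continuous[of v] id_Gr assms unfolding continuous_on_iff by blast
  then obtain d where d: "d > 0" "\<And>g. g \<in> Gr \<Longrightarrow> dist g id_blinfun < d \<Longrightarrow> dist (\<pi> g v) (\<pi> id_blinfun v) < e"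
    by blast
  show thesis
    by (rule that[OF d(1)]) (use d(2) in \<open>auto simp: dist_norm disp_def \<pi>_id\<close>)
qed

lemma KerI_disp:
  assumes "g \<in> Gr" "\<And>v e. e > 0 \<Longrightarrow> disp g v < e"
  shows "g \<in> Ker"
proof -
  have "disp g v \<le> 0" for v using assms(2)[of "disp g v" v] by (meson less_irrefl not_less)
  then have "\<pi> g v = v" for v by (simp add: disp_def)
  then show ?thesis using assms(1) by (auto simp: Ker_def intro: blinfun_eqI)
qed

text \<open>This converts contraction in the operator norm into equality under \<open>\<pi>\<close>:
  the images are constant along the sequence and converge pointwise to the image of the
  limit.\<close>

lemma KerI_tendsto:
  assumes "x \<in> Gr" "y \<in> Gr" "\<And>n. xs n \<in> Gr" "\<And>n. \<pi> (xs n) = \<pi> x" "(\<lambda>n. xs (n::nat)) \<longlonglongrightarrow> y"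
  shows "\<pi> x = \<pi> y"
proof (rule blinfun_eqI)
  fix v
  have "(\<lambda>n. \<pi> (xs n) v) \<longlonglongrightarrow> \<pi> y v"
    using continuous_on_tendsto_compose[OF \<pi>_continuous assms(5,2), of v] assms(3) by simp
  then have "(\<lambda>n. \<pi> x v) \<longlonglongrightarrow> \<pi> y v" by (simp add: assms(4))
  then show "\<pi> x v = \<pi> y v" by (simp add: LIMSEQ_const_iff)
qed

lemma dop_Un:
  assumes "fons (I \<union> J) u" "I \<inter> J = {}"
  shows "dop (I \<union> J) u t = dop I u t o\<^sub>L dop J u t"
proof (rule blinfun_eqI)
  fix v
  have f: "fons I u" "fons J u" using assms by (auto simp: fons_def)
  have z: "zorth I u J u" "zorth J u I u"
    using zorth_compose[OF assms(1), of id I id J] zorth_compose[OF assms(1), of id J id I] assms(2) by auto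
  show "dop (I \<union> J) u t v = (dop I u t o\<^sub>L dop J u t) v"
    using assms f z U_subset V_subset
    by (simp add: dop_apply KX_Un blin_simps algebra_simps)
qed

text \<open>Quantitative Mautner argument: \<open>E\<close> is the product of \<open>d'\<close>,
  \<open>E'\<close> and \<open>d\<close>, each of which moves \<open>v\<close> by less than
  \<open>e\<close>; the inverse \<open>d'\<close> moves \<open>v\<close> as far as \<open>d\<close>
  does.\<close>

lemma approx_fixed_contract:
  assumes "t > 0" "d \<in> Gr" "d' \<in> Gr" "E \<in> Gr" "E' \<in> Gr"
    and "\<And>v. d (d' v) = v" "\<And>v. d' (d v) = v" "\<And>v. d (E (d' v)) = E' v"
    and "disp d v < e" "disp E' v < e"
  shows "disp E v < 3 * e"
proof -
  have "E = d' o\<^sub>L (E' o\<^sub>L d)" by (rule blinfun_eqI) (simp add: assms(6,7) flip: assms(8))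
  then have "disp E v \<le> disp d' v + (disp E' v + disp d v)"
    using disp_compose[OF assms(3) compose_Gr[OF assms(5,2)], of v] disp_compose[OF assms(5,2), of v] by simp
  moreover have "disp d' v = disp d v" by (rule disp_inverse) (use assms in auto)
  ultimately show ?thesis using assms(9,10) by linarith
qed

text \<open>By separability two of the uncountably many cuts \<open>S r\<close> of a system indexed by \<open>\<rat> \<times> bool\<close> give nearly
  the same vector, so the scaling on \<open>T = S s - S r\<close> almost fixes \<open>v\<close>. A large parameter \<open>t\<close> contracts the
  transvections between \<open>T\<close> and its complement towards 1, so these and \<open>Wop\<close> almost fix \<open>v\<close> as well. Finally
  \<open>Wop\<close> conjugates the scaling on the uncontrolled set \<open>T\<close> to the scaling on the fixed set \<open>A\<close>.\<close>

lemma dop_disp: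
  fixes u w :: "nat \<Rightarrow> 'e"
  assumes "jfons UNIV u w" "e > 0"
  shows "disp (dop UNIV u 2) v < 19 * e"
proof -
  obtain \<tau> :: "nat \<Rightarrow> rat" where \<tau>: "bij_betw \<tau> UNIV UNIV"
    using infinite_enumeration[of "UNIV :: rat set"] infinite_UNIV_char_0 by blast
  define \<sigma> where "\<sigma> = inv \<tau>"
  have \<sigma>: "bij_betw \<sigma> UNIV UNIV" unfolding \<sigma>_def using \<tau> by (rule bij_betw_inv_into)
  have \<sigma>\<tau>: "\<sigma> (\<tau> n) = n" for n unfolding \<sigma>_def using \<tau> by (simp add: bij_betw_def inv_f_f)
  \<comment> \<open>The label \<open>True\<close> marks the vectors of \<open>u\<close>,
    \<open>False\<close> those of \<open>w\<close>. The cuts go through both halves at once, whereas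
    the target set \<open>A\<close> is the \<open>True\<close> half.\<close>
  define b :: "rat \<times> bool \<Rightarrow> 'e" where "b p = (if snd p then u (\<sigma> (fst p)) else w (\<sigma> (fst p)))" for p
  have inj: "\<sigma> q = \<sigma> q' \<longleftrightarrow> q = q'" for q q' using \<sigma> by (auto simp: bij_betw_def inj_eq)
  have b: "fons UNIV b"
    unfolding fons_def using assms(1) by (auto simp: b_def jfons_def fons_def zorth_def inj)
  define A where "A = {p :: rat \<times> bool. snd p}"
  define S where "S r = {p :: rat \<times> bool. of_rat (fst p) < (r :: real)}" for r
  have fb: "fons I b" for I using b by (rule fons_subset) simp
  have dA: "dop A b 2 = dop UNIV u 2"
  proof -
    have "bij_betw (\<lambda>n. (\<tau> n, True)) UNIV A"
      using \<tau> by (auto simp: bij_betw_def A_def inj_on_def image_iff surj_def)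
    moreover have "b \<circ> (\<lambda>n. (\<tau> n, True)) = u" by (auto simp: b_def \<sigma>\<tau>)
    ultimately show ?thesis unfolding dop_def by (simp add: KX_reindex o_def)
  qed
  obtain \<delta> where \<delta>: "\<delta> > 0" "\<And>g. g \<in> Gr \<Longrightarrow> norm (g - id_blinfun) < \<delta> \<Longrightarrow> disp g v < e"
    using disp_small[OF \<open>e > 0\<close>] by blast
  \<comment> \<open>By \<open>norm_Eop\<close> a transvection with weights 1 and parameter 1/t is
    within 2 \<open>card Z\<close> / t of the identity; the additional 1 makes this strictly less
    than \<open>\<delta>\<close>. The factor must be fixed before the cuts, which depend on
    it.\<close>
  define t where "t = (2 * real (card Z) + 1) / \<delta>"
  have t: "t > 0" "2 * real (card Z) / t < \<delta>" using \<delta>(1) by (auto simp: t_def field_simps)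
  obtain r s where rs: "r < s" "dist (\<pi> (dop (S r) b 2) v) (\<pi> (dop (S s) b 2) v) < e"
    "dist (\<pi> (dop (S r) b t) v) (\<pi> (dop (S s) b t) v) < e"
    by (rule separable_pigeonhole[OF \<pi>_separable \<open>e > 0\<close>])
  define T where "T = {p :: rat \<times> bool. r \<le> of_rat (fst p) \<and> of_rat (fst p) < s}"
  have SsT: "S s = S r \<union> T" "S r \<inter> T = {}" using rs(1) by (auto simp: S_def T_def)
  have dT: "disp (dop T b c) v < e"
    if "c > 0" "dist (\<pi> (dop (S r) b c) v) (\<pi> (dop (S s) b c) v) < e" for c
  proof -
    have g: "dop (S r) b c \<in> Gr" "dop T b c \<in> Gr" using that fb by (auto intro: dop_Gr)
    have "\<pi> (dop (S s) b c) v - \<pi> (dop (S r) b c) v = \<pi> (dop (S r) b c) (\<pi> (dop T b c) v - v)"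
      unfolding SsT(1) dop_Un[OF fb SsT(2)] using g by (simp add: \<pi>_compose blinfun.diff_right)
    then have "dist (\<pi> (dop (S r) b c) v) (\<pi> (dop (S s) b c) v) = disp (dop T b c) v"
      unfolding dist_norm norm_minus_commute[of "\<pi> (dop (S r) b c) v"] using g by (simp add: disp_def \<pi>_norm)
    then show ?thesis using that by simp
  qed
  \<comment> \<open>\<open>T\<close> is the union of \<open>X\<close> and \<open>C\<close>, and
    \<open>A\<close> that of \<open>Y\<close> and \<open>C\<close>, so exchanging \<open>X\<close>
    with \<open>Y\<close> and leaving \<open>C\<close> alone carries \<open>T\<close> to
    \<open>A\<close>. All three are infinite because bands of rationals are: the band from
    \<open>r\<close> to \<open>s\<close> serves \<open>X\<close> and \<open>C\<close>, the one from
    \<open>s\<close> to \<open>s + 1\<close> serves \<open>Y\<close>.\<close>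
  define X Y C where "X = {p \<in> T. \<not> snd p}" and "Y = {p. p \<notin> T \<and> snd p}" and "C = {p \<in> T. snd p}"
  let ?I = "{q :: rat. r \<le> of_rat q \<and> of_rat q < s}"
  let ?J = "{q :: rat. s \<le> of_rat q \<and> of_rat q < s + 1}"
  have "infinite X"
    by (rule infinite_super[of "(\<lambda>q. (q, False)) ` ?I"])
      (use infinite_rat_between[OF rs(1)] in \<open>auto simp: X_def T_def finite_image_iff inj_on_def\<close>)
  then obtain hX where hX: "bij_betw hX (UNIV :: nat set) X" by (rule infinite_enumeration)
  have "infinite C"
    by (rule infinite_super[of "(\<lambda>q. (q, True)) ` ?I"])
      (use infinite_rat_between[OF rs(1)] in \<open>auto simp: C_def T_def finite_image_iff inj_on_def\<close>)
  then obtain hC where hC: "bij_betw hC (UNIV :: nat set) C" by (rule infinite_enumeration)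
  have "infinite Y"
    by (rule infinite_super[of "(\<lambda>q. (q, True)) ` ?J"])
      (use infinite_rat_between[of s "s + 1"] in \<open>auto simp: Y_def T_def finite_image_iff inj_on_def\<close>)
  then obtain hY where hY: "bij_betw hY (UNIV :: nat set) Y" by (rule infinite_enumeration)
  define x y c where "x = b \<circ> hX" and "y = b \<circ> hY" and "c = b \<circ> hC"
  have f: "fons UNIV x" "fons UNIV y" "fons UNIV c"
    unfolding x_def y_def c_def using hX hY hC b
    by (auto intro!: fons_compose simp: bij_betw_def)
  have rng: "range hX = X" "range hY = Y" "range hC = C" using hX hY hC by (auto simp: bij_betw_def)
  have z: "zorth UNIV x UNIV y" "zorth UNIV y UNIV x" "zorth UNIV x UNIV c" "zorth UNIV c UNIV x"
     "zorth UNIV y UNIV c" "zorth UNIV c UNIV y"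
    unfolding x_def y_def c_def
    by (rule zorth_compose[OF b]; auto simp: rng X_def Y_def C_def; fail)+
  have j: "jfons UNIV x y" "jfons UNIV y x" using f z by (auto simp: jfons_def)
  have "T = X \<union> C" "X \<inter> C = {}" "A = Y \<union> C" "Y \<inter> C = {}" by (auto simp: X_def Y_def C_def A_def)
  have spl: "KX W T one b b q = KX W UNIV one x x q + KX W UNIV one c c q"
     "KX W A one b b q = KX W UNIV one y y q + KX W UNIV one c c q" if "W \<subseteq> Z" for W q
    unfolding \<open>T = X \<union> C\<close> \<open>A = Y \<union> C\<close> x_def y_def c_def
      KX_Un[OF that fb fb bounded_on_const \<open>X \<inter> C = {}\<close>] KX_Un[OF that fb fb bounded_on_const \<open>Y \<inter> C = {}\<close>]
      KX_reindex[OF hX] KX_reindex[OF hY] KX_reindex[OF hC] by (simp_all add: o_def)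
  have dTA: "dop T b a q = q + (a - 1) *\<^sub>R (KX U UNIV one x x q + KX U UNIV one c c q)
      + (1/a - 1) *\<^sub>R (KX V UNIV one x x q + KX V UNIV one c c q)"
    "dop A b a q = q + (a - 1) *\<^sub>R (KX U UNIV one y y q + KX U UNIV one c c q)
      + (1/a - 1) *\<^sub>R (KX V UNIV one y y q + KX V UNIV one c c q)" for a q
    by (simp_all add: dop_apply spl[OF U_subset] spl[OF V_subset])
  \<comment> \<open>The scaling on \<open>T\<close> stretches \<open>x\<close> and leaves
    \<open>y\<close> alone. It contracts the transvections from \<open>x\<close> to
    \<open>y\<close>, and its inverse contracts those from \<open>y\<close> to
    \<open>x\<close>.\<close>
  have conj1: "dop T b t (Eop UNIV one k x y (dop T b (1/t) q)) = Eop UNIV one (k / t) x y q" for k q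
    using f z t(1) by (simp add: dTA Eop_apply blin_simps algebra_simps diff_divide_distrib)
  have conj2: "dop T b (1/t) (Eop UNIV one k y x (dop T b t q)) = Eop UNIV one (k / t) y x q" for k q
    using f z t(1) by (simp add: dTA Eop_apply blin_simps algebra_simps diff_divide_distrib)
  have gT: "dop T b t \<in> Gr" "dop T b (1/t) \<in> Gr" "dop T b 2 \<in> Gr" using fb t by (auto intro: dop_Gr)
  have inv: "dop T b t (dop T b (1/t) q) = q" "dop T b (1/t) (dop T b t q) = q" for q
    using dop_inverse[OF fb, of t] t by auto
  have dispT: "disp (dop T b t) v < e" "disp (dop T b (1/t)) v < e" "disp (dop T b 2) v < e"
    using dT[OF t(1) rs(3)] dT[OF _ rs(2)] disp_inverse[OF gT(1,2)] inv by auto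
  have small: "disp (Eop UNIV one (k / t) p q) v < e" if "jfons UNIV p q" "\<bar>k\<bar> = 1" for k and p q :: "nat \<Rightarrow> 'e"
  proof (rule \<delta>(2))
    have "norm (Eop UNIV one (k / t) p q - id_blinfun) \<le> \<bar>k / t\<bar> * (2 * 1 * real (card Z))"
      by (rule norm_Eop) (use that in auto)
    also have "\<dots> = 2 * real (card Z) / t" using that t by simp
    finally show "norm (Eop UNIV one (k / t) p q - id_blinfun) < \<delta>" using t by simp
  qed (use that in \<open>auto intro: Eop_Gr\<close>)
  have E1: "disp (Eop UNIV one k x y) v < 3 * e" if "\<bar>k\<bar> = 1" for k
    by (rule approx_fixed_contract[OF t(1) gT(1,2) Eop_Gr Eop_Gr inv(1,2) conj1 dispT(1) small[OF j(1) that]])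
      (use j in auto)
  have E2: "disp (Eop UNIV one k y x) v < 3 * e" if "\<bar>k\<bar> = 1" for k
    by (rule approx_fixed_contract[OF t(1) gT(2,1) Eop_Gr Eop_Gr inv(2,1) conj2 dispT(2) small[OF j(2) that]])
      (use j in auto)
  let ?W = "Wop UNIV x y"
  have W: "?W \<in> Gr" using j(1) by (rule Wop_Gr)
  \<comment> \<open>\<open>Wop\<close> is a product of three transvections, each of displacement
    below 3e.\<close>
  have "disp ?W v < 9 * e"
    using disp_compose[of "Eop UNIV one (- 1) x y" "Eop UNIV one 1 y x o\<^sub>L Eop UNIV one (- 1) x y" v]
      disp_compose[of "Eop UNIV one 1 y x" "Eop UNIV one (- 1) x y" v] E1[of "- 1"] E2[of 1] j
    by (simp add: Wop_def compose_Gr Eop_Gr)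
  moreover obtain W' where W': "W' \<in> Gr" "\<And>v. ?W (W' v) = v" "\<And>v. W' (?W v) = v"
    using inverse_Gr[OF W] by metis
  moreover have "disp W' v = disp ?W v" by (rule disp_inverse) (use W W' in auto)
  moreover have comm: "?W (dop T b 2 q) = dop A b 2 (?W q)" for q
    using f z by (simp add: Wop_apply[OF j(1)] dTA blin_simps algebra_simps)
  have "dop A b 2 = ?W o\<^sub>L (dop T b 2 o\<^sub>L W')"
    by (rule blinfun_eqI) (simp add: comm W')
  \<comment> \<open>The three factors contribute 9e, e and 9e, which gives the constant 19.\<close>
  then have "disp (dop A b 2) v \<le> disp ?W v + (disp (dop T b 2) v + disp W' v)"
    using disp_compose[OF W compose_Gr[OF gT(3) W'(1)], of v] disp_compose[OF gT(3) W'(1), of v] by simp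
  ultimately show ?thesis using dispT(3) by (simp add: dA)
qed

text \<open>The scaling along \<open>u\<close> depends neither on the vector nor on the tolerance,
  so the displacement bound may be applied with arbitrarily small \<open>e\<close>.\<close>

lemma dop_Ker:
  fixes u w :: "nat \<Rightarrow> 'e"
  assumes "jfons UNIV u w"
  shows "dop UNIV u 2 \<in> Ker"
proof (rule KerI_disp)
  show "dop UNIV u 2 \<in> Gr" using assms by (intro dop_Gr) (auto simp: jfons_def)
  show "disp (dop UNIV u 2) v < e" if "e > 0" for v e
    using dop_disp[OF assms, of "e/19" v] that by simp
qed

end

section \<open>Unipotents and signed permutations in the kernel\<close>

context separable_rep
begin

text \<open>Conjugation by a kernel element halves the parameter without changing the image, and the
  halved parameters tend to 0. General weights \<open>c\<close> are kept because the reduction below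
  needs norms of images, and their reciprocals, as weights.\<close>

lemma Eop_Ker:
  fixes u w :: "nat \<Rightarrow> 'e"
  assumes j: "jfons UNIV u w" and c: "bounded_on UNIV c"
  shows "Eop UNIV c s u w \<in> Ker"
proof -
  have g: "Eop UNIV c s u w \<in> Gr" for s using assms by (rule Eop_Gr)
  have d: "dop UNIV u 2 \<in> Ker" using j by (rule dop_Ker)
  have f: "fons UNIV u" using j by (simp add: jfons_def)
  have "dop UNIV u 2 o\<^sub>L Eop UNIV c s u w = Eop UNIV c (s / 2) u w o\<^sub>L dop UNIV u 2" for s
  proof (rule blinfun_eqI)
    fix v
    show "(dop UNIV u 2 o\<^sub>L Eop UNIV c s u w) v = (Eop UNIV c (s / 2) u w o\<^sub>L dop UNIV u 2) v"
      using dop_Eop_conj[OF j c, of 2 s "dop UNIV u 2 v"] dop_inverse[OF f, of 2] by simp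
  qed
  then have half: "\<pi> (Eop UNIV c (s / 2) u w) = \<pi> (Eop UNIV c s u w)" for s
    using \<pi>_Ker_left[OF d g[of s]] \<pi>_Ker_right[OF d g[of "s / 2"]] by simp
  have "\<pi> (Eop UNIV c s u w) = \<pi> id_blinfun"
  proof (rule KerI_tendsto[where xs = "\<lambda>n. Eop UNIV c (s * (1/2) ^ n) u w"])
    show "\<pi> (Eop UNIV c (s * (1 / 2) ^ n) u w) = \<pi> (Eop UNIV c s u w)" for n
    proof (induction n)
      case (Suc n)
      then show ?case using half[of "s * (1/2) ^ n"] by simp
    qed simp
    have "(\<lambda>n. id_blinfun + (s * (1/2) ^ n) *\<^sub>R (KX U UNIV c u w - KX V UNIV c w u)) \<longlonglongrightarrow>
       id_blinfun + (s * 0) *\<^sub>R (KX U UNIV c u w - KX V UNIV c w u)"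
      by (intro tendsto_intros LIMSEQ_realpow_zero) auto
    then show "(\<lambda>n. Eop UNIV c (s * (1/2) ^ n) u w) \<longlonglongrightarrow> id_blinfun"
      by (simp add: Eop_def)
  qed (use g id_Gr in auto)
  then show ?thesis using g by (simp add: Ker_def \<pi>_id)
qed

lemma Wop_Ker:
  fixes u w :: "nat \<Rightarrow> 'e"
  assumes "jfons UNIV u w"
  shows "Wop UNIV u w \<in> Ker"
  unfolding Wop_def by (intro compose_Ker Eop_Ker assms jfons_sym[OF assms] bounded_on_const)

end

section \<open>The swindle\<close>

locale based_rep = separable_rep Z U \<pi>
  for Z U :: "('e::{real_inner,complete_space} \<Rightarrow>\<^sub>L 'e) set" and \<pi> :: "('e \<Rightarrow>\<^sub>L 'e) \<Rightarrow> 'v::real_normed_vector \<Rightarrow>\<^sub>L 'v" +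
  fixes b :: "nat \<Rightarrow> 'e"
  assumes b: "fons UNIV b"
    and complete: "(\<And>i a. a \<in> Z \<Longrightarrow> v \<bullet> a (b i) = 0) \<Longrightarrow> v = 0"
begin

lemma Z_cases: "a \<in> Z \<Longrightarrow> a \<in> U \<or> a \<in> V"
  by (simp add: V_def)

text \<open>The \<open>Z\<close>-equivariant isometry that extends \<open>b i\<close> \<mapsto>
  \<open>e i\<close>. Both averages are needed because the translates of \<open>b\<close> under
  \<open>U\<close> and under \<open>V\<close> together span the space; \<open>Q'\<close> is the
  adjoint.\<close>

definition Q :: "(nat \<Rightarrow> 'e) \<Rightarrow> 'e \<Rightarrow>\<^sub>L 'e" where
  "Q e = KX U UNIV one b e + KX V UNIV one b e"

definition Q' :: "(nat \<Rightarrow> 'e) \<Rightarrow> 'e \<Rightarrow>\<^sub>L 'e" where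
  "Q' e = KX U UNIV one e b + KX V UNIV one e b"

lemma Q_apply: "Q e v = KX U UNIV one b e v + KX V UNIV one b e v"
  and Q'_apply: "Q' e v = KX U UNIV one e b v + KX V UNIV one e b v"
  by (simp_all add: Q_def Q'_def blinfun.add_left)

lemma Q_Z: "fons UNIV e \<Longrightarrow> a \<in> Z \<Longrightarrow> Q e (a v) = a (Q e v)"
  and Q'_Z: "fons UNIV e \<Longrightarrow> a \<in> Z \<Longrightarrow> Q' e (a v) = a (Q' e v)"
  unfolding Q_apply Q'_apply
  using b by (auto dest!: Z_cases simp: U_KX V_KX blinfun.add_right)

lemma Q_adjoint: "fons UNIV e \<Longrightarrow> Q e v \<bullet> z = v \<bullet> Q' e z"
  using b by (simp add: Q_apply Q'_apply inner_add_left inner_add_right KX_adjoint_U KX_adjoint_V)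

lemma Q_basis: "fons UNIV e \<Longrightarrow> Q e (b i) = e i"
  using b by (simp add: Q_apply KX_U_basis KX_V_basis)

text \<open>Here completeness of \<open>b\<close> enters: the difference \<open>v - Q b v\<close> is
  orthogonal to every translate of the basis.\<close>

lemma Q_b: "Q b v = v"
proof -
  have "(v - Q b v) \<bullet> a (b i) = 0" if "a \<in> Z" for a i
  proof -
    have "Q b v \<bullet> a (b i) = v \<bullet> Q b (a (b i))"
      using Q_adjoint[OF b] by (simp add: Q_apply Q'_apply)
    also have "\<dots> = v \<bullet> a (b i)" using that b by (simp add: Q_Z Q_basis)
    finally show ?thesis by (simp add: inner_diff_left)
  qed
  then have "v - Q b v = 0" by (rule complete)
  then show ?thesis by simp
qed

lemma Q'_Q [simp]: "fons UNIV e \<Longrightarrow> Q' e (Q e v) = v"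
  using b Q_b[of v] by (simp add: Q_apply Q'_apply blinfun.add_right)

lemma Q'_Q_orth [simp]: "fons UNIV e \<Longrightarrow> fons UNIV e' \<Longrightarrow> zorth UNIV e UNIV e' \<Longrightarrow> Q' e' (Q e v) = 0"
  using b by (simp add: Q_apply Q'_apply blinfun.add_right)

lemma fons_b: "inj \<beta> \<Longrightarrow> fons UNIV (b \<circ> \<beta>)"
  using b by (rule fons_compose) auto

lemma Q_compose:
  assumes "fons UNIV e" "inj \<beta>"
  shows "Q e (Q (b \<circ> \<beta>) v) = Q (e \<circ> \<beta>) v"
proof -
  have f: "fons UNIV (b \<circ> \<beta>)" "fons UNIV (e \<circ> \<beta>)" using assms b by (auto intro: fons_compose)
  have "Q e (Kop UNIV one (act a b) (act a (b \<circ> \<beta>)) v) = Kop UNIV one (act a b) (act a (e \<circ> \<beta>)) v" if "a \<in> Z" for a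
    unfolding blinfun_Kop[OF fons_ons[OF b that] fons_ons[OF f(1) that] bounded_on_const]
      Kop_apply[OF fons_ons[OF b that] fons_ons[OF f(2) that] bounded_on_const]
    using assms that by (simp add: Q_Z Q_basis)
  then have "Q e (KX X UNIV one b (b \<circ> \<beta>) v) = KX X UNIV one b (e \<circ> \<beta>) v" if "X \<subseteq> Z" for X
    using that unfolding KX_apply blin_simps
    by (intro arg_cong[where f = "(*\<^sub>R) (1/2)"] sum.cong refl) blast
  then show ?thesis
    using U_subset V_subset unfolding Q_apply[of "b \<circ> \<beta>"] Q_apply[of "e \<circ> \<beta>"] blinfun.add_right by simp
qed

lemma Q'_compose:
  assumes "fons UNIV e" "inj \<beta>"
  shows "Q' (b \<circ> \<beta>) (Q' e v) = Q' (e \<circ> \<beta>) v"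
proof -
  have f: "fons UNIV (b \<circ> \<beta>)" "fons UNIV (e \<circ> \<beta>)" using assms b by (auto intro: fons_compose)
  have "z \<bullet> Q' (b \<circ> \<beta>) (Q' e v) = z \<bullet> Q' (e \<circ> \<beta>) v" for z
    using Q_compose[OF assms, of z] assms(1) f by (simp flip: Q_adjoint)
  then show ?thesis using vector_eq_ldot by blast
qed

text \<open>\<open>tw e z\<close> is the copy of \<open>z\<close> on the range of the isometry \<open>Q e\<close>, extended by the identity. Below, \<open>amp z\<close>
  consists of infinitely many copies, and it equals one copy of \<open>z\<close> times a copy of \<open>amp z\<close>.\<close>

definition tw :: "(nat \<Rightarrow> 'e) \<Rightarrow> ('e \<Rightarrow>\<^sub>L 'e) \<Rightarrow> 'e \<Rightarrow>\<^sub>L 'e" where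
  "tw e z = id_blinfun + (Q e o\<^sub>L (z - id_blinfun) o\<^sub>L Q' e)"

lemma tw_apply: "tw e z v = v + (Q e (z (Q' e v)) - Q e (Q' e v))"
  by (simp add: tw_def blin_simps)

lemma tw_compose:
  assumes "fons UNIV e"
  shows "tw e (z o\<^sub>L z') = tw e z o\<^sub>L tw e z'"
  by (rule blinfun_eqI) (simp add: tw_apply blin_simps assms)

lemma tw_id: "tw e id_blinfun = id_blinfun"
  by (rule blinfun_eqI) (simp add: tw_apply)

lemma tw_tw:
  assumes "fons UNIV e" "inj \<beta>"
  shows "tw e (tw (b \<circ> \<beta>) z) = tw (e \<circ> \<beta>) z"
  by (rule blinfun_eqI) (simp add: tw_apply blin_simps assms Q_compose Q'_compose)

lemma tw_form:
  assumes "fons UNIV e" "z \<in> Gr" "a \<in> V"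
  shows "tw e z v \<bullet> a (tw e z w) = v \<bullet> a w"
proof -
  have aZ: "a \<in> Z" using assms V_subset by blast
  have z: "z x \<bullet> a (z y) = x \<bullet> a y" for x y using assms by (simp add: Gr_def)
  have QQ: "Q e x \<bullet> Q e y = x \<bullet> y" for x y using assms(1) by (simp add: Q_adjoint)
  have vQ: "x \<bullet> Q e y = Q' e x \<bullet> y" for x y using Q_adjoint[OF assms(1), of y x] by (simp add: inner_commute)
  have aQ: "a (Q e x) = Q e (a x)" for x using Q_Z[OF assms(1) aZ, of x] by simp
  have aQ': "Q' e (a x) = a (Q' e x)" for x using Q'_Z[OF assms(1) aZ, of x] by simp
  show ?thesis
    using assms(1)
    by (simp add: tw_apply blin_simps inner_add_left inner_add_right inner_diff_left inner_diff_right
        aQ QQ vQ aQ' z) (simp add: Q_adjoint aQ' QQ vQ)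
qed

lemma tw_Gr:
  assumes "fons UNIV e" "z \<in> Gr"
  shows "tw e z \<in> Gr"
proof -
  obtain z' where z': "z o\<^sub>L z' = id_blinfun" "z' o\<^sub>L z = id_blinfun" using inverse_Gr[OF assms(2)] by metis
  have "\<exists>h. tw e z o\<^sub>L h = id_blinfun \<and> h o\<^sub>L tw e z = id_blinfun"
    by (rule exI[of _ "tw e z'"]) (simp add: z' tw_id flip: tw_compose[OF assms(1)])
  moreover have "tw e z (a v) = a (tw e z v)" if "a \<in> U" for a v
    using assms that U_subset by (auto simp: tw_apply Q_Z Q'_Z blin_simps Gr_def subset_iff)
  ultimately show ?thesis using tw_form[OF assms] by (simp add: Gr_def)
qed

text \<open>\<open>Wop\<close> lies in the kernel and carries one copy to the other. Its sign occurs
  once with \<open>Q\<close> and once with \<open>Q'\<close> and cancels.\<close>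

lemma \<pi>_tw:
  assumes "jfons UNIV e e'" "z \<in> Gr"
  shows "\<pi> (tw e z) = \<pi> (tw e' z)"
proof -
  let ?W = "Wop UNIV e e'"
  note f = assms(1)[unfolded jfons_def]
  have WQ: "?W (Q e v) = - Q e' v" for v
    using f b by (simp add: Wop_apply[OF assms(1)] Q_apply blin_simps)
  have Q'W: "Q' e' (?W v) = - Q' e v" for v
    using f b by (simp add: Wop_apply[OF assms(1)] Q'_apply blin_simps)
  have "?W o\<^sub>L tw e z = tw e' z o\<^sub>L ?W"
    by (rule blinfun_eqI) (simp add: tw_apply blin_simps WQ Q'W)
  then show ?thesis
    using \<pi>_Ker_left[OF Wop_Ker tw_Gr, OF assms(1) _ assms(2), of e]
      \<pi>_Ker_right[OF Wop_Ker tw_Gr, OF assms(1) _ assms(2), of e'] f by simp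
qed

text \<open>The pairing function cuts the index set into infinitely many infinite pieces, one for
  each \<open>j\<close>.\<close>

definition \<rho> :: "nat \<Rightarrow> nat \<Rightarrow> nat" where "\<rho> j i = prod_encode (j, i)"

lemma inj_\<rho>: "inj (\<rho> j)"
  by (auto simp: inj_def \<rho>_def)

lemma \<rho>_disjoint: "j \<noteq> k \<Longrightarrow> zorth UNIV (b \<circ> \<rho> j) UNIV (b \<circ> \<rho> k)"
  by (rule zorth_compose[OF b]) (auto simp: \<rho>_def)

text \<open>The copy carries \<open>z\<close> minus the identity, so that different blocks
  annihilate each other and the identity is added only once in \<open>amp\<close>.\<close>

definition blk :: "('e \<Rightarrow>\<^sub>L 'e) \<Rightarrow> nat \<Rightarrow> 'e \<Rightarrow>\<^sub>L 'e" where
  "blk z j = Q (b \<circ> \<rho> j) o\<^sub>L (z - id_blinfun) o\<^sub>L Q' (b \<circ> \<rho> j)"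

definition amp :: "('e \<Rightarrow>\<^sub>L 'e) \<Rightarrow> 'e \<Rightarrow>\<^sub>L 'e" where
  "amp z = id_blinfun + strong_sum UNIV (blk z)"

lemma fons_\<rho>: "fons UNIV (b \<circ> \<rho> j)" using inj_\<rho> by (rule fons_b)

lemma blk_apply: "blk z j v = Q (b \<circ> \<rho> j) (z (Q' (b \<circ> \<rho> j) v) - Q' (b \<circ> \<rho> j) v)"
  by (simp add: blk_def blin_simps)

lemma Q_inner: "fons UNIV e \<Longrightarrow> Q e v \<bullet> Q e w = v \<bullet> w"
  by (simp add: Q_adjoint)

lemma norm_Q: "fons UNIV e \<Longrightarrow> norm (Q e v) = norm v"
  by (simp add: norm_eq_sqrt_inner Q_inner)

lemma Q_\<rho>_orth: "j \<noteq> k \<Longrightarrow> Q (b \<circ> \<rho> j) v \<bullet> Q (b \<circ> \<rho> k) w = 0"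
  using \<rho>_disjoint[of k j] by (simp add: Q_adjoint fons_\<rho>)

lemma Q'_Bessel:
  assumes "finite F"
  shows "(\<Sum>j\<in>F. (norm (Q' (b \<circ> \<rho> j) v))\<^sup>2) \<le> (norm v)\<^sup>2"
proof -
  let ?x = "\<lambda>j. Q (b \<circ> \<rho> j) (Q' (b \<circ> \<rho> j) v)"
  let ?p = "\<Sum>j\<in>F. ?x j"
  have 1: "?p \<bullet> v = (\<Sum>j\<in>F. (norm (Q' (b \<circ> \<rho> j) v))\<^sup>2)"
    by (simp add: inner_sum_left Q_adjoint fons_\<rho> power2_norm_eq_inner)
  have "(norm ?p)\<^sup>2 = (\<Sum>j\<in>F. (norm (?x j))\<^sup>2)"
    using assms Q_\<rho>_orth by (intro norm_sum_orthogonal) auto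
  then have 2: "?p \<bullet> ?p = (\<Sum>j\<in>F. (norm (Q' (b \<circ> \<rho> j) v))\<^sup>2)"
    by (simp add: norm_Q fons_\<rho> power2_norm_eq_inner)
  have "0 \<le> (v - ?p) \<bullet> (v - ?p)" by simp
  also have "\<dots> = v \<bullet> v - (v \<bullet> ?p) - (?p \<bullet> v) + ?p \<bullet> ?p"
    unfolding inner_diff_left inner_diff_right by simp
  also have "\<dots> = v \<bullet> v - ?p \<bullet> v"
    using 1 2 by (simp only: inner_commute[of v ?p])
  finally show ?thesis using 1 by (simp add: power2_norm_eq_inner)
qed

lemma blk_orth_family: "orth_family I (blk z) (norm (z - id_blinfun)) TYPE('e)"
  unfolding orth_family_def
proof (intro conjI ballI impI allI)
  fix F v assume F: "finite F" "F \<subseteq> I"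
  have "(\<Sum>i\<in>F. (norm (blk z i v))\<^sup>2) \<le> (\<Sum>i\<in>F. (norm (z - id_blinfun))\<^sup>2 * (norm (Q' (b \<circ> \<rho> i) v))\<^sup>2)"
  proof (rule sum_mono)
    fix i
    have "norm (blk z i v) = norm ((z - id_blinfun) (Q' (b \<circ> \<rho> i) v))"
      by (simp add: blk_def norm_Q fons_\<rho>)
    also have "\<dots> \<le> norm (z - id_blinfun) * norm (Q' (b \<circ> \<rho> i) v)" by (rule norm_blinfun)
    finally show "(norm (blk z i v))\<^sup>2 \<le> (norm (z - id_blinfun))\<^sup>2 * (norm (Q' (b \<circ> \<rho> i) v))\<^sup>2"
      by (simp add: power_mult_distrib[symmetric] power_mono)
  qed
  also have "\<dots> \<le> (norm (z - id_blinfun))\<^sup>2 * (norm v)\<^sup>2"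
    unfolding sum_distrib_left[symmetric] by (intro mult_left_mono Q'_Bessel F(1)) simp
  finally show "(\<Sum>i\<in>F. (norm (blk z i v))\<^sup>2) \<le> (norm (z - id_blinfun) * norm v)\<^sup>2"
    by (simp add: power_mult_distrib)
qed (auto simp: blk_apply Q_\<rho>_orth)

lemma blk_summable: "(\<lambda>j. blk z j v) summable_on I"
  by (rule strong_sum_summable[OF blk_orth_family])

lemma amp_apply: "amp z v = v + (\<Sum>\<^sub>\<infinity>j. blk z j v)"
  by (simp add: amp_def blinfun.add_left strong_sum_apply[OF blk_orth_family])

lemma blk_blk: "j \<noteq> k \<Longrightarrow> blk z j (blk z' k v) = 0"
  by (simp add: blk_apply fons_\<rho> \<rho>_disjoint)

lemma blinfun_infsum_blk:
  fixes L :: "'e \<Rightarrow>\<^sub>L 'e"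
  shows "L (\<Sum>\<^sub>\<infinity>j. blk z j v) = (\<Sum>\<^sub>\<infinity>j. blinfun_apply L (blk z j v))"
  using infsum_bounded_linear(1)[OF blinfun.bounded_linear_right blk_summable] .

lemma amp_compose: "amp z o\<^sub>L amp z' = amp (z o\<^sub>L z')"
proof (rule blinfun_eqI)
  fix v
  have s: "blk z j (\<Sum>\<^sub>\<infinity>k. blk z' k v) = blk z j (blk z' j v)" for j
    unfolding blinfun_infsum_blk
    by (rule infsum_single) (auto simp: blk_blk)
  have "(amp z o\<^sub>L amp z') v = v + (\<Sum>\<^sub>\<infinity>k. blk z' k v) + (\<Sum>\<^sub>\<infinity>j. blk z j (v + (\<Sum>\<^sub>\<infinity>k. blk z' k v)))"
    by (simp add: amp_apply)
  also have "\<dots> = v + (\<Sum>\<^sub>\<infinity>j. blk z' j v + blk z j (v + (\<Sum>\<^sub>\<infinity>k. blk z' k v)))"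
    by (simp add: infsum_add blk_summable)
  also have "\<dots> = v + (\<Sum>\<^sub>\<infinity>j. blk (z o\<^sub>L z') j v)"
    by (simp add: blinfun.add_right s) (simp add: blk_apply blin_simps fons_\<rho>)
  finally show "(amp z o\<^sub>L amp z') v = amp (z o\<^sub>L z') v" by (simp add: amp_apply)
qed

lemma amp_id: "amp id_blinfun = id_blinfun"
  by (rule blinfun_eqI) (simp add: amp_apply blk_apply)

text \<open>As \<open>amp z\<close> is only a strong limit, invertibility comes from
  \<open>amp\<close> of the inverse, and the form is expanded block by block, where mixed terms of
  different blocks vanish.\<close>

lemma amp_Gr:
  assumes "z \<in> Gr"
  shows "amp z \<in> Gr"
proof -
  obtain z' where z': "z o\<^sub>L z' = id_blinfun" "z' o\<^sub>L z = id_blinfun" using inverse_Gr[OF assms] by metis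
  have "\<exists>h. amp z o\<^sub>L h = id_blinfun \<and> h o\<^sub>L amp z = id_blinfun"
    by (rule exI[of _ "amp z'"]) (simp add: z' amp_id amp_compose)
  moreover have "amp z (a v) = a (amp z v)" if "a \<in> U" for a v
  proof -
    have "blk z j (a v) = a (blk z j v)" for j
      using assms that U_subset by (auto simp: blk_apply Q_Z Q'_Z fons_\<rho> blin_simps Gr_def subset_iff)
    then show ?thesis by (simp add: amp_apply blinfun.add_right blinfun_infsum_blk)
  qed
  moreover have "amp z v \<bullet> a (amp z w) = v \<bullet> a w" if a: "a \<in> V" for a v w
  proof -
    have aZ: "a \<in> Z" using a V_subset by blast
    let ?Bv = "\<Sum>\<^sub>\<infinity>j. blk z j v" and ?Bw = "\<Sum>\<^sub>\<infinity>j. blk z j w"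
    have L: "x \<bullet> a ?Bw = (\<Sum>\<^sub>\<infinity>j. x \<bullet> a (blk z j w))" for x
      unfolding blinfun_infsum_blk
      by (rule infsum_bounded_linear[OF bounded_linear_inner_right infsum_bounded_linear(2)[OF blinfun.bounded_linear_right blk_summable]])
    have Ls: "(\<lambda>j. x \<bullet> a (blk z j w)) summable_on UNIV" for x
      by (rule infsum_bounded_linear[OF bounded_linear_inner_right infsum_bounded_linear(2)[OF blinfun.bounded_linear_right blk_summable]])
    have R: "?Bv \<bullet> x = (\<Sum>\<^sub>\<infinity>j. blk z j v \<bullet> x)" "(\<lambda>j. blk z j v \<bullet> x) summable_on UNIV" for x
      by (rule infsum_bounded_linear[OF bounded_linear_inner_left blk_summable])+
    have diag: "blk z j v \<bullet> a ?Bw = blk z j v \<bullet> a (blk z j w)" for j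
      unfolding L
      by (rule infsum_single) (use aZ in \<open>auto simp: blk_apply Q_\<rho>_orth fons_\<rho> simp flip: Q_Z\<close>)
    \<comment> \<open>Invariance of the form under a single copy, after cancelling v \<bullet>
      \<open>a\<close> w: the linear and quadratic terms of each block cancel.\<close>
    have tm: "v \<bullet> a (blk z j w) + (blk z j v \<bullet> a w + blk z j v \<bullet> a (blk z j w)) = 0" for j
      using tw_form[OF fons_\<rho> assms a, of j v w]
      by (simp add: tw_apply blk_apply blin_simps inner_add_left inner_add_right)
    have "amp z v \<bullet> a (amp z w) = v \<bullet> a w + (v \<bullet> a ?Bw + (?Bv \<bullet> a w + ?Bv \<bullet> a ?Bw))"
      by (simp add: amp_apply blinfun.add_right inner_add_left inner_add_right)
    also have "v \<bullet> a ?Bw + (?Bv \<bullet> a w + ?Bv \<bullet> a ?Bw) =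
       (\<Sum>\<^sub>\<infinity>j. v \<bullet> a (blk z j w) + (blk z j v \<bullet> a w + blk z j v \<bullet> a ?Bw))"
      unfolding R(1) unfolding L[of v] by (simp only: infsum_add Ls R(2) summable_on_add)
    also have "\<dots> = 0" by (simp add: diag tm)
    finally show ?thesis by simp
  qed
  ultimately show ?thesis by (simp add: Gr_def)
qed

text \<open>Moves block j onto block j + 1, so that \<open>b \<circ> shift\<close> omits exactly
  block 0.\<close>

definition shift :: "nat \<Rightarrow> nat" where
  "shift n = prod_encode (Suc (fst (prod_decode n)), snd (prod_decode n))"

lemma inj_shift: "inj shift"
proof (rule injI)
  fix x y assume "shift x = shift y"
  then have "prod_decode x = prod_decode y" by (simp add: shift_def prod_eq_iff)
  then show "x = y" by (metis prod_decode_inverse)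
qed

lemma shift_\<rho>: "shift \<circ> \<rho> j = \<rho> (Suc j)"
  by (auto simp: shift_def \<rho>_def)

lemma amp_split: "amp z = tw (b \<circ> \<rho> 0) z o\<^sub>L tw (b \<circ> shift) (amp z)"
proof (rule blinfun_eqI)
  fix v
  have fs: "fons UNIV (b \<circ> shift)" using inj_shift by (rule fons_b)
  have QQ: "Q (b \<circ> shift) (Q (b \<circ> \<rho> j) x) = Q (b \<circ> \<rho> (Suc j)) x"
    "Q' (b \<circ> \<rho> j) (Q' (b \<circ> shift) x) = Q' (b \<circ> \<rho> (Suc j)) x" for j x
    using Q_compose[OF fs inj_\<rho>] Q'_compose[OF fs inj_\<rho>] by (simp_all add: comp_assoc shift_\<rho>)
  have "tw (b \<circ> shift) (amp z) v = v + (\<Sum>\<^sub>\<infinity>j. Q (b \<circ> shift) (blk z j (Q' (b \<circ> shift) v)))"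
    by (simp add: tw_apply amp_apply blinfun.add_right blinfun_infsum_blk)
  also have "\<dots> = v + (\<Sum>\<^sub>\<infinity>j. blk z (Suc j) v)"
    by (simp add: blk_apply QQ)
  also have "(\<Sum>\<^sub>\<infinity>j. blk z (Suc j) v) = (\<Sum>\<^sub>\<infinity>j\<in>range Suc. blk z j v)"
    by (subst infsum_reindex) (auto simp: o_def)
  finally have 1: "tw (b \<circ> shift) (amp z) v = v + (\<Sum>\<^sub>\<infinity>j\<in>range Suc. blk z j v)" .
  have tw0: "tw (b \<circ> \<rho> 0) z x = x + blk z 0 x" for x
    by (simp add: tw_apply blk_apply blinfun.diff_right)
  have "blk z 0 (\<Sum>\<^sub>\<infinity>j\<in>range Suc. blk z j v) = (\<Sum>\<^sub>\<infinity>j\<in>range Suc. blk z 0 (blk z j v))"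
    by (rule infsum_bounded_linear[OF blinfun.bounded_linear_right blk_summable])
  also have "\<dots> = 0" by (rule infsum_0) (auto simp: blk_blk)
  finally have 2: "blk z 0 (\<Sum>\<^sub>\<infinity>j\<in>range Suc. blk z j v) = 0" .
  have "(\<Sum>\<^sub>\<infinity>j\<in>{0} \<union> range Suc. blk z j v) = (\<Sum>\<^sub>\<infinity>j\<in>{0}. blk z j v) + (\<Sum>\<^sub>\<infinity>j\<in>range Suc. blk z j v)"
    by (rule infsum_Un_disjoint) (auto intro: blk_summable)
  moreover have "{0} \<union> range Suc = (UNIV :: nat set)" using UNIV_nat_eq[symmetric] by (simp only: insert_is_Un[symmetric])
  ultimately have 3: "(\<Sum>\<^sub>\<infinity>j. blk z j v) = blk z 0 v + (\<Sum>\<^sub>\<infinity>j\<in>range Suc. blk z j v)"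
    by (simp only: infsum_finite finite.intros sum.insert sum.empty) simp
  show "amp z v = (tw (b \<circ> \<rho> 0) z o\<^sub>L tw (b \<circ> shift) (amp z)) v"
    unfolding amp_apply[of z v] 3 blinfun_apply_blinfun_compose 1 tw0 blinfun.add_right 2 by simp
qed

text \<open>Let A be one copy of \<open>z\<close> and B the shifted copy of \<open>amp z\<close>.
  The unshifted copy of \<open>amp z\<close> is AB, yet it has the same image as B; cancelling the
  image of B leaves the identity as image of A.\<close>

theorem tw_Ker:
  assumes e: "fons UNIV e" and z: "z \<in> Gr"
  shows "tw (e \<circ> ((\<lambda>n. 2 * n) \<circ> \<rho> 0)) z \<in> Ker"
proof -
  let ?ev = "\<lambda>n::nat. 2 * n" and ?od = "\<lambda>n::nat. 2 * n + 1"
  have i: "inj ?ev" "inj ?od" "inj (?ev \<circ> shift)" "inj (?ev \<circ> \<rho> 0)"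
    using inj_shift inj_\<rho> by (auto intro!: inj_compose simp: inj_on_def[of "\<lambda>n. 2 * n"] inj_on_def[of "\<lambda>n. Suc (2 * n)"])
  have f: "fons UNIV (e \<circ> ?ev)" "fons UNIV (e \<circ> ?od)" "fons UNIV (e \<circ> (?ev \<circ> shift))" "fons UNIV (e \<circ> (?ev \<circ> \<rho> 0))"
    by (rule fons_compose[OF e]; use i in simp)+
  have ne: "2 * m \<noteq> Suc (2 * n)" for m n :: nat by presburger
  have z1: "zorth UNIV (e \<circ> ?ev) UNIV (e \<circ> ?od)"
    by (rule zorth_compose[OF e]) (auto simp: ne)
  have z2: "zorth UNIV (e \<circ> (?ev \<circ> shift)) UNIV (e \<circ> ?od)"
    by (rule zorth_compose[OF e]) (auto simp: ne)
  let ?Y = "amp z"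
  have Y: "?Y \<in> Gr" using z by (rule amp_Gr)
  \<comment> \<open>The unshifted and the shifted system overlap, so \<open>\<pi>_tw\<close> does
    not compare them directly. The odd indices, kept free for this purpose, are disjoint from
    both.\<close>
  have eq: "\<pi> (tw (e \<circ> ?ev) ?Y) = \<pi> (tw (e \<circ> (?ev \<circ> shift)) ?Y)"
    using \<pi>_tw[OF jfonsI[OF f(1,2) z1] Y] \<pi>_tw[OF jfonsI[OF f(3,2) z2] Y] by simp
  let ?A = "tw (e \<circ> (?ev \<circ> \<rho> 0)) z" and ?B = "tw (e \<circ> (?ev \<circ> shift)) ?Y"
  have "tw (e \<circ> ?ev) ?Y = tw (e \<circ> ?ev) (tw (b \<circ> \<rho> 0) z o\<^sub>L tw (b \<circ> shift) ?Y)"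
    using amp_split by simp
  also have "\<dots> = ?A o\<^sub>L ?B"
    by (simp add: tw_compose[OF f(1)] tw_tw[OF f(1) inj_\<rho>] tw_tw[OF f(1) inj_shift] comp_assoc)
  finally have "\<pi> ?A o\<^sub>L \<pi> ?B = \<pi> ?B"
    using eq tw_Gr[OF f(4) z] tw_Gr[OF f(3) Y] by (simp add: \<pi>_compose)
  moreover obtain B' where "B' \<in> Gr" "?B o\<^sub>L B' = id_blinfun" using inverse_Gr[OF tw_Gr[OF f(3) Y]] by metis
  then have B': "\<pi> ?B o\<^sub>L \<pi> B' = id_blinfun" using \<pi>_compose[OF tw_Gr[OF f(3) Y]] \<pi>_id by metis
  have "\<pi> ?A = (\<pi> ?A o\<^sub>L \<pi> ?B) o\<^sub>L \<pi> B'" by (simp add: blinfun_compose_assoc B')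
  ultimately have "\<pi> ?A = id_blinfun" by (simp add: B')
  then show ?thesis using tw_Gr[OF f(4) z] by (simp add: Ker_def)
qed

end

section \<open>Reduction to operators fixing an infinite free system\<close>

text \<open>Dependent choice in which each step sees the set of all earlier choices; the recursion
  carries them along as a list.\<close>

lemma choose_sequence:
  assumes "\<And>S :: 'a set. finite S \<Longrightarrow> \<exists>x. P S x"
  shows "\<exists>f :: nat \<Rightarrow> 'a. \<forall>n. P (f ` {..<n}) (f n)"
proof -
  define L where "L = rec_nat [] (\<lambda>n l. l @ [SOME x. P (set l) x])"
  have LS: "L (Suc n) = L n @ [SOME x. P (set (L n)) x]" for n by (simp add: L_def)
  define f where "f n = (SOME x. P (set (L n)) x)" for n
  have "set (L n) = f ` {..<n}" for n
  proof (induction n)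
    case 0
    then show ?case by (simp add: L_def)
  next
    case (Suc n)
    then show ?case by (simp add: LS f_def lessThan_Suc)
  qed
  moreover have "P (set (L n)) (f n)" for n
    unfolding f_def by (rule someI_ex) (simp add: assms)
  ultimately show ?thesis by metis
qed

text \<open>Gaussian elimination: equation \<open>k\<close> with pivot \<open>f k l\<close> removes
  the unknown \<open>l\<close> from the remaining equations.\<close>

lemma homogeneous_system:
  fixes f :: "'k \<Rightarrow> 'j \<Rightarrow> real"
  assumes "finite K" "finite J" "card K < card J"
  shows "\<exists>c. (\<exists>j\<in>J. c j \<noteq> 0) \<and> (\<forall>k\<in>K. (\<Sum>j\<in>J. c j * f k j) = 0)"
  using assms
proof (induction K arbitrary: J f rule: finite_induct)
  case empty
  then obtain j where "j \<in> J" by fastforce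
  then show ?case by (intro exI[of _ "\<lambda>_. 1"]) auto
next
  case (insert k K)
  show ?case
  proof (cases "\<forall>j\<in>J. f k j = 0")
    case True
    have "card K < card J" using insert by simp
    then obtain c where "\<exists>j\<in>J. c j \<noteq> 0" "\<forall>k\<in>K. (\<Sum>j\<in>J. c j * f k j) = 0"
      using insert.IH[OF insert.prems(1), of f] by blast
    then show ?thesis using True by (intro exI[of _ c]) auto
  next
    case False
    then obtain l where l: "l \<in> J" "f k l \<noteq> 0" by blast
    let ?J = "J - {l}"
    have "card K < card ?J" using insert l by simp
    then obtain c where c: "\<exists>j\<in>?J. c j \<noteq> 0"
      "\<forall>m\<in>K. (\<Sum>j\<in>?J. c j * (f m j - f k j / f k l * f m l)) = 0"
      using insert.IH[of ?J "\<lambda>m j. f m j - f k j / f k l * f m l"] insert.prems by auto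
    define T where "T = (\<Sum>j\<in>?J. c j * f k j)"
    \<comment> \<open>The value at \<open>l\<close> is the one forced by equation
      \<open>k\<close>.\<close>
    define c' where "c' j = (if j = l then - T / f k l else c j)" for j
    have split: "(\<Sum>j\<in>J. c' j * f m j) = - T / f k l * f m l + (\<Sum>j\<in>?J. c j * f m j)" for m
    proof -
      have "(\<Sum>j\<in>J. c' j * f m j) = c' l * f m l + (\<Sum>j\<in>?J. c' j * f m j)"
        using l(1) insert.prems(1) by (rule sum.remove[rotated])
      also have "(\<Sum>j\<in>?J. c' j * f m j) = (\<Sum>j\<in>?J. c j * f m j)"
        by (rule sum.cong) (auto simp: c'_def)
      finally show ?thesis by (simp add: c'_def)
    qed
    have "(\<Sum>j\<in>J. c' j * f m j) = 0" if "m \<in> insert k K" for m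
    proof (cases "m = k")
      case True
      then show ?thesis using l(2) split[of k] by (simp add: T_def)
    next
      case False
      then have "(\<Sum>j\<in>?J. c j * (f m j - f k j / f k l * f m l)) = 0" using c that by simp
      moreover have "(\<Sum>j\<in>?J. c j * (f m j - f k j / f k l * f m l)) = (\<Sum>j\<in>?J. c j * f m j) - T / f k l * f m l"
        unfolding T_def sum_divide_distrib sum_distrib_right sum_subtractf[symmetric]
        by (rule sum.cong) (auto simp: algebra_simps)
      ultimately show ?thesis using split[of m] by simp
    qed
    moreover have "\<exists>j\<in>J. c' j \<noteq> 0" using c(1) by (auto simp: c'_def)
    ultimately show ?thesis by blast
  qed
qed

context free_action
begin

definition ort :: "'e \<Rightarrow> 'e \<Rightarrow> bool" where "ort x y \<longleftrightarrow> (\<forall>a\<in>Z. x \<bullet> blinfun_apply a y = 0)"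

lemma ort_sym: "ort x y \<Longrightarrow> ort y x"
  using zorth_sym[of "{()}" "\<lambda>_. x" "{()}" "\<lambda>_. y"] by (auto simp: ort_def zorth_def)

end

context based_rep
begin

text \<open>The condition is bilinear over the reals and so passes from the basis to its real span.
  General vectors may fail it, since elements of \<open>V\<close> can be symmetric
  operators.\<close>

lemma free_span:
  assumes "x \<in> span (range b)" "y \<in> span (range b)" "a \<in> Z" "a \<noteq> id_blinfun" "a \<noteq> - id_blinfun"
  shows "x \<bullet> a y = 0"
proof -
  have bb: "b i \<bullet> a (b j) = 0" for i j
    using b assms(3-5) unfolding fons_def by auto
  have "b i \<bullet> a y = 0" for i
    using assms(2)
  proof (induction rule: span_induct_alt)
    case (step c z y)
    then show ?case using bb by (auto simp: blin_simps inner_add_right)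
  qed (simp add: blin_simps)
  with assms(1) show ?thesis
  proof (induction rule: span_induct_alt)
    case (step c z y)
    then show ?case by (auto simp: inner_add_left)
  qed simp
qed

lemma exists_free_orthogonal:
  fixes g :: "'e \<Rightarrow>\<^sub>L 'e"
  assumes "finite S"
  shows "\<exists>e. e \<in> span (range b) \<and> norm e = 1 \<and> (\<forall>s\<in>S. e \<bullet> s = 0 \<and> g e \<bullet> s = 0)"
proof -
  have ob: "b i \<bullet> b j = (if i = j then 1 else 0)" for i j
    using fons_ons'[OF b] by (simp add: ons_def)
  \<comment> \<open>Each element of \<open>S\<close> imposes two linear conditions; the indices up
    to and including \<open>2 * card S\<close> give one more unknown than conditions.\<close>
  let ?K = "S \<times> (UNIV :: bool set)" and ?J = "{..2 * card S}"
  let ?f = "\<lambda>(s, c) j. if c then b j \<bullet> s else g (b j) \<bullet> s"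
  have "card ?K < card ?J" by (simp add: card_cartesian_product)
  then obtain c where c: "\<exists>j\<in>?J. c j \<noteq> 0" "\<forall>k\<in>?K. (\<Sum>j\<in>?J. c j * ?f k j) = 0"
    using homogeneous_system[of ?K ?J ?f] assms by auto
  define x where "x = (\<Sum>j\<in>?J. c j *\<^sub>R b j)"
  have xs: "x \<bullet> s = 0 \<and> g x \<bullet> s = 0" if "s \<in> S" for s
    using bspec[OF c(2), of "(s, True)"] bspec[OF c(2), of "(s, False)"] that
    by (simp add: x_def blin_simps inner_sum_left)
  have xsp: "x \<in> span (range b)" unfolding x_def by (intro span_sum span_scale span_base) auto
  have "x \<noteq> 0"
  proof
    assume "x = 0"
    obtain l where l: "l \<in> ?J" "c l \<noteq> 0" using c(1) by blast
    have "x \<bullet> b l = (\<Sum>j\<in>?J. c j * (if j = l then 1 else 0))" by (simp add: x_def inner_sum_left ob)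
    also have "\<dots> = (\<Sum>j\<in>?J. if j = l then c l else 0)" by (rule sum.cong) auto
    also have "\<dots> = c l" using l by simp
    finally show False using l \<open>x = 0\<close> by simp
  qed
  then show ?thesis
    by (intro exI[of _ "(1 / norm x) *\<^sub>R x"]) (use xs xsp in \<open>auto simp: span_scale blin_simps\<close>)
qed

lemma Eop_basis:
  assumes "jfons I u w" "bounded_on I c" "k \<in> I"
  shows "Eop I c s u w (u k) = u k + (s * c k) *\<^sub>R w k" "Eop I c s u w (w k) = w k"
proof -
  note f = assms(1)[unfolded jfons_def]
  have 1: "KX V I c w u (u k) = 0"
    by (rule KX_orth) (use f assms V_subset in \<open>auto simp: zorth_def subset_iff\<close>)
  have 2: "KX U I c u w (w k) = 0"
    by (rule KX_orth) (use f assms U_subset in \<open>auto simp: zorth_def subset_iff\<close>)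
  show "Eop I c s u w (u k) = u k + (s * c k) *\<^sub>R w k" "Eop I c s u w (w k) = w k"
    using f assms by (simp_all add: Eop_apply 1 2 KX_U_basis KX_V_basis)
qed

text \<open>Kernel transvections first push \<open>g p\<close> onto a system \<open>w\<close>
  orthogonal to both \<open>p\<close> and \<open>g p\<close>, and then push \<open>w\<close> onto
  \<open>p\<close>.\<close>

lemma reduce_to_fixing:
  assumes g: "g \<in> Gr"
  obtains x p w where "x \<in> Gr" "\<pi> x = \<pi> g" "jfons (UNIV :: nat set) p w" "\<And>k. x (p k) = p k"
proof -
  obtain h :: "'e \<Rightarrow>\<^sub>L 'e" where h: "\<And>v. h (g v) = v" using inverse_Gr[OF g] by metis
  define A where "A S = (\<Union>s\<in>S. \<Union>a\<in>Z. {blinfun_apply a s, blinfun_apply a (g s)})" for S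
  have "\<exists>e. e \<in> span (range b) \<and> norm e = 1 \<and> (\<forall>s\<in>A S. e \<bullet> s = 0 \<and> g e \<bullet> s = 0)" if "finite S" for S
    by (rule exists_free_orthogonal) (use that finite_Z in \<open>auto simp: A_def\<close>)
  then have "\<exists>e :: nat \<Rightarrow> 'e. \<forall>n. e n \<in> span (range b) \<and> norm (e n) = 1 \<and>
      (\<forall>s\<in>A (e ` {..<n}). e n \<bullet> s = 0 \<and> g (e n) \<bullet> s = 0)"
    by (rule choose_sequence[of "\<lambda>S e. e \<in> span (range b) \<and> norm e = 1 \<and> (\<forall>s\<in>A S. e \<bullet> s = 0 \<and> g e \<bullet> s = 0)"])
  then obtain e :: "nat \<Rightarrow> 'e" where e: "e n \<in> span (range b) \<and> norm (e n) = 1 \<and>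
      (\<forall>s\<in>A (e ` {..<n}). e n \<bullet> s = 0 \<and> g (e n) \<bullet> s = 0)" for n
    by blast
  have lt: "ort (e n) (e m)" "ort (e n) (g (e m))" "ort (g (e n)) (e m)" "ort (g (e n)) (g (e m))" if "m < n" for m n
    using e[of n] that unfolding ort_def A_def by auto
  have ne: "ort (e n) (e m)" "ort (e n) (g (e m))" "ort (g (e n)) (e m)" "ort (g (e n)) (g (e m))" if "m \<noteq> n" for m n
    using lt[of m n] lt[of n m, THEN ort_sym] that by (cases "m < n"; simp)+
  define r where "r n = norm (g (e n))" for n
  have nh: "1 \<le> norm h * r n" for n
    using norm_blinfun[of h "g (e n)"] e[of n] by (simp add: h r_def)
  have r: "r n > 0" for n
    using nh[of n] norm_ge_zero[of "g (e n)"] unfolding r_def by (cases "norm (g (e n)) = 0") auto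
  define f where "f n = (1 / r n) *\<^sub>R g (e n)" for n
  have fe: "fons UNIV e"
    unfolding fons_def
  proof (intro ballI)
    fix i j a assume a: "a \<in> Z"
    show "e i \<bullet> act a e j = (if i = j then if a = id_blinfun then 1 else if a = - id_blinfun then - 1 else 0 else 0)"
      using ne(1)[of j i] a e free_span[of "e i" "e i" a]
      by (auto simp: ort_def blinfun.minus_left norm_eq_1)
  qed
  have ff: "fons UNIV f"
    unfolding fons_def
  proof (intro ballI)
    fix i j a assume a: "a \<in> Z"
    \<comment> \<open>Images under \<open>g\<close> leave the span of \<open>b\<close>, so freeness
      needs a new reason: elements of \<open>U\<close> are skew on every vector, and for
      \<open>V\<close> the form preserved by \<open>g\<close> leads back to
      \<open>e i\<close>.\<close>
    have "g (e i) \<bullet> a (g (e i)) = 0" if "a \<noteq> id_blinfun" "a \<noteq> - id_blinfun"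
    proof (cases "a \<in> U")
      case True
      then show ?thesis using skew_U that by blast
    next
      case False
      then have "a \<in> V" using a by (simp add: V_def)
      then have "g (e i) \<bullet> a (g (e i)) = e i \<bullet> a (e i)" using g by (simp add: Gr_def)
      then show ?thesis using free_span[of "e i" "e i" a] e that a by auto
    qed
    then show "f i \<bullet> act a f j = (if i = j then if a = id_blinfun then 1 else if a = - id_blinfun then - 1 else 0 else 0)"
      using ne(4)[of j i] a r[of i]
      by (auto simp: ort_def f_def blin_simps r_def power2_norm_eq_inner[symmetric] power2_eq_square)
  qed
  \<comment> \<open>Even indices supply \<open>p\<close> and its normalized image \<open>u\<close>,
    odd ones the stopover \<open>w\<close>. Vectors \<open>e n\<close> and \<open>g (e n)\<close>
    with the same index are not known to be orthogonal.\<close>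
  define u w p where "u k = f (2 * k)" and "w k = e (2 * k + 1)" and "p k = e (2 * k)" for k
  have i: "inj (\<lambda>k::nat. 2 * k)" "inj (\<lambda>k::nat. 2 * k + 1)" by (auto simp: inj_on_def)
  have neq: "2 * k \<noteq> Suc (2 * l)" for k l :: nat by presburger
  have fu: "fons UNIV u" "fons UNIV w" "fons UNIV p"
    using fons_compose[OF ff i(1)] fons_compose[OF fe i(2)] fons_compose[OF fe i(1)]
    unfolding u_def w_def p_def o_def by simp_all
  have "zorth UNIV w UNIV p"
    using ne(1) neq unfolding zorth_def w_def p_def ort_def by (auto simp: neq[symmetric])
  then have jwp: "jfons UNIV w p" "jfons UNIV p w" using fu jfonsI jfons_sym by blast+
  have "ort (g (e (2 * k))) (e (2 * l + 1))" for k l using ne(3)[of "2 * l + 1" "2 * k"] neq[of k l] by auto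
  then have "zorth UNIV u UNIV w"
    unfolding zorth_def u_def w_def f_def by (auto simp: ort_def)
  then have juw: "jfons UNIV u w" "jfons UNIV w u" using fu jfonsI jfons_sym by blast+
  \<comment> \<open>The bounded inverse \<open>h\<close> keeps the norms \<open>r\<close> away from
    0, so the reciprocal weights are bounded.\<close>
  have c1: "bounded_on UNIV (\<lambda>k. 1 / r (2 * k))"
    unfolding bounded_on_def using nh r by (intro exI[of _ "norm h"]) (auto simp: field_simps abs_of_pos)
  have c2: "bounded_on UNIV (\<lambda>k. r (2 * k))"
    unfolding bounded_on_def r_def using e norm_blinfun[of g "e (2 * _)"] by (intro exI[of _ "norm g"]) auto
  have ge: "g (p k) = r (2 * k) *\<^sub>R u k" for k using r[of "2 * k"] by (simp add: p_def u_def f_def)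
  let ?E1 = "Eop UNIV (\<lambda>k. 1 / r (2 * k)) 1 u w" and ?E2 = "Eop UNIV (\<lambda>k. r (2 * k)) (-1) w u"
    and ?E3 = "Eop UNIV one 1 w p" and ?E4 = "Eop UNIV one (-1) p w"
  have K: "?E1 \<in> Ker" "?E2 \<in> Ker" "?E3 \<in> Ker" "?E4 \<in> Ker"
    by (rule Eop_Ker; fact juw jwp c1 c2 bounded_on_const)+
  let ?x = "?E4 o\<^sub>L (?E3 o\<^sub>L (?E2 o\<^sub>L (?E1 o\<^sub>L g)))"
  have x: "?x \<in> Gr" "\<pi> ?x = \<pi> g"
    using K g by (simp_all add: \<pi>_Ker_left compose_Gr Ker_Gr)
  \<comment> \<open>With r for \<open>r (2 * k)\<close> the path is r u \<mapsto> r u + w \<mapsto>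
    w \<mapsto> w + p \<mapsto> p.\<close>
  have "?x (p k) = p k" for k
  proof -
    have 1: "?E1 (g (p k)) = g (p k) + w k"
      using r[of "2 * k"] by (simp add: ge blin_simps Eop_basis juw c1 scaleR_add_right)
    have 2: "?E2 (g (p k) + w k) = w k"
      by (simp add: ge blin_simps Eop_basis juw c2)
    have 3: "?E4 (?E3 (w k)) = p k"
      by (simp add: blin_simps Eop_basis jwp)
    show ?thesis by (simp only: blinfun_apply_blinfun_compose 1 2 3)
  qed
  then show thesis using that[OF x jwp(2)] by blast
qed

lemma inverse_Ker:
  assumes "g \<in> Ker" "h \<in> Gr" "g o\<^sub>L h = id_blinfun"
  shows "h \<in> Ker"
  using \<pi>_Ker_left[OF assms(1,2)] assms \<pi>_id by (simp add: Ker_def)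

lemma dop_power_Ker:
  fixes p :: "nat \<Rightarrow> 'e"
  assumes "jfons UNIV p w"
  shows "dop UNIV p (2 ^ n) \<in> Ker" "dop UNIV p (1 / 2 ^ n) \<in> Ker"
proof -
  have f: "fons UNIV p" using assms by (simp add: jfons_def)
  show *: "dop UNIV p (2 ^ n) \<in> Ker"
  proof (induction n)
    case 0
    then show ?case using \<pi>_id id_Gr by (simp add: dop_one Ker_def)
  next
    case (Suc n)
    have "dop UNIV p (2 ^ Suc n) = dop UNIV p 2 o\<^sub>L dop UNIV p (2 ^ n)"
      by (rule blinfun_eqI) (simp add: dop_dop[OF f])
    then show ?case using compose_Ker[OF dop_Ker[OF assms] Suc] by simp
  qed
  show "dop UNIV p (1 / 2 ^ n) \<in> Ker"
    by (rule inverse_Ker[OF *]) (use f in \<open>auto intro!: dop_Gr blinfun_eqI simp: dop_inverse\<close>)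
qed

text \<open>With respect to \<open>P\<close>, \<open>R\<close>, \<open>P'\<close> the operator \<open>x\<close> is block upper triangular with identities in the outer diagonal
  blocks. Conjugation with powers of the scaling contracts it to its diagonal part \<open>y\<close>, and \<open>k\<close> conjugates
  \<open>y\<close> to a copy of \<open>y\<close> inside the range of \<open>P + P'\<close>, to which the swindle applies.\<close>

lemma fixing_in_Ker:
  fixes p w :: "nat \<Rightarrow> 'e"
  assumes x: "x \<in> Gr" and j: "jfons UNIV p w" and xp: "\<And>k. x (p k) = p k"
  shows "\<pi> x = id_blinfun"
proof -
  have f: "fons UNIV p" using j by (simp add: jfons_def)
  define P where "P = KX U UNIV one p p"
  define P' where "P' = KX V UNIV one p p"
  define R where "R = id_blinfun - P - P'"
  have R: "R v = v - P v - P' v" for v by (simp add: R_def blin_simps)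
  have PP: "P (P v) = P v" "P' (P' v) = P' v" "P (P' v) = 0" "P' (P v) = 0" for v
    using f by (simp_all add: P_def P'_def)
  have RP: "R (P v) = 0" "R (P' v) = 0" "P (R v) = 0" "P' (R v) = 0" "R (R v) = R v" for v
    by (simp_all add: R PP blin_simps)
  \<comment> \<open>On the \<open>U\<close>-half, linearity over \<open>U\<close> suffices. On the
    \<open>V\<close>-half the coefficients are products with translates \<open>a (p k)\<close>,
    which are values of a preserved form at a vector fixed by \<open>x\<close>.\<close>
  have fixed: "x (P v) = P v" "P' (x v) = P' v" if "x \<in> Gr" "\<And>k. x (p k) = p k" for x v
  proof -
    have "x (Kop UNIV one (act a p) (act a p) v) = Kop UNIV one (act a p) (act a p) v" if "a \<in> U" for a
    proof -
      have o: "ons UNIV (act a p)" using f that U_subset by (auto intro: fons_ons)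
      show ?thesis
        unfolding blinfun_Kop[OF o o bounded_on_const] unfolding Kop_apply[OF o o bounded_on_const]
        using \<open>x \<in> Gr\<close> \<open>\<And>k. x (p k) = p k\<close> that by (simp add: Gr_def)
    qed
    then show "x (P v) = P v" by (simp add: P_def KX_apply blin_simps)
    have "Kop UNIV one (act a p) (act a p) (x v) = Kop UNIV one (act a p) (act a p) v" if "a \<in> V" for a
    proof -
      have o: "ons UNIV (act a p)" using f that V_subset by (auto intro: fons_ons)
      have "x v \<bullet> a (p k) = v \<bullet> a (p k)" for k
      proof -
        have "x v \<bullet> a (x (p k)) = v \<bullet> a (p k)" using \<open>x \<in> Gr\<close> that by (simp add: Gr_def)
        then show ?thesis using \<open>\<And>k. x (p k) = p k\<close> by simp
      qed
      then show ?thesis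
        unfolding Kop_apply[OF o o bounded_on_const] by simp
    qed
    then show "P' (x v) = P' v" by (simp add: P'_def KX_apply)
  qed
  obtain xi where xi: "xi \<in> Gr" "\<And>v. x (xi v) = v" "\<And>v. xi (x v) = v" using inverse_Gr[OF x] by metis
  have xip: "xi (p k) = p k" for k using xi(3)[of "p k"] xp by simp
  note fx = fixed[OF x xp] fixed[OF xi(1) xip]
  define y where "y = P + P' + (R o\<^sub>L (x o\<^sub>L R))"
  define yi where "yi = P + P' + (R o\<^sub>L (xi o\<^sub>L R))"
  have y: "y v = P v + P' v + R (x (R v))" "yi v = P v + P' v + R (xi (R v))" for v
    by (simp_all add: y_def yi_def blin_simps)
  \<comment> \<open>Taking the middle diagonal block is multiplicative on block triangular
    operators; thus \<open>yi\<close> inverts \<open>y\<close>.\<close>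
  have "R (x (R (xi (R v)))) = R v" "R (xi (R (x (R v)))) = R v" for v
  proof -
    have "x (R (xi (R v))) = R v - P (xi (R v))" "xi (R (x (R v))) = R v - P (x (R v))"
      by (simp_all add: R[of "xi (R v)"] R[of "x (R v)"] blin_simps fx RP xi)
    then show "R (x (R (xi (R v)))) = R v" "R (xi (R (x (R v)))) = R v"
      by (simp_all add: blin_simps RP)
  qed
  then have yyi: "y (yi v) = v" "yi (y v) = v" for v
    by (simp_all add: y blin_simps PP RP) (simp_all add: R)
  define xs where "xs n = dop UNIV p (1 / 2 ^ n) o\<^sub>L (x o\<^sub>L dop UNIV p (2 ^ n))" for n :: nat
  have dopR: "dop UNIV p s v = s *\<^sub>R P v + R v + (1 / s) *\<^sub>R P' v" if "s \<noteq> 0" for s v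
    by (simp add: dop_apply R P_def P'_def algebra_simps)
  have xs_eq: "xs n = y + (1 / 2 ^ n) *\<^sub>R ((P o\<^sub>L (x o\<^sub>L R)) + (R o\<^sub>L (x o\<^sub>L P')))
       + ((1 / 2 ^ n) * (1 / 2 ^ n)) *\<^sub>R (P o\<^sub>L (x o\<^sub>L P'))" for n
    by (rule blinfun_eqI)
      (simp add: xs_def dopR y blin_simps fx PP RP algebra_simps)
  have half: "(\<lambda>n. 1 / 2 ^ n :: real) \<longlonglongrightarrow> 0"
    using LIMSEQ_realpow_zero[of "1/2"] by (simp add: power_one_over)
  have "(\<lambda>n. y + (1 / 2 ^ n) *\<^sub>R ((P o\<^sub>L (x o\<^sub>L R)) + (R o\<^sub>L (x o\<^sub>L P')))
       + ((1 / 2 ^ n) * (1 / 2 ^ n)) *\<^sub>R (P o\<^sub>L (x o\<^sub>L P'))) \<longlonglongrightarrow>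
     y + 0 *\<^sub>R ((P o\<^sub>L (x o\<^sub>L R)) + (R o\<^sub>L (x o\<^sub>L P'))) + (0 * 0) *\<^sub>R (P o\<^sub>L (x o\<^sub>L P'))"
    by (intro tendsto_intros half)
  then have lim: "xs \<longlonglongrightarrow> y" by (simp add: xs_eq[abs_def])
  then have limv: "(\<lambda>n. xs n v) \<longlonglongrightarrow> y v" for v by (intro tendsto_intros)
  have dK: "dop UNIV p (2 ^ n) \<in> Ker" "dop UNIV p (1 / 2 ^ n) \<in> Ker" for n using dop_power_Ker[OF j] by auto
  have xsG: "xs n \<in> Gr" "\<pi> (xs n) = \<pi> x" for n
    unfolding xs_def using dK[of n] x by (simp_all add: \<pi>_Ker_left \<pi>_Ker_right compose_Gr Ker_Gr)
  \<comment> \<open>The linearity and form conditions survive the limit; invertibility need not, and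
    is supplied by \<open>yi\<close>.\<close>
  have yG: "y \<in> Gr"
    unfolding Gr_def
  proof (safe)
    show "\<exists>h. y o\<^sub>L h = id_blinfun \<and> h o\<^sub>L y = id_blinfun"
      by (rule exI[of _ yi]) (auto intro!: blinfun_eqI simp: yyi)
    show "y (a v) = a (y v)" if "a \<in> U" for a v
    proof -
      have "(\<lambda>n. xs n (a v)) \<longlonglongrightarrow> a (y v)"
        using xsG(1) that blinfun.tendsto[OF tendsto_const limv, of a v] by (simp add: Gr_def)
      then show ?thesis using limv LIMSEQ_unique by blast
    qed
    show "y v \<bullet> a (y w) = v \<bullet> a w" if "a \<in> V" for a v w
    proof -
      have "(\<lambda>n. xs n v \<bullet> a (xs n w)) \<longlonglongrightarrow> y v \<bullet> a (y w)"
        by (intro tendsto_intros limv blinfun.tendsto)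
      then have "(\<lambda>n. v \<bullet> a w) \<longlonglongrightarrow> y v \<bullet> a (y w)" using xsG(1) that by (simp add: Gr_def)
      then show ?thesis by (simp add: LIMSEQ_const_iff)
    qed
  qed
  have "\<pi> x = \<pi> y" by (rule KerI_tendsto[OF x yG xsG lim])
  define z where "z = y - id_blinfun"
  have z: "y v = v + z v" for v by (simp add: z_def blin_simps)
  have Rz: "R (z v) = z v" "z (R v) = z v" for v
    by (simp_all add: z_def y blin_simps RP PP) (simp_all add: R)
  \<comment> \<open>A subfamily of \<open>p\<close> of the shape demanded by \<open>tw_Ker\<close>;
    the copy thus lies where \<open>R\<close> vanishes.\<close>
  define e where "e = p \<circ> ((\<lambda>n. 2 * n) \<circ> \<rho> 0)"
  have fe: "fons UNIV e"
    unfolding e_def by (rule fons_compose[OF f]) (use inj_\<rho> in \<open>auto intro!: inj_compose simp: inj_on_def[of "\<lambda>n. 2 * n"]\<close>)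
  have RZ: "R (a v) = a (R v)" if "a \<in> Z" for a v
    using Z_cases[OF that] f by (auto simp: R P_def P'_def U_KX V_KX blin_simps)
  have Rp: "R (p k) = 0" for k
    using f by (simp add: R P_def P'_def KX_U_basis KX_V_basis)
  have Radj: "R v \<bullet> w = v \<bullet> R w" for v w
    using f by (simp add: R P_def P'_def inner_diff_left inner_diff_right KX_adjoint_U KX_adjoint_V)
  have RQ: "R (Q e v) = 0" for v
  proof -
    have "R (Kop UNIV one (act a b) (act a e) v) = 0" if "a \<in> Z" for a
      unfolding blinfun_Kop[OF fons_ons[OF b that] fons_ons[OF fe that] bounded_on_const]
      using that by (simp add: RZ e_def Rp)
    then show ?thesis
      using U_subset V_subset by (simp add: Q_apply KX_apply blin_simps subset_iff)
  qed
  have Q'R: "Q' e (R v) = 0" for v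
  proof -
    have "u \<bullet> Q' e (R v) = 0" for u
      using Radj[of "Q e u" v] RQ by (simp flip: Q_adjoint[OF fe])
    then show ?thesis by (metis inner_eq_zero_iff)
  qed
  \<comment> \<open>The involution that exchanges the range of \<open>R\<close> with its copy under
    \<open>Q e\<close> and is the identity on the complement; the two ranges are orthogonal because
    \<open>R\<close> annihilates the range of \<open>Q e\<close>.\<close>
  define k where "k = id_blinfun - R - (Q e o\<^sub>L (R o\<^sub>L Q' e)) + (Q e o\<^sub>L R) + (R o\<^sub>L Q' e)"
  have k: "k v = v - R v - Q e (R (Q' e v)) + Q e (R v) + R (Q' e v)" for v
    by (simp add: k_def blin_simps)
  have kk: "k (k v) = v" for v
    by (simp add: k blin_simps RP RQ Q'R fe)
  have kG: "k \<in> Gr"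
  proof (rule GrI_unitary[OF kk kk])
    show "k (a v) = a (k v)" if "a \<in> Z" for a v
      using that by (simp add: k RZ Q_Z Q'_Z fe blin_simps)
    show "k v \<bullet> w = v \<bullet> k w" for v w
    proof -
      have adj: "Q e v \<bullet> w = v \<bullet> Q' e w" "Q' e v \<bullet> w = v \<bullet> Q e w" for v w
        using Q_adjoint[OF fe, of v w] Q_adjoint[OF fe, of w v] by (simp_all add: inner_commute)
      show ?thesis
        by (simp add: k inner_add_left inner_add_right inner_diff_left inner_diff_right adj Radj)
    qed
  qed
  have Q'z: "Q' e (z v) = 0" for v using Q'R[of "z v"] by (simp add: Rz)
  have zz: "R (y v) = R v + z v" "Q' e (y v) = Q' e v" for v by (simp_all add: z blinfun.add_right Rz Q'z)
  have conj: "k (y v) = tw e y (k v)" for v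
  proof -
    have "k (y v) = k v + Q e (z v)"
      by (simp add: k[of "y v"] k[of v] zz blin_simps) (simp add: z)
    moreover have "Q' e (k v) = Q' e v - R (Q' e v) + R v"
      by (simp add: k blin_simps Q'R fe)
    then have "z (Q' e (k v)) = z v" by (simp add: blin_simps Rz)
    then have "tw e y (k v) = k v + Q e (z v)"
      by (simp add: tw_apply z blin_simps)
    ultimately show ?thesis by simp
  qed
  have "y \<in> Ker"
  proof (rule Ker_conj[OF _ kG yG])
    show "tw e y \<in> Ker" unfolding e_def by (rule tw_Ker[OF f yG])
    show "k o\<^sub>L tw e y = y o\<^sub>L k"
    proof (rule blinfun_eqI)
      fix v
      have "k (tw e y (k (k v))) = k (k (y (k v)))" by (simp only: conj)
      then show "(k o\<^sub>L tw e y) v = (y o\<^sub>L k) v" by (simp add: kk)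
    qed
  qed
  then show ?thesis using \<open>\<pi> x = \<pi> y\<close> by (simp add: Ker_def)
qed

theorem rep_trivial: "g \<in> Gr \<Longrightarrow> \<pi> g = id_blinfun"
  using reduce_to_fixing[of g] fixing_in_Ker by metis

end

section \<open>Existence of free bases and the criterion for triviality\<close>

context free_action
begin

lemma fonsI:
  assumes "\<And>i. i \<in> I \<Longrightarrow> norm (u i) = 1"
    "\<And>i a. i \<in> I \<Longrightarrow> a \<in> Z \<Longrightarrow> a \<noteq> id_blinfun \<Longrightarrow> a \<noteq> - id_blinfun \<Longrightarrow> u i \<bullet> a (u i) = 0"
    "\<And>i j a. i \<in> I \<Longrightarrow> j \<in> I \<Longrightarrow> i \<noteq> j \<Longrightarrow> a \<in> Z \<Longrightarrow> u i \<bullet> a (u j) = 0"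
  shows "fons I u"
  using assms unfolding fons_def by (auto simp: blinfun.minus_left norm_eq_1)

lemma KX_finite_in_span:
  assumes "finite B" "fons B id" "X \<subseteq> Z"
  shows "KX X B one id id v \<in> span (\<Union>a\<in>Z. blinfun_apply a ` B)"
  unfolding KX_apply
proof (intro span_scale span_sum)
  fix a assume "a \<in> X"
  then have a: "a \<in> Z" using assms by blast
  have "Kop B one (act a id) (act a id) v = (\<Sum>i\<in>B. (1 * (v \<bullet> act a id i)) *\<^sub>R act a id i)"
    unfolding Kop_apply[OF fons_ons[OF assms(2) a] fons_ons[OF assms(2) a] bounded_on_const]
    using assms(1) by simp
  also have "\<dots> \<in> span (\<Union>a\<in>Z. blinfun_apply a ` B)"
    by (intro span_sum span_scale span_base) (use a in auto)
  finally show "Kop B one (act a id) (act a id) v \<in> span (\<Union>a\<in>Z. blinfun_apply a ` B)" .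
qed

text \<open>By Zorn's lemma there is a maximal free system, and a unit vector orthogonal to all its
  translates could be added. That the new vector is itself free is \<open>skew_U\<close>, which
  covers all of \<open>Z\<close> only for \<open>Z = U\<close>.\<close>

lemma exists_basis:
  assumes ZU: "Z = U" and sep: "separable (UNIV :: 'e set)"
    and inf: "\<And>B. finite B \<Longrightarrow> span (\<Union>a\<in>Z. blinfun_apply a ` B) \<noteq> UNIV"
  shows "\<exists>b :: nat \<Rightarrow> 'e. fons UNIV b \<and> (\<forall>v. (\<forall>i. \<forall>a\<in>Z. v \<bullet> blinfun_apply a (b i) = 0) \<longrightarrow> v = 0)"
proof -
  have "\<exists>M\<in>{B. fons B id}. \<forall>X\<in>{B. fons B id}. M \<subseteq> X \<longrightarrow> X = M"
  proof (rule subset_Zorn')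
    fix C :: "'e set set" assume C: "subset.chain {B. fons B id} C"
    have "fons (\<Union>C) id"
      unfolding fons_def
    proof (intro ballI)
      fix x y a assume "x \<in> \<Union>C" "y \<in> \<Union>C" and a: "a \<in> Z"
      then obtain X Y where "x \<in> X" "X \<in> C" "y \<in> Y" "Y \<in> C" by blast
      moreover have "X \<subseteq> Y \<or> Y \<subseteq> X" using C \<open>X \<in> C\<close> \<open>Y \<in> C\<close> by (auto simp: subset_chain_def)
      ultimately obtain W where "x \<in> W" "y \<in> W" "W \<in> C" by blast
      then have "fons W id" using C by (auto simp: subset_chain_def)
      then show "id x \<bullet> act a id y = (if x = y then if a = id_blinfun then 1 else if a = - id_blinfun then - 1 else 0 else 0)"
        using \<open>x \<in> W\<close> \<open>y \<in> W\<close> a unfolding fons_def by blast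
    qed
    then show "\<Union>C \<in> {B. fons B id}" by simp
  qed
  then obtain B where B: "fons B id" and max: "\<And>X. fons X id \<Longrightarrow> B \<subseteq> X \<Longrightarrow> X = B" by blast
  have nB: "norm x = 1" if "x \<in> B" for x
    using fons_ons'[OF B] that by (auto simp: ons_def norm_eq_1)
  have comp: "v = 0" if v: "\<And>x a. x \<in> B \<Longrightarrow> a \<in> Z \<Longrightarrow> v \<bullet> a x = 0" for v
  proof (rule ccontr)
    assume "v \<noteq> 0"
    define w where "w = (1 / norm v) *\<^sub>R v"
    have w: "norm w = 1" "w \<bullet> a x = 0" if "x \<in> B" "a \<in> Z" for x a
      using \<open>v \<noteq> 0\<close> v that by (auto simp: w_def)
    have nw: "norm w = 1" using \<open>v \<noteq> 0\<close> by (auto simp: w_def)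
    have o: "ort w x" if "x \<in> B" for x using w that by (auto simp: ort_def)
    have "fons (insert w B) id"
    proof (rule fonsI)
      fix i j a assume ij: "i \<in> insert w B" "j \<in> insert w B" "i \<noteq> j" "a \<in> Z"
      show "id i \<bullet> a (id j) = 0"
        using ij o[of i, THEN ort_sym] o[of j] B unfolding fons_def ort_def by auto
    qed (use nw nB skew_U ZU in auto)
    then have "w \<in> B" using max[of "insert w B"] by blast
    then have "w \<bullet> w = 0" using w(2)[of w id_blinfun] id_Z by simp
    then show False using nw by simp
  qed
  have "infinite B"
  proof
    assume fin: "finite B"
    have "v \<in> span (\<Union>a\<in>Z. blinfun_apply a ` B)" for v
    proof -
      \<comment> \<open>For finite \<open>B\<close> this projection onto the span of the translates
        would be the identity, contrary to \<open>inf\<close>.\<close>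
      let ?P = "KX U B one id id"
      have "(v - ?P v) \<bullet> a x = 0" if "x \<in> B" "a \<in> Z" for a x
      proof -
        have "?P v \<bullet> a x = v \<bullet> a (?P x)"
          using B that ZU by (simp add: KX_adjoint_U U_KX)
        also have "?P x = x" using KX_U_basis[OF B B bounded_on_const that(1)] by simp
        finally show ?thesis by (simp only: inner_diff_left diff_self)
      qed
      then have "v - ?P v = 0" by (rule comp)
      then show ?thesis using KX_finite_in_span[OF fin B U_subset, of v] by simp
    qed
    then show False using inf[OF fin] by blast
  qed
  have "countable B"
  proof -
    obtain D :: "'e set" where D: "countable D" "UNIV \<subseteq> closure D"
      using sep by (auto simp: separable_def)
    have "\<exists>d\<in>D. dist d x < 1/2" for x
      using D(2) closure_approachable[of x D] by (metis UNIV_I half_gt_zero_iff zero_less_one subsetD)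
    then obtain p where p: "p x \<in> D" "dist (p x) x < 1/2" for x by metis
    \<comment> \<open>Distinct members of \<open>B\<close> have squared distance 2, whereas a common
      approximant within 1/2 would force distance below 1.\<close>
    have "inj_on p B"
    proof (rule inj_onI, rule ccontr)
      fix x y assume xy: "x \<in> B" "y \<in> B" "p x = p y" "x \<noteq> y"
      have "dist x y < 1" using p(2)[of x] p(2)[of y] xy(3) dist_triangle3[of x y "p x"] by simp
      moreover have "x \<bullet> y = 0" "x \<bullet> x = 1" "y \<bullet> y = 1" using fons_ons'[OF B] xy by (auto simp: ons_def)
      then have "(dist x y)\<^sup>2 = 2"
        by (simp add: dist_norm power2_norm_eq_inner inner_diff_left inner_diff_right inner_commute)
      ultimately show False using power_le_one[of "dist x y" 2] by simp
    qed
    moreover have "countable (p ` B)" using D(1) p by (intro countable_subset[of "p ` B" D]) auto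
    ultimately show ?thesis by (rule countable_image_inj_on[rotated])
  qed
  then have h: "bij_betw (from_nat_into B) UNIV B" using \<open>infinite B\<close> by (rule bij_betw_from_nat_into)
  have "fons UNIV (id \<circ> from_nat_into B)"
    using h by (intro fons_compose[OF B]) (auto simp: bij_betw_def)
  moreover have "v = 0" if "\<And>i a. a \<in> Z \<Longrightarrow> v \<bullet> a (from_nat_into B i) = 0" for v
  proof (rule comp)
    fix x a assume "x \<in> B" "a \<in> Z"
    then obtain i where "x = from_nat_into B i" using h by (auto simp: bij_betw_def)
    then show "v \<bullet> a x = 0" using that \<open>a \<in> Z\<close> by simp
  qed
  ultimately show ?thesis by (intro exI[of _ "from_nat_into B"]) auto
qed

text \<open>\<open>V\<close> is the coset of \<open>U\<close> through \<open>J\<close>, so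
  commutation with \<open>U\<close> derives all the forms from the one given by
  \<open>J\<close>.\<close>

lemma Gr_iff:
  assumes "J \<in> V"
  shows "g \<in> Gr \<longleftrightarrow> (\<exists>h. g o\<^sub>L h = id_blinfun \<and> h o\<^sub>L g = id_blinfun) \<and>
    (\<forall>a\<in>U. \<forall>v. g (blinfun_apply a v) = a (g v)) \<and> (\<forall>v w. g v \<bullet> J (g w) = v \<bullet> J w)"
proof -
  have "g v \<bullet> a (g w) = v \<bullet> a w"
    if a: "a \<in> V" and U: "\<forall>a\<in>U. \<forall>v. g (blinfun_apply a v) = a (g v)" and J: "\<forall>v w. g v \<bullet> J (g w) = v \<bullet> J w" for a v w
  proof -
    obtain u where u: "u \<in> U" "a = J o\<^sub>L u" using bij_VU[OF assms] a by (auto simp: bij_betw_def)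
    have "g v \<bullet> a (g w) = g v \<bullet> J (g (u w))" using u U by simp
    also have "\<dots> = v \<bullet> a w" using J u by simp
    finally show ?thesis .
  qed
  then show ?thesis unfolding Gr_def using assms by blast
qed

end

lemma trivial_repI:
  fixes Z U :: "('e::{real_inner,complete_space} \<Rightarrow>\<^sub>L 'e) set"
    and vsc :: "complex \<Rightarrow> 'v::{real_inner,complete_space} \<Rightarrow> 'v"
  assumes V: "hilbert_space vsc vip" "separable (UNIV :: 'v set)"
    and Z: "free_action Z U"
    and b: "free_action.fons Z (UNIV :: nat set) b"
    and complete: "\<And>v. (\<And>i a. a \<in> Z \<Longrightarrow> v \<bullet> a (b i) = 0) \<Longrightarrow> v = 0"
    and G: "G = free_action.Gr Z U"
    and rep: "continuous_unitary_rep vsc vip G \<pi>"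
  shows "trivial_rep G \<pi>"
proof -
  interpret hs: hilbert_space vsc vip by fact
  interpret free_action Z U by fact
  have r: "\<And>g. g \<in> Gr \<Longrightarrow> \<pi> g \<in> unitary_group vsc vip" "\<And>g h. g \<in> Gr \<Longrightarrow> h \<in> Gr \<Longrightarrow> \<pi> (g o\<^sub>L h) = \<pi> g o\<^sub>L \<pi> h"
    "\<And>v. continuous_on Gr (\<lambda>g. \<pi> g v)"
    using rep unfolding continuous_unitary_rep_def G by auto
  have "norm (\<pi> g v) = norm v" if "g \<in> Gr" for g v
  proof -
    have "vip (\<pi> g v) (\<pi> g v) = vip v v"
      using r(1)[OF that] by (simp add: unitary_group_def preserves_def)
    then have "(norm (\<pi> g v))\<^sup>2 = (norm v)\<^sup>2" unfolding hs.ip_self of_real_eq_iff .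
    then show ?thesis by simp
  qed
  then interpret based_rep Z U \<pi> b
    using r V(2) b complete by unfold_locales auto
  show ?thesis unfolding trivial_rep_def G using rep_trivial by blast
qed

section \<open>Hilbert spaces over the scalar algebras\<close>

lemma isometry_inner:
  fixes a :: "'e::real_inner \<Rightarrow> 'e"
  assumes "linear a" "\<And>v. norm (a v) = norm v"
  shows "a v \<bullet> a w = v \<bullet> w"
proof -
  have p: "2 * (x \<bullet> y) = (norm (x + y))\<^sup>2 - (norm x)\<^sup>2 - (norm y)\<^sup>2" for x y :: 'e
    by (simp add: power2_norm_eq_inner inner_add_left inner_add_right inner_commute)
  have "2 * (a v \<bullet> a w) = 2 * (v \<bullet> w)"
    unfolding p linear_add[OF assms(1), symmetric] assms(2) ..
  then show ?thesis by simp
qed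

lemma star_one [simp]: "star (1 :: 'k::real_star_algebra) = 1"
proof -
  have "star (1 * star (1::'k)) = star (star 1) * star 1" by (rule star_mult)
  then show ?thesis by (simp only: star_star mult_1_left mult_1_right)
qed

lemma star_of_real [simp]: "star (of_real r :: 'k::real_star_algebra) = of_real r"
  unfolding of_real_def star_scaleR by simp

lemma star_uminus: "star (- x) = - star (x :: 'k::real_star_algebra)"
  using star_scaleR[of "-1" x] by simp

lemma of_real_mult_commute: "of_real r * x = x * (of_real r :: 'k::real_algebra_1)"
  by (simp add: of_real_def)

lemma ex_inverse_iff:
  fixes g :: "'e::real_normed_vector \<Rightarrow>\<^sub>L 'e"
  assumes "g o\<^sub>L h = id_blinfun" "h o\<^sub>L g = id_blinfun"
  shows "inv (blinfun_apply g) = blinfun_apply h"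
  using assms blinfun_inverseD[OF assms(1)] blinfun_inverseD[OF assms(2)] by (intro inv_equality) auto

text \<open>A finite group of unit scalars, each equal to 1 or -1 or purely imaginary, with a
  subgroup \<open>Q0\<close> of index at most two: the equivalence says that the cosets multiply
  like signs.\<close>

definition unit_group :: "'k::real_star_algebra set \<Rightarrow> 'k set \<Rightarrow> bool" where
  "unit_group Q Q0 \<longleftrightarrow> finite Q \<and> Q0 \<subseteq> Q \<and> 1 \<in> Q0 \<and> (\<forall>q\<in>Q. - q \<in> Q) \<and> (\<forall>q\<in>Q0. - q \<in> Q0) \<and>
    (\<forall>q\<in>Q. \<forall>r\<in>Q. q * r \<in> Q \<and> (q * r \<in> Q0 \<longleftrightarrow> (q \<in> Q0 \<longleftrightarrow> r \<in> Q0))) \<and>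
    (\<forall>q\<in>Q. q * star q = 1 \<and> (q = 1 \<or> q = - 1 \<or> star q = - q))"

context hilbert_space
begin

lemma sc_scaleR: "sc a (r *\<^sub>R v) = r *\<^sub>R sc a v"
  by (metis sc_of_real sc_sc of_real_mult_commute)

lemma linear_sc: "linear (sc a)"
  by (rule linearI) (simp_all add: sc_add_right sc_scaleR)

lemma sc_one: "sc 1 v = v"
  using sc_of_real[of 1 v] by simp

lemma sc_uminus: "sc (- a) v = - sc a v"
proof -
  have "sc (of_real (-1)) (sc a v) = - sc a v" by (simp only: sc_of_real scaleR_minus_left scaleR_one)
  then show ?thesis by (simp add: sc_sc)
qed

lemma sc_scaleR_left: "sc (r *\<^sub>R a) v = r *\<^sub>R sc a v"
proof -
  have "sc (of_real r) (sc a v) = r *\<^sub>R sc a v" by (rule sc_of_real)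
  then show ?thesis by (simp add: sc_sc of_real_def)
qed

lemma ip_sc_right: "ip v (sc a w) = ip v w * star a"
  by (metis ip_star ip_sc_left star_mult star_star)

lemma norm_sc:
  assumes "a * star a = 1"
  shows "norm (sc a v) = norm v"
proof -
  have "ip (sc a v) (sc a v) = a * (of_real ((norm v)\<^sup>2) * star a)"
    unfolding ip_sc_left unfolding ip_sc_right unfolding ip_self ..
  also have "\<dots> = of_real ((norm v)\<^sup>2) * (a * star a)"
    by (metis of_real_mult_commute mult.assoc)
  finally have "(of_real ((norm (sc a v))\<^sup>2) :: 'k) = of_real ((norm v)\<^sup>2)"
    by (simp only: ip_self assms mult_1_right)
  then have "(norm (sc a v))\<^sup>2 = (norm v)\<^sup>2" by (simp only: of_real_eq_iff)
  then show ?thesis by simp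
qed

lemma inner_sc: "a * star a = 1 \<Longrightarrow> sc a v \<bullet> sc a w = v \<bullet> w"
  by (rule isometry_inner[OF linear_sc norm_sc])

text \<open>Polarization of the common norm identifies the real inner product with the real part of
  \<open>ip\<close>.\<close>

lemma ip_inner: "of_real (2 * (v \<bullet> w)) = ip v w + star (ip v w)"
proof -
  have r: "ip u (x + y) = ip u x + ip u y" for u x y
    by (metis ip_star ip_add_left star_add star_star)
  have "ip (v + w) (v + w) = ip v v + ip w w + (ip v w + ip w v)"
    by (simp add: ip_add_left r)
  then have "of_real ((norm (v + w))\<^sup>2) - of_real ((norm v)\<^sup>2) - of_real ((norm w)\<^sup>2) = ip v w + ip w v"
    by (simp only: ip_self) (simp add: algebra_simps)
  moreover have "2 * (v \<bullet> w) = (norm (v + w))\<^sup>2 - (norm v)\<^sup>2 - (norm w)\<^sup>2"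
    by (simp add: power2_norm_eq_inner inner_add_left inner_add_right inner_commute)
  ultimately show ?thesis using ip_star[of w v] by (simp only: of_real_diff)
qed

lemma inner_sc_skew:
  assumes "star a = - a"
  shows "v \<bullet> sc a v = 0"
proof -
  have "of_real (2 * (v \<bullet> sc a v)) = (0 :: 'k)"
    unfolding ip_inner ip_sc_right ip_self star_mult star_star star_of_real unfolding assms
    using of_real_mult_commute[of "(norm v)\<^sup>2" a] by simp
  then have "2 * (v \<bullet> sc a v) = 0" by (simp only: of_real_eq_0_iff)
  then show ?thesis by simp
qed

lemma inner_sc_skew_swap:
  assumes "star a = - a"
  shows "v \<bullet> sc a w + w \<bullet> sc a v = 0"
  using inner_sc_skew[OF assms, of "v + w"] inner_sc_skew[OF assms, of v] inner_sc_skew[OF assms, of w]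
  by (simp add: sc_add_right inner_add_left inner_add_right)

lemma bounded_linear_sc:
  assumes "a * star a = 1"
  shows "bounded_linear (sc a)"
  by (rule bounded_linear_intro[where K = 1]) (simp_all add: sc_add_right sc_scaleR norm_sc assms)

definition scop :: "'k \<Rightarrow> 'h \<Rightarrow>\<^sub>L 'h" where "scop a = Blinfun (sc a)"

lemma scop_apply: "a * star a = 1 \<Longrightarrow> scop a v = sc a v"
  unfolding scop_def by (simp add: bounded_linear_Blinfun_apply bounded_linear_sc)

lemma scop_free_action:
  assumes Q: "unit_group Q Q0" and nz: "\<exists>v :: 'h. v \<noteq> 0"
  shows "free_action (scop ` Q) (scop ` Q0)"
proof
  note q = Q[unfolded unit_group_def]
  have un: "q * star q = 1" if "q \<in> Q" for q using q that by blast
  have ap: "scop q v = sc q v" if "q \<in> Q" for q v using scop_apply[OF un[OF that]] .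
  have sub: "x \<in> Q" if "x \<in> Q0" for x using q that by blast
  have one: "1 \<in> Q0" "1 \<in> Q" using q by blast+
  have s1: "scop 1 = id_blinfun" by (rule blinfun_eqI) (simp add: ap one sc_one)
  have sm: "- scop a = scop (- a)" if "a \<in> Q" for a
  proof (rule blinfun_eqI)
    fix v
    have "- a \<in> Q" using q that by blast
    then show "(- scop a) v = scop (- a) v" using that by (simp add: blinfun.minus_left ap sc_uminus)
  qed
  have sc2: "scop a o\<^sub>L scop c = scop (a * c)" if "a \<in> Q" "c \<in> Q" for a c
  proof (rule blinfun_eqI)
    fix v
    have "a * c \<in> Q" using q that by blast
    then show "(scop a o\<^sub>L scop c) v = scop (a * c) v" using that by (simp add: ap sc_sc)
  qed
  show "finite (scop ` Q)" "scop ` Q0 \<subseteq> scop ` Q" using q by auto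
  show "id_blinfun \<in> scop ` Q0" using s1 one by (metis imageI)
  show "- a \<in> scop ` Q0" if "a \<in> scop ` Q0" for a using that sub q by (auto simp: sm)
  show "- a \<in> scop ` Q" if "a \<in> scop ` Q" for a using that q by (auto simp: sm)
  show "a o\<^sub>L c \<in> scop ` Q0" if "a \<in> scop ` Q0" "c \<in> scop ` Q0" for a c
  proof -
    obtain x y where "x \<in> Q0" "y \<in> Q0" "a = scop x" "c = scop y" using \<open>a \<in> scop ` Q0\<close> \<open>c \<in> scop ` Q0\<close> by blast
    moreover have "x * y \<in> Q0" using q sub \<open>x \<in> Q0\<close> \<open>y \<in> Q0\<close> by blast
    ultimately show ?thesis using sc2 sub by auto
  qed
  show "a o\<^sub>L c \<in> scop ` Q" if "a \<in> scop ` Q" "c \<in> scop ` Q" for a c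
    using that q by (auto simp: sc2)
  show "a o\<^sub>L c \<in> scop ` Q0" if ac: "a \<in> scop ` Q - scop ` Q0" "c \<in> scop ` Q - scop ` Q0" for a c
  proof -
    obtain x y where xy: "x \<in> Q" "y \<in> Q" "a = scop x" "c = scop y" using ac by blast
    then have "x \<notin> Q0" "y \<notin> Q0" using ac by auto
    then have "x * y \<in> Q0" using q xy by blast
    then show ?thesis using sc2 xy by auto
  qed
  show "a v \<bullet> a w = v \<bullet> w" if "a \<in> scop ` Q" for a v w
    using that by (auto simp: ap inner_sc un)
  show "v \<bullet> a v = 0" if a: "a \<in> scop ` Q0" "a \<noteq> id_blinfun" "a \<noteq> - id_blinfun" for a v
  proof -
    obtain x where x: "x \<in> Q0" "a = scop x" using a by blast
    then have "x \<noteq> 1" "x \<noteq> - 1" using a s1 sm[OF one(2)] by auto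
    then have "star x = - x" using q sub x by blast
    then show ?thesis using x sub by (simp add: ap inner_sc_skew)
  qed
  show "id_blinfun \<noteq> (- id_blinfun :: 'h \<Rightarrow>\<^sub>L 'h)"
  proof
    assume h: "id_blinfun = (- id_blinfun :: 'h \<Rightarrow>\<^sub>L 'h)"
    have "v = - v" for v :: 'h using arg_cong[OF h, of "\<lambda>z. z v"] by (simp add: blinfun.minus_left)
    then have "2 *\<^sub>R v = 0" for v :: 'h unfolding scaleR_2 using eq_neg_iff_add_eq_0 by blast
    then show False using nz by simp
  qed
qed

end

context separable_infinite_dim_hilbert_space
begin

lemma nonzero: "\<exists>v :: 'h. v \<noteq> 0"
  using infinite_dim by (metis finite.emptyI sum.empty)

lemma exists_scalar_basis:
  assumes Q: "unit_group Q Q"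
  shows "\<exists>b :: nat \<Rightarrow> 'h. (\<forall>i. norm (b i) = 1) \<and> (\<forall>i j. \<forall>q\<in>Q. i \<noteq> j \<longrightarrow> b i \<bullet> sc q (b j) = 0) \<and>
    (\<forall>v. (\<forall>i. \<forall>q\<in>Q. v \<bullet> sc q (b i) = 0) \<longrightarrow> v = 0)"
proof -
  interpret fa: free_action "scop ` Q" "scop ` Q" using scop_free_action[OF Q nonzero] .
  have ap: "scop q v = sc q v" if "q \<in> Q" for q v using Q that by (auto simp: unit_group_def scop_apply)
  have "span (\<Union>a\<in>scop ` Q. blinfun_apply a ` B) \<noteq> UNIV" if B: "finite B" for B
  proof
    assume s: "span (\<Union>a\<in>scop ` Q. blinfun_apply a ` B) = UNIV"
    have "\<exists>c. v = (\<Sum>x\<in>B. sc (c x) x)" for v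
    proof -
      have "v \<in> span (\<Union>a\<in>scop ` Q. blinfun_apply a ` B)" using s by simp
      then show ?thesis
      proof (induction rule: span_induct_alt)
        case base
        have "sc 0 x = 0" for x using sc_of_real[of 0 x] by simp
        then show ?case by (intro exI[of _ "\<lambda>_. 0"]) simp
      next
        case (step r z y)
        then obtain c where c: "y = (\<Sum>x\<in>B. sc (c x) x)" by blast
        obtain q w where q: "q \<in> Q" "w \<in> B" "z = sc q w" using step(1) ap by auto
        have "r *\<^sub>R z + y = (\<Sum>x\<in>B. (if x = w then sc (r *\<^sub>R q) x else 0) + sc (c x) x)"
          using q B by (simp add: sum.distrib c sc_scaleR_left)
        also have "\<dots> = (\<Sum>x\<in>B. sc (if x = w then r *\<^sub>R q + c x else c x) x)"
          by (rule sum.cong) (auto simp: sc_add_left)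
        finally show ?case by (intro exI[of _ "\<lambda>x. if x = w then r *\<^sub>R q + c x else c x"])
      qed
    qed
    then show False using infinite_dim B by blast
  qed
  then obtain b :: "nat \<Rightarrow> 'h" where b: "fa.fons UNIV b"
    "\<And>v. (\<forall>i. \<forall>a\<in>scop ` Q. v \<bullet> blinfun_apply a (b i) = 0) \<Longrightarrow> v = 0"
    using fa.exists_basis[OF refl separable] by blast
  have "norm (b i) = 1" for i using fa.fons_ons'[OF b(1)] by (auto simp: ons_def norm_eq_1)
  moreover have "b i \<bullet> sc q (b j) = 0" if "q \<in> Q" "i \<noteq> j" for i j q
    using b(1) that unfolding fa.fons_def by (auto simp: ap)
  moreover have "v = 0" if "\<forall>i. \<forall>q\<in>Q. v \<bullet> sc q (b i) = 0" for v
    by (rule b(2)) (use that ap in auto)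
  ultimately show ?thesis by blast
qed

text \<open>Freeness and completeness of a system depend on \<open>Z\<close> alone. A basis obtained
  with the full scalar group as \<open>U\<close> therefore also serves for the smaller
  \<open>U\<close> coming from \<open>Q0\<close>.\<close>

lemma trivial_rep_single:
  fixes vsc :: "complex \<Rightarrow> 'v::{real_inner,complete_space} \<Rightarrow> 'v"
  assumes V: "hilbert_space vsc vip" "separable (UNIV :: 'v set)"
    and Q: "unit_group Q Q" "unit_group Q Q0"
    and G: "G = free_action.Gr (scop ` Q) (scop ` Q0)"
    and rep: "continuous_unitary_rep vsc vip G \<pi>"
  shows "trivial_rep G \<pi>"
proof -
  interpret fa: free_action "scop ` Q" "scop ` Q0" using scop_free_action[OF Q(2) nonzero] .
  have ap: "scop q v = sc q v" if "q \<in> Q" for q v using Q(1) that by (auto simp: unit_group_def scop_apply)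
  have one: "1 \<in> Q" "- 1 \<in> Q" using Q(1) unfolding unit_group_def by blast+
  have s1: "scop 1 = id_blinfun" by (rule blinfun_eqI) (simp add: ap one sc_one)
  have sm1: "scop (- 1) = - id_blinfun"
    by (rule blinfun_eqI) (simp add: ap one sc_one sc_uminus blinfun.minus_left)
  obtain b :: "nat \<Rightarrow> 'h" where bb: "(\<forall>i. norm (b i) = 1) \<and> (\<forall>i j. \<forall>q\<in>Q. i \<noteq> j \<longrightarrow> b i \<bullet> sc q (b j) = 0) \<and>
    (\<forall>v. (\<forall>i. \<forall>q\<in>Q. v \<bullet> sc q (b i) = 0) \<longrightarrow> v = 0)"
    using exists_scalar_basis[OF Q(1)] ..
  have b: "norm (b i) = 1" "q \<in> Q \<Longrightarrow> i \<noteq> j \<Longrightarrow> b i \<bullet> sc q (b j) = 0"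
    "(\<And>i q. q \<in> Q \<Longrightarrow> v \<bullet> sc q (b i) = 0) \<Longrightarrow> v = 0" for i j q v
    using bb[THEN conjunct1] bb[THEN conjunct2, THEN conjunct1] bb[THEN conjunct2, THEN conjunct2] by simp_all
  show ?thesis
  proof (rule trivial_repI[OF V fa.free_action_axioms _ _ G rep])
    show "fa.fons UNIV b"
    proof (rule fa.fonsI)
      fix i a assume a: "a \<in> scop ` Q" "a \<noteq> id_blinfun" "a \<noteq> - id_blinfun"
      then obtain q where q: "q \<in> Q" "a = scop q" by blast
      then have "q \<noteq> 1" "q \<noteq> - 1" using a s1 sm1 by auto
      then have "star q = - q" using Q(1) q(1) unfolding unit_group_def by blast
      then show "b i \<bullet> a (b i) = 0" using q by (simp add: ap inner_sc_skew)
    next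
      show "b i \<bullet> a (b j) = 0" if "i \<noteq> j" "a \<in> scop ` Q" for i j a
        using b(2)[of _ i j] that ap by auto
    qed (rule b(1))
    show "v = 0" if v: "\<And>i a. a \<in> scop ` Q \<Longrightarrow> v \<bullet> a (b i) = 0" for v
    proof (rule b(3))
      show "v \<bullet> sc q (b i) = 0" if "q \<in> Q" for i q
        using v[OF imageI[OF that], of i] ap[OF that] by simp
    qed
  qed
qed

text \<open>Here \<open>V\<close> is empty, so no form is imposed, and commuting with a real
  spanning set of scalars is full linearity.\<close>

lemma GL_eq_Gr:
  assumes Q: "unit_group Q Q" and sp: "span Q = UNIV"
  shows "GL sc = free_action.Gr (scop ` Q) (scop ` Q)"
proof -
  interpret fa: free_action "scop ` Q" "scop ` Q" using scop_free_action[OF Q nonzero] .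
  have ap: "scop q v = sc q v" if "q \<in> Q" for q v using Q that by (auto simp: unit_group_def scop_apply)
  have "(\<forall>a v. g (sc a v) = sc a (g v)) \<longleftrightarrow> (\<forall>q\<in>Q. \<forall>v. g (sc q v) = sc q (g v))" for g :: "'h \<Rightarrow>\<^sub>L 'h"
  proof (intro iffI allI)
    fix a v assume h: "\<forall>q\<in>Q. \<forall>v. g (sc q v) = sc q (g v)"
    have "a \<in> span Q" using sp by simp
    then show "g (sc a v) = sc a (g v)"
    proof (induction rule: span_induct_alt)
      case base
      have "sc 0 x = 0" for x using sc_of_real[of 0 x] by simp
      then show ?case by (simp add: blinfun.zero_right)
    next
      case (step r q y)
      then show ?case using h by (simp add: sc_add_left sc_scaleR_left blin_simps)
    qed
  qed blast
  then show ?thesis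
    unfolding GL_def fa.Gr_def fa.V_def by (auto simp: ap)
qed

end

section \<open>The pairs acting on the Hilbert space itself\<close>

lemma unit_group_real: "unit_group {1, - 1} {1, - 1 :: real}"
  by (auto simp: unit_group_def star_real_def)

lemma span_real: "span {1, - 1 :: real} = UNIV"
proof -
  have "x *\<^sub>R 1 \<in> span {1, - 1 :: real}" for x by (intro span_scale span_base) simp
  then show ?thesis by auto
qed

lemma unit_group_complex: "unit_group {1, - 1, \<i>, - \<i>} {1, - 1, \<i>, - \<i>}"
  and unit_group_complex0: "unit_group {1, - 1, \<i>, - \<i>} {1, - 1}"
  by (auto simp: unit_group_def star_complex_def complex_eq_iff)

lemma span_complex: "span {1, - 1, \<i>, - \<i>} = UNIV"
proof -
  have "z \<in> span {1, - 1, \<i>, - \<i>}" for z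
  proof -
    have "z = Re z *\<^sub>R 1 + Im z *\<^sub>R \<i>" by (simp add: complex_eq_iff)
    also have "\<dots> \<in> span {1, - 1, \<i>, - \<i>}" by (intro span_add span_scale span_base) auto
    finally show ?thesis .
  qed
  then show ?thesis by auto
qed

text \<open>The quaternion group of order 8; \<open>Quat 0 \<i>\<close> is the product ij, that is,
  k.\<close>

definition Q8 :: "quat set" where
  "Q8 = {Quat 1 0, Quat (- 1) 0, Quat \<i> 0, Quat (- \<i>) 0, Quat 0 1, Quat 0 (- 1), Quat 0 \<i>, Quat 0 (- \<i>)}"

definition Q4 :: "quat set" where
  "Q4 = {Quat 1 0, Quat (- 1) 0, Quat \<i> 0, Quat (- \<i>) 0}"

lemma unit_group_quat: "unit_group Q8 Q8" and unit_group_quat0: "unit_group Q8 Q4"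
  unfolding unit_group_def Q8_def Q4_def
  by (simp_all add: one_quat_def uminus_quat_def times_quat_def star_quat_def complex_eq_iff)

lemma span_quat: "span Q8 = UNIV"
proof -
  have "p \<in> span Q8" for p
  proof -
    have "p = Re (cpart p) *\<^sub>R Quat 1 0 + Im (cpart p) *\<^sub>R Quat \<i> 0 + Re (jpart p) *\<^sub>R Quat 0 1 + Im (jpart p) *\<^sub>R Quat 0 \<i>"
      by (simp add: plus_quat_def scaleR_quat_def complex_eq_iff quat.expand)
    also have "\<dots> \<in> span Q8" by (intro span_add span_scale span_base) (auto simp: Q8_def)
    finally show ?thesis .
  qed
  then show ?thesis by auto
qed

lemma (in hilbert_space) scop_inj:
  assumes "a * star a = 1" "c * star c = 1" "scop a = scop c" "\<exists>v :: 'h. v \<noteq> 0"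
  shows "a = c"
proof -
  obtain v :: 'h where v: "v \<noteq> 0" using assms(4) by blast
  have "sc a v = sc c v" using assms(1-3) scop_apply by metis
  then have "a * of_real ((norm v)\<^sup>2) = c * of_real ((norm v)\<^sup>2)" by (metis ip_sc_left ip_self)
  then have "(norm v)\<^sup>2 *\<^sub>R a = (norm v)\<^sup>2 *\<^sub>R c" by (simp add: of_real_def)
  then show ?thesis using v by simp
qed

lemma (in separable_infinite_dim_hilbert_space) scop_in_V:
  assumes "unit_group Q Q0" "q \<in> Q" "q \<notin> Q0"
  shows "scop q \<in> free_action.V (scop ` Q) (scop ` Q0)"
proof -
  interpret fa: free_action "scop ` Q" "scop ` Q0" using scop_free_action[OF assms(1) nonzero] .
  have un: "x * star x = 1" "y \<in> Q0 \<Longrightarrow> y \<in> Q" if "x \<in> Q" for x y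
    using assms(1) that unfolding unit_group_def by blast+
  have "scop q \<noteq> scop x" if "x \<in> Q0" for x
    using scop_inj[of q x] un nonzero assms that by blast
  then show ?thesis using assms(2) by (auto simp: fa.V_def)
qed

text \<open>The imaginary part of \<open>ip\<close> is v \<bullet> iw, so \<open>V\<close> consists
  of the scalars i and -i, and \<open>U\<close> asks for real linearity only.\<close>

lemma Sp_eq_Gr:
  fixes sc :: "complex \<Rightarrow> 'h::{real_inner,complete_space} \<Rightarrow> 'h"
  assumes "separable_infinite_dim_hilbert_space sc ip"
  shows "Sp_group ip = free_action.Gr (hilbert_space.scop sc ` {1, - 1, \<i>, - \<i>}) (hilbert_space.scop sc ` {1, - 1})"
proof -
  interpret separable_infinite_dim_hilbert_space sc ip by fact
  interpret fa: free_action "scop ` {1, - 1, \<i>, - \<i>}" "scop ` {1, - 1}"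
    using scop_free_action[OF unit_group_complex0 nonzero] .
  have ap: "scop q v = sc q v" if "q \<in> {1, - 1, \<i>, - \<i>}" for q v
    using that by (auto intro!: scop_apply simp: star_complex_def)
  have J: "scop \<i> \<in> fa.V" by (rule scop_in_V[OF unit_group_complex0]) (auto simp: complex_eq_iff)
  have im: "v \<bullet> sc \<i> w = Im (ip v w)" for v w
  proof -
    have "of_real (2 * (v \<bullet> sc \<i> w)) = ip v w * cnj \<i> + cnj (ip v w * cnj \<i>)"
      unfolding ip_inner ip_sc_right by (simp add: star_complex_def)
    then show ?thesis by (simp add: complex_eq_iff)
  qed
  have "g \<in> Sp_group ip \<longleftrightarrow> g \<in> fa.Gr" for g
    unfolding Sp_group_def GL_def preserves_def fa.Gr_iff[OF J]
    by (auto simp: ap im sc_one sc_uminus blin_simps)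
  then show ?thesis by blast
qed

text \<open>The real part of the skew form is v \<bullet> jw; its imaginary part follows from
  complex linearity on replacing v by iv.\<close>

lemma U_quat_eq_Gr:
  fixes sc :: "quat \<Rightarrow> 'h::{real_inner,complete_space} \<Rightarrow> 'h"
  assumes "separable_infinite_dim_hilbert_space sc ip"
  shows "U_quat_complexified sc ip = free_action.Gr (hilbert_space.scop sc ` Q8) (hilbert_space.scop sc ` Q4)"
proof -
  interpret separable_infinite_dim_hilbert_space sc ip by fact
  interpret fa: free_action "scop ` Q8" "scop ` Q4"
    using scop_free_action[OF unit_group_quat0 nonzero] .
  have ap: "scop q v = sc q v" if "q \<in> Q8" for q v
    using that unit_group_quat by (auto intro!: scop_apply simp: unit_group_def)
  have j8: "quat_j \<in> Q8" "quat_j \<notin> Q4" by (auto simp: Q8_def Q4_def quat_j_def complex_eq_iff)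
  have J: "scop quat_j \<in> fa.V" by (rule scop_in_V[OF unit_group_quat0 j8])
  have re: "v \<bullet> sc quat_j w = Re (skew_form sc ip v w)" for v w
  proof -
    have "of_real (2 * (v \<bullet> sc quat_j w)) = ip v (sc quat_j w) + star (ip v (sc quat_j w))"
      by (rule ip_inner)
    then have "cpart (of_real (2 * (v \<bullet> sc quat_j w))) = cpart (ip v (sc quat_j w)) + cnj (cpart (ip v (sc quat_j w)))"
      by (simp add: plus_quat_def star_quat_def)
    then show ?thesis
      by (simp add: skew_form_def restrict_ip_def of_real_def scaleR_quat_def one_quat_def complex_eq_iff)
  qed
  have skew_i: "skew_form sc ip (sc (Quat z 0) v) w = z * skew_form sc ip v w" for z v w
    by (simp add: skew_form_def restrict_ip_def ip_sc_left times_quat_def)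
  have lin: "(\<forall>a v. g (restrict_scalars sc a v) = restrict_scalars sc a (g v)) \<longleftrightarrow>
      (\<forall>q\<in>Q4. \<forall>v. g (sc q v) = sc q (g v))" for g :: "'h \<Rightarrow>\<^sub>L 'h"
  proof (intro iffI allI)
    fix a v assume h: "\<forall>q\<in>Q4. \<forall>v. g (sc q v) = sc q (g v)"
    have "Quat a 0 = Re a *\<^sub>R 1 + Im a *\<^sub>R Quat \<i> 0"
      by (simp add: plus_quat_def scaleR_quat_def one_quat_def complex_eq_iff)
    then have r: "restrict_scalars sc a w = Re a *\<^sub>R w + Im a *\<^sub>R sc (Quat \<i> 0) w" for w
      by (simp add: restrict_scalars_def sc_add_left sc_scaleR_left sc_one)
    have "g (sc (Quat \<i> 0) w) = sc (Quat \<i> 0) (g w)" for w using h by (simp add: Q4_def)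
    then show "g (restrict_scalars sc a v) = restrict_scalars sc a (g v)"
      by (simp add: r blin_simps)
  qed (auto simp: restrict_scalars_def Q4_def)
  have q48: "q \<in> Q4 \<Longrightarrow> q \<in> Q8" for q by (auto simp: Q8_def Q4_def)
  have form: "preserves (skew_form sc ip) g \<longleftrightarrow> (\<forall>v w. g v \<bullet> sc quat_j (g w) = v \<bullet> sc quat_j w)"
    if g: "\<forall>q\<in>Q4. \<forall>v. g (sc q v) = sc q (g v)" for g :: "'h \<Rightarrow>\<^sub>L 'h"
  proof
    assume h: "\<forall>v w. g v \<bullet> sc quat_j (g w) = v \<bullet> sc quat_j w"
    have gi: "g (sc (Quat \<i> 0) v) = sc (Quat \<i> 0) (g v)" for v using g by (simp add: Q4_def)
    have R: "Re (skew_form sc ip (g v) (g w)) = Re (skew_form sc ip v w)" for v w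
      using h by (simp add: re)
    have "Re (skew_form sc ip (g (sc (Quat \<i> 0) v)) (g w)) = Re (skew_form sc ip (sc (Quat \<i> 0) v) w)" for v w
      by (rule R)
    then have "Im (skew_form sc ip (g v) (g w)) = Im (skew_form sc ip v w)" for v w
      by (simp add: gi skew_i)
    then show "preserves (skew_form sc ip) g" using R by (simp add: preserves_def complex_eq_iff)
  qed (simp add: preserves_def re)
  have "g \<in> U_quat_complexified sc ip \<longleftrightarrow> g \<in> fa.Gr" for g
    unfolding U_quat_complexified_def GL_def lin fa.Gr_iff[OF J]
    by (auto simp: ap q48 j8 form)
  then show ?thesis by blast
qed

section \<open>The pairs acting on the double\<close>

lemma unit_groupD:
  assumes "unit_group Q Q0"
  shows "finite Q" "Q0 \<subseteq> Q" "1 \<in> Q0" "1 \<in> Q" "- 1 \<in> Q0"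
    and "q \<in> Q \<Longrightarrow> - q \<in> Q" "q \<in> Q \<Longrightarrow> - q \<in> Q0 \<longleftrightarrow> q \<in> Q0"
    and "q \<in> Q \<Longrightarrow> r \<in> Q \<Longrightarrow> q * r \<in> Q"
    and "q \<in> Q \<Longrightarrow> r \<in> Q \<Longrightarrow> q * r \<in> Q0 \<longleftrightarrow> (q \<in> Q0 \<longleftrightarrow> r \<in> Q0)"
    and "q \<in> Q \<Longrightarrow> q * star q = 1" "q \<in> Q \<Longrightarrow> q \<noteq> 1 \<Longrightarrow> q \<noteq> - 1 \<Longrightarrow> star q = - q"
proof -
  note u = assms[unfolded unit_group_def]
  have u1: "finite Q" "Q0 \<subseteq> Q" "1 \<in> Q0" and u2: "\<forall>q\<in>Q. - q \<in> Q" "\<forall>q\<in>Q0. - q \<in> Q0"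
    and u3: "\<forall>q\<in>Q. \<forall>r\<in>Q. q * r \<in> Q \<and> (q * r \<in> Q0 \<longleftrightarrow> (q \<in> Q0 \<longleftrightarrow> r \<in> Q0))"
    and u4: "\<forall>q\<in>Q. q * star q = 1 \<and> (q = 1 \<or> q = - 1 \<or> star q = - q)"
    using u by simp_all
  show "finite Q" "Q0 \<subseteq> Q" "1 \<in> Q0" "1 \<in> Q" "- 1 \<in> Q0" using u1 u2 by auto
  show "q \<in> Q \<Longrightarrow> - q \<in> Q" using u2 by simp
  show "q \<in> Q \<Longrightarrow> - q \<in> Q0 \<longleftrightarrow> q \<in> Q0" using u2(2) by (metis minus_minus)
  show "q \<in> Q \<Longrightarrow> r \<in> Q \<Longrightarrow> q * r \<in> Q"
    "q \<in> Q \<Longrightarrow> r \<in> Q \<Longrightarrow> q * r \<in> Q0 \<longleftrightarrow> (q \<in> Q0 \<longleftrightarrow> r \<in> Q0)" using u3 by simp_all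
  show "q \<in> Q \<Longrightarrow> q * star q = 1" "q \<in> Q \<Longrightarrow> q \<noteq> 1 \<Longrightarrow> q \<noteq> - 1 \<Longrightarrow> star q = - q" using u4 by auto
qed

type_synonym mat2 = "real \<times> real \<times> real \<times> real"

text \<open>\<open>(p, q, r, s)\<close> stands for the matrix with rows \<open>(p, q)\<close> and \<open>(r, s)\<close>. \<open>D4\<close> is the dihedral group of order 8
  generated by the complex structure and the conjugation of a complexification.\<close>

definition mmul :: "mat2 \<Rightarrow> mat2 \<Rightarrow> mat2" where
  "mmul = (\<lambda>(p, q, r, s) (p', q', r', s'). (p * p' + q * r', p * q' + q * s', r * p' + s * r', r * q' + s * s'))"

definition Rot :: "mat2 set" where
  "Rot = {(1, 0, 0, 1), (- 1, 0, 0, - 1), (0, - 1, 1, 0), (0, 1, - 1, 0)}"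

definition D4 :: "mat2 set" where
  "D4 = Rot \<union> {(1, 0, 0, - 1), (- 1, 0, 0, 1), (0, 1, 1, 0), (0, - 1, - 1, 0)}"

definition D2 :: "mat2 set" where
  "D2 = {(1, 0, 0, 1), (- 1, 0, 0, - 1), (1, 0, 0, - 1), (- 1, 0, 0, 1)}"

text \<open>\<open>Rot\<close> is the part of determinant 1, so membership is multiplicative; the
  finitely many cases are enumerated.\<close>

lemma mmul_D4: "M \<in> D4 \<Longrightarrow> N \<in> D4 \<Longrightarrow> mmul M N \<in> D4 \<and> (mmul M N \<in> Rot \<longleftrightarrow> (M \<in> Rot \<longleftrightarrow> N \<in> Rot))"
  unfolding D4_def Rot_def mmul_def by (elim UnE insertE emptyE) simp_all

lemma mmul_D2: "M \<in> D2 \<Longrightarrow> N \<in> D2 \<Longrightarrow> mmul M N \<in> D2"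
  unfolding D2_def mmul_def by (elim insertE emptyE) simp_all

lemma D2_D4: "D2 \<subseteq> D4"
  by (auto simp: D2_def D4_def Rot_def)

context separable_infinite_dim_hilbert_space
begin

definition pop :: "mat2 \<Rightarrow> 'k \<Rightarrow> ('h \<times> 'h) \<Rightarrow>\<^sub>L ('h \<times> 'h)" where
  "pop M a = Blinfun (\<lambda>v. case M of (p, q, r, s) \<Rightarrow>
     (p *\<^sub>R sc a (fst v) + q *\<^sub>R sc a (snd v), r *\<^sub>R sc a (fst v) + s *\<^sub>R sc a (snd v)))"

lemma pop_apply:
  assumes "a * star a = 1"
  shows "pop (p, q, r, s) a v =
    (p *\<^sub>R sc a (fst v) + q *\<^sub>R sc a (snd v), r *\<^sub>R sc a (fst v) + s *\<^sub>R sc a (snd v))"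
proof -
  have f: "bounded_linear (\<lambda>v. sc a (fst v))" "bounded_linear (\<lambda>v. sc a (snd v))"
    using bounded_linear_compose[OF bounded_linear_sc[OF assms]] bounded_linear_fst bounded_linear_snd by blast+
  have "bounded_linear (\<lambda>v. (p *\<^sub>R sc a (fst v) + q *\<^sub>R sc a (snd v), r *\<^sub>R sc a (fst v) + s *\<^sub>R sc a (snd v)))"
    by (intro bounded_linear_Pair bounded_linear_add bounded_linear_const_scaleR f)
  then show ?thesis unfolding pop_def by (simp add: bounded_linear_Blinfun_apply)
qed

definition PZ :: "mat2 set \<Rightarrow> 'k set \<Rightarrow> (('h \<times> 'h) \<Rightarrow>\<^sub>L ('h \<times> 'h)) set" where
  "PZ \<M> Q = {pop M q |M q. M \<in> \<M> \<and> q \<in> Q}"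

text \<open>The kernel of a product of two sign characters: the determinant of \<open>M\<close> and
  the class of \<open>q\<close> modulo \<open>Q0\<close>.\<close>

definition PU :: "mat2 set \<Rightarrow> 'k set \<Rightarrow> 'k set \<Rightarrow> (('h \<times> 'h) \<Rightarrow>\<^sub>L ('h \<times> 'h)) set" where
  "PU \<M> Q Q0 = {pop M q |M q. M \<in> \<M> \<and> q \<in> Q \<and> (M \<in> Rot \<longleftrightarrow> q \<in> Q0)}"

lemma PZ_I: "M \<in> \<M> \<Longrightarrow> q \<in> Q \<Longrightarrow> pop M q \<in> PZ \<M> Q"
  and PU_I: "M \<in> \<M> \<Longrightarrow> q \<in> Q \<Longrightarrow> M \<in> Rot \<longleftrightarrow> q \<in> Q0 \<Longrightarrow> pop M q \<in> PU \<M> Q Q0"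
  unfolding PZ_def PU_def by blast+

lemma PZ_E:
  assumes "x \<in> PZ \<M> Q"
  obtains M q where "x = pop M q" "M \<in> \<M>" "q \<in> Q"
  using assms unfolding PZ_def by blast

lemma PU_E:
  assumes "x \<in> PU \<M> Q Q0"
  obtains M q where "x = pop M q" "M \<in> \<M>" "q \<in> Q" "M \<in> Rot \<longleftrightarrow> q \<in> Q0"
  using assms unfolding PU_def by blast

text \<open>\<open>D2\<close> with \<open>Q0 = Q\<close> gives \<open>U(H,H)\<close>, \<open>D4\<close> over the reals gives the complexified orthogonal group, and
  \<open>D4\<close> over the complex numbers with \<open>Q0 = {1, -1}\<close> gives \<open>O*\<close>: its scalars \<open>U\<close> form a quaternion group
  generated by the complex structure and the product of \<open>D\<close> with the conjugation.\<close>

definition admissible :: "mat2 set \<Rightarrow> 'k set \<Rightarrow> 'k set \<Rightarrow> bool" where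
  "admissible \<M> Q Q0 \<longleftrightarrow> unit_group Q Q0 \<and> (\<M> = D2 \<or> \<M> = D4 \<and> Q0 \<subseteq> {1, - 1})"

lemma admissibleD:
  assumes "admissible \<M> Q Q0"
  shows "unit_group Q Q0" "\<M> = D2 \<or> \<M> = D4" "\<M> \<noteq> D2 \<Longrightarrow> q \<in> Q0 \<Longrightarrow> q = 1 \<or> q = - 1"
    and "M \<in> \<M> \<Longrightarrow> M \<in> D4"
  using assms D2_D4 by (auto simp: admissible_def)

lemma pop_one: "pop (1, 0, 0, 1) 1 = id_blinfun"
  by (rule blinfun_eqI) (simp add: pop_apply sc_one)

lemma pop_uminus:
  assumes "q * star q = 1"
  shows "- pop M q = pop M (- q)"
proof (rule blinfun_eqI)
  fix v
  have "- q * star (- q) = 1" using assms by (simp add: star_uminus)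
  then show "(- pop M q) v = pop M (- q) v"
    using assms by (cases M) (simp add: pop_apply blinfun.minus_left sc_uminus del: minus_mult_minus)
qed

lemma pop_compose:
  assumes "a * star a = 1" "c * star c = 1"
  shows "pop M a o\<^sub>L pop N c = pop (mmul M N) (a * c)"
proof (rule blinfun_eqI)
  fix v
  have "a * c * star (a * c) = a * (c * star c) * star a" by (simp only: star_mult mult.assoc)
  then have "a * c * star (a * c) = 1" using assms by simp
  then show "(pop M a o\<^sub>L pop N c) v = pop (mmul M N) (a * c) v"
    using assms
    by (cases M; cases N)
      (simp add: pop_apply mmul_def sc_add_right sc_scaleR sc_sc scaleR_add_right scaleR_add_left)
qed

lemma pop_isometry:
  assumes "q * star q = 1" "M \<in> D4"
  shows "pop M q v \<bullet> pop M q w = v \<bullet> w"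
  using assms(2) unfolding D4_def Rot_def
  by (elim UnE insertE emptyE) (simp_all add: pop_apply assms(1) inner_prod_def inner_sc[OF assms(1)])

lemma pop_signs:
  "pop (- 1, 0, 0, - 1) 1 = - id_blinfun"
  "pop (1, 0, 0, 1) (- 1) = - id_blinfun"
  "pop (- 1, 0, 0, - 1) (- 1) = id_blinfun"
proof -
  show p1: "pop (- 1, 0, 0, - 1) 1 = - id_blinfun"
    by (rule blinfun_eqI) (simp add: pop_apply sc_one blinfun.minus_left prod_eq_iff)
  show "pop (1, 0, 0, 1) (- 1) = - id_blinfun"
    using pop_uminus[of 1 "(1, 0, 0, 1)"] pop_one by simp
  show "pop (- 1, 0, 0, - 1) (- 1) = id_blinfun"
    using pop_uminus[of 1 "(- 1, 0, 0, - 1)"] p1 by simp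
qed

text \<open>A symmetric matrix with a skew scalar is skew, and so is a quarter turn with a real
  scalar. A quarter turn with an imaginary scalar would be symmetric, which is why
  \<open>admissible\<close> restricts \<open>Q0\<close> when \<open>D4\<close> occurs.\<close>

lemma pop_skew:
  assumes "admissible \<M> Q Q0" "M \<in> \<M>" "q \<in> Q" "M \<in> Rot \<longleftrightarrow> q \<in> Q0"
    and ne: "pop M q \<noteq> id_blinfun" "pop M q \<noteq> - id_blinfun"
  shows "v \<bullet> pop M q v = 0"
proof -
  note ug = admissibleD(1)[OF assms(1)]
  note un = unit_groupD(10)[OF ug assms(3)] unit_groupD(11)[OF ug assms(3)] unit_groupD(3,5)[OF ug]
  note pa = pop_apply[OF un(1)]
  show ?thesis
  proof (cases "M \<in> Rot")
    case True
    then consider "M = (1, 0, 0, 1) \<or> M = (- 1, 0, 0, - 1)" | "M = (0, - 1, 1, 0) \<or> M = (0, 1, - 1, 0)"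
      by (auto simp: Rot_def)
    then show ?thesis
    proof cases
      case 1
      have "q \<noteq> 1" using 1 ne pop_one pop_signs(1) by metis
      moreover have "q \<noteq> - 1" using 1 ne pop_signs(2,3) by metis
      ultimately have sk: "star q = - q" by (rule un(2))
      show ?thesis using 1 by (elim disjE) (simp_all add: pa inner_prod_def inner_sc_skew[OF sk])
    next
      case 2
      then have "M \<notin> D2" by (elim disjE) (simp_all add: D2_def)
      then have "\<M> \<noteq> D2" using assms(2) by blast
      then have "q = 1 \<or> q = - 1" using admissibleD(3)[OF assms(1)] assms(4) True by simp
      then have sw: "fst v \<bullet> sc q (snd v) = snd v \<bullet> sc q (fst v)"
        by (elim disjE) (simp_all add: sc_one sc_uminus inner_commute)
      show ?thesis using 2 by (elim disjE) (simp_all add: pa inner_prod_def sw)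
    qed
  next
    case False
    then have "q \<noteq> 1" "q \<noteq> - 1" using assms(4) un by auto
    then have sk: "star q = - q" by (rule un(2))
    have "M \<in> D4" using admissibleD(4)[OF assms(1,2)] .
    then have "M = (1, 0, 0, - 1) \<or> M = (- 1, 0, 0, 1) \<or> M = (0, 1, 1, 0) \<or> M = (0, - 1, - 1, 0)"
      using False by (auto simp: D4_def)
    then show ?thesis
      using inner_sc_skew_swap[OF sk, of "fst v" "snd v"]
      by (elim disjE) (simp_all add: pa inner_prod_def inner_sc_skew[OF sk])
  qed
qed

lemma P_free_action:
  assumes a: "admissible \<M> Q Q0"
  shows "free_action (PZ \<M> Q) (PU \<M> Q Q0)"
proof
  note ug = admissibleD(1)[OF a]
  note un = unit_groupD(10)[OF ug] and D4 = admissibleD(4)[OF a] and neg = unit_groupD(6)[OF ug]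
    and neg0 = unit_groupD(7)[OF ug] and qq = unit_groupD(8,9)[OF ug] and one = unit_groupD(3,4)[OF ug]
  have fin: "finite \<M>" using admissibleD(2)[OF a] by (auto simp: D2_def D4_def Rot_def)
  have mm: "mmul M N \<in> \<M>" "mmul M N \<in> Rot \<longleftrightarrow> (M \<in> Rot \<longleftrightarrow> N \<in> Rot)" if "M \<in> \<M>" "N \<in> \<M>" for M N
    using mmul_D2[of M N] mmul_D4[of M N] admissibleD(2)[OF a] that D4 by auto
  have "PZ \<M> Q = (\<Union>M\<in>\<M>. pop M ` Q)" unfolding PZ_def by blast
  then show "finite (PZ \<M> Q)" using fin unit_groupD(1)[OF ug] by simp
  show "PU \<M> Q Q0 \<subseteq> PZ \<M> Q" unfolding PU_def PZ_def by blast
  have "(1, 0, 0, 1) \<in> \<M>" "(1, 0, 0, 1) \<in> Rot" using admissibleD(2)[OF a] by (auto simp: D2_def D4_def Rot_def)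
  then show "id_blinfun \<in> PU \<M> Q Q0" using PU_I[of "(1, 0, 0, 1)" \<M> 1 Q Q0] one pop_one by simp
  show "- x \<in> PU \<M> Q Q0" if "x \<in> PU \<M> Q Q0" for x
    using that
  proof (rule PU_E)
    fix M y assume "x = pop M y" "M \<in> \<M>" "y \<in> Q" "M \<in> Rot \<longleftrightarrow> y \<in> Q0"
    then show ?thesis using PU_I[of M \<M> "- y" Q Q0] pop_uminus[OF un, of y M] neg neg0 by simp
  qed
  show "- x \<in> PZ \<M> Q" if "x \<in> PZ \<M> Q" for x
    using that
  proof (rule PZ_E)
    fix M y assume "x = pop M y" "M \<in> \<M>" "y \<in> Q"
    then show ?thesis using PZ_I[of M \<M> "- y" Q] pop_uminus[OF un, of y M] neg by simp
  qed
  show "x o\<^sub>L x' \<in> PU \<M> Q Q0" if "x \<in> PU \<M> Q Q0" "x' \<in> PU \<M> Q Q0" for x x'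
    using that(1)
  proof (rule PU_E)
    fix M y assume 1: "x = pop M y" "M \<in> \<M>" "y \<in> Q" "M \<in> Rot \<longleftrightarrow> y \<in> Q0"
    show ?thesis using that(2)
    proof (rule PU_E)
      fix N z assume 2: "x' = pop N z" "N \<in> \<M>" "z \<in> Q" "N \<in> Rot \<longleftrightarrow> z \<in> Q0"
      show ?thesis
        using PU_I[of "mmul M N" \<M> "y * z" Q Q0] 1 2 mm[of M N] qq[of y z]
        by (simp add: pop_compose[OF un un])
    qed
  qed
  show "x o\<^sub>L x' \<in> PZ \<M> Q" if "x \<in> PZ \<M> Q" "x' \<in> PZ \<M> Q" for x x'
    using that(1)
  proof (rule PZ_E)
    fix M y assume 1: "x = pop M y" "M \<in> \<M>" "y \<in> Q"
    show ?thesis using that(2)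
    proof (rule PZ_E)
      fix N z assume 2: "x' = pop N z" "N \<in> \<M>" "z \<in> Q"
      show ?thesis
        using PZ_I[of "mmul M N" \<M> "y * z" Q] 1 2 mm[of M N] qq[of y z]
        by (simp add: pop_compose[OF un un])
    qed
  qed
  show "x o\<^sub>L x' \<in> PU \<M> Q Q0" if xx: "x \<in> PZ \<M> Q - PU \<M> Q Q0" "x' \<in> PZ \<M> Q - PU \<M> Q Q0" for x x'
  proof (rule PZ_E[OF DiffD1[OF xx(1)]])
    fix M y assume 1: "x = pop M y" "M \<in> \<M>" "y \<in> Q"
    then have n1: "\<not> (M \<in> Rot \<longleftrightarrow> y \<in> Q0)" using PU_I[of M \<M> y Q Q0] xx(1) by auto
    show ?thesis
    proof (rule PZ_E[OF DiffD1[OF xx(2)]])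
      fix N z assume 2: "x' = pop N z" "N \<in> \<M>" "z \<in> Q"
      then have "\<not> (N \<in> Rot \<longleftrightarrow> z \<in> Q0)" using PU_I[of N \<M> z Q Q0] xx(2) by auto
      then show ?thesis
        using PU_I[of "mmul M N" \<M> "y * z" Q Q0] 1 2 n1 mm[of M N] qq[of y z]
        by (auto simp: pop_compose[OF un un])
    qed
  qed
  show "x v \<bullet> x w = v \<bullet> w" if "x \<in> PZ \<M> Q" for x v w
    using that
  proof (rule PZ_E)
    fix M y assume "x = pop M y" "M \<in> \<M>" "y \<in> Q"
    then show ?thesis using pop_isometry[OF un D4] by simp
  qed
  show "v \<bullet> x v = 0" if "x \<in> PU \<M> Q Q0" "x \<noteq> id_blinfun" "x \<noteq> - id_blinfun" for x v
    using that(1)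
  proof (rule PU_E)
    fix M y assume "x = pop M y" "M \<in> \<M>" "y \<in> Q" "M \<in> Rot \<longleftrightarrow> y \<in> Q0"
    then show ?thesis using pop_skew[OF a] that by simp
  qed
  show "id_blinfun \<noteq> (- id_blinfun :: ('h \<times> 'h) \<Rightarrow>\<^sub>L ('h \<times> 'h))"
  proof
    assume h: "id_blinfun = (- id_blinfun :: ('h \<times> 'h) \<Rightarrow>\<^sub>L ('h \<times> 'h))"
    obtain x :: 'h where "x \<noteq> 0" using nonzero by blast
    have "(x, 0::'h) = - (x, 0)" using arg_cong[OF h, of "\<lambda>z. z (x, 0)"] by (simp add: blinfun.minus_left)
    then have "2 *\<^sub>R (x, 0::'h) = 0" unfolding scaleR_2 using eq_neg_iff_add_eq_0 by blast
    then show False using \<open>x \<noteq> 0\<close> by (simp add: zero_prod_def)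
  qed
qed

text \<open>An operator may have several representations \<open>pop M q\<close>, so non-membership
  in \<open>PU\<close> is read off from the operator: elements of \<open>PU\<close> other than 1 and
  -1 are skew, and the reflection is not.\<close>

lemma reflection_in_V:
  assumes a: "admissible \<M> Q Q0"
  shows "pop (1, 0, 0, - 1) 1 \<in> free_action.V (PZ \<M> Q) (PU \<M> Q Q0)"
proof -
  interpret fa: free_action "PZ \<M> Q" "PU \<M> Q Q0" using P_free_action[OF a] .
  let ?J = "pop (1, 0, 0, - 1) 1"
  have J: "?J v = (fst v, - snd v)" for v by (simp add: pop_apply sc_one)
  obtain x :: 'h where x: "x \<noteq> 0" using nonzero by blast
  have "(1, 0, 0, - 1) \<in> \<M>" "1 \<in> Q" using admissibleD(2)[OF a] unit_groupD(4)[OF admissibleD(1)[OF a]] by (auto simp: D2_def D4_def)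
  then have "?J \<in> PZ \<M> Q" unfolding PZ_def by blast
  moreover have "?J \<notin> PU \<M> Q Q0"
  proof
    assume U: "?J \<in> PU \<M> Q Q0"
    have "x \<noteq> - x" using x by (metis add.right_inverse scaleR_2 scaleR_eq_0_iff zero_neq_numeral)
    then have "?J \<noteq> id_blinfun" using J[of "(0, x)"] by auto
    moreover have "?J \<noteq> - id_blinfun"
    proof
      assume "?J = - id_blinfun"
      then have "(x, 0) = - (x, 0::'h)" using J[of "(x, 0)"] by (simp add: blinfun.minus_left)
      then show False using \<open>x \<noteq> - x\<close> by simp
    qed
    ultimately have "(x, 0::'h) \<bullet> ?J (x, 0) = 0" using fa.skew_U[OF U] by blast
    then show False using x by (simp add: J inner_prod_def)
  qed
  ultimately show ?thesis by (simp add: fa.V_def)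
qed

text \<open>\<open>Z\<close> contains symmetric reflections, so \<open>exists_basis\<close> cannot
  be applied with \<open>Z\<close> as \<open>U\<close>; a free basis of the double is assembled from
  a scalar basis \<open>h\<close> of the single space.\<close>

lemma trivial_rep_product:
  fixes vsc :: "complex \<Rightarrow> 'v::{real_inner,complete_space} \<Rightarrow> 'v"
  assumes V: "hilbert_space vsc vip" "separable (UNIV :: 'v set)"
    and a: "admissible \<M> Q Q0" and Q: "unit_group Q Q"
    and G: "G = free_action.Gr (PZ \<M> Q) (PU \<M> Q Q0)"
    and rep: "continuous_unitary_rep vsc vip G \<pi>"
  shows "trivial_rep G \<pi>"
proof -
  interpret fa: free_action "PZ \<M> Q" "PU \<M> Q Q0" using P_free_action[OF a] .
  note un = unit_groupD(10)[OF Q] unit_groupD(11)[OF Q]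
    and D4 = admissibleD(4)[OF a] and q = admissibleD(2)[OF a]
  obtain h :: "nat \<Rightarrow> 'h" where hh: "(\<forall>i. norm (h i) = 1) \<and> (\<forall>i j. \<forall>q\<in>Q. i \<noteq> j \<longrightarrow> h i \<bullet> sc q (h j) = 0) \<and>
    (\<forall>v. (\<forall>i. \<forall>q\<in>Q. v \<bullet> sc q (h i) = 0) \<longrightarrow> v = 0)"
    using exists_scalar_basis[OF Q] ..
  have h: "norm (h i) = 1" "q \<in> Q \<Longrightarrow> i \<noteq> j \<Longrightarrow> h i \<bullet> sc q (h j) = 0"
    "(\<And>i q. q \<in> Q \<Longrightarrow> v \<bullet> sc q (h i) = 0) \<Longrightarrow> v = 0" for i j q v
    using hh[THEN conjunct1] hh[THEN conjunct2, THEN conjunct1] hh[THEN conjunct2, THEN conjunct2] by simp_all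
  \<comment> \<open>For \<open>D2\<close> both entries of \<open>b k\<close> may be
    \<open>h k\<close>, as a sign change in one entry already gives an orthogonal vector.
    \<open>D4\<close> also swaps the entries, so they must be different basis vectors, taken from
    even and odd indices.\<close>
  define \<alpha> \<beta> where "\<alpha> k = (if \<M> = D2 then k else 2 * k)" and "\<beta> k = (if \<M> = D2 then k else 2 * k + 1)" for k :: nat
  have ab: "\<alpha> k \<noteq> \<alpha> l" "\<beta> k \<noteq> \<beta> l" "\<alpha> k \<noteq> \<beta> l" "\<beta> k \<noteq> \<alpha> l" if "k \<noteq> l" for k l
    using that by (cases "\<M> = D2"; simp add: \<alpha>_def \<beta>_def; presburger)+
  have ab': "\<alpha> k \<noteq> \<beta> k" if "\<M> \<noteq> D2" for k
    using that by (simp add: \<alpha>_def \<beta>_def)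
  define b where "b k = (1 / sqrt 2) *\<^sub>R (h (\<alpha> k), h (\<beta> k))" for k
  have pop_b: "v \<bullet> pop (p, r, s, t) x (b k) = (1 / sqrt 2) *
     (p * (fst v \<bullet> sc x (h (\<alpha> k))) + r * (fst v \<bullet> sc x (h (\<beta> k))) + s * (snd v \<bullet> sc x (h (\<alpha> k))) + t * (snd v \<bullet> sc x (h (\<beta> k))))"
    if "x \<in> Q" for p r s t x v k
    using un(1)[OF that]
    by (simp add: b_def pop_apply sc_scaleR inner_prod_def inner_add_right algebra_simps add_divide_distrib)
  have hsk: "h i \<bullet> sc x (h i) = 0" if "x \<in> Q" "x \<noteq> 1" "x \<noteq> - 1" for x i
    using inner_sc_skew[OF un(2)[OF that]] .
  show ?thesis
  proof (rule trivial_repI[where b = b, OF V fa.free_action_axioms _ _ G rep])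
    show "fa.fons UNIV b"
    proof (rule fa.fonsI)
      show "norm (b i) = 1" for i
        by (simp add: b_def norm_prod_def h power_divide)
    next
      fix i j :: nat and m assume ij: "i \<noteq> j" "m \<in> PZ \<M> Q"
      obtain M x where m3: "m = pop M x" and m12: "M \<in> \<M>" "x \<in> Q" using ij(2) by (rule PZ_E)
      note m = m12 m3
      show "b i \<bullet> m (b j) = 0" unfolding m(3)
        using ab[OF ij(1)] h(2)[OF m(2)] by (cases M) (simp add: pop_b[OF m(2)], simp add: b_def)
    next
      fix i :: nat and m assume mm: "m \<in> PZ \<M> Q" "m \<noteq> id_blinfun" "m \<noteq> - id_blinfun"
      obtain M x where m3: "m = pop M x" and m12: "M \<in> \<M>" "x \<in> Q" using mm(1) by (rule PZ_E)
      note m = m12 m3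
      obtain p r s t where M: "M = (p, r, s, t)" by (cases M)
      have "h (\<alpha> i) \<bullet> sc x (h (\<alpha> i)) = h (\<beta> i) \<bullet> sc x (h (\<beta> i))"
      proof (cases "x = 1 \<or> x = - 1")
        case True
        then show ?thesis by (auto simp: sc_one sc_uminus h dot_square_norm)
      next
        case False
        then show ?thesis using hsk m by auto
      qed
      moreover have "p + t = 0 \<or> h (\<alpha> i) \<bullet> sc x (h (\<alpha> i)) = 0"
      proof (cases "x = 1 \<or> x = - 1")
        case True
        have "M \<noteq> (1, 0, 0, 1)" "M \<noteq> (- 1, 0, 0, - 1)"
          using True mm(2,3) m(3) pop_one pop_signs by metis+
        then have "p + t = 0" using D4[OF m(1)] M by (auto simp: D4_def Rot_def)
        then show ?thesis ..
      next
        case False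
        then show ?thesis using hsk m by auto
      qed
      moreover have "r * (h (\<alpha> i) \<bullet> sc x (h (\<beta> i))) = 0" "s * (h (\<beta> i) \<bullet> sc x (h (\<alpha> i))) = 0"
      proof -
        have "\<M> = D2 \<Longrightarrow> r = 0 \<and> s = 0" using m(1) M by (auto simp: D2_def)
        then show "r * (h (\<alpha> i) \<bullet> sc x (h (\<beta> i))) = 0" "s * (h (\<beta> i) \<bullet> sc x (h (\<alpha> i))) = 0"
          using ab'[of i] h(2)[OF m(2), of "\<alpha> i" "\<beta> i"] h(2)[OF m(2), of "\<beta> i" "\<alpha> i"] by (cases "\<M> = D2"; auto)+
      qed
      ultimately have "p * (h (\<alpha> i) \<bullet> sc x (h (\<alpha> i))) + t * (h (\<beta> i) \<bullet> sc x (h (\<beta> i))) = 0"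
        by (metis add.right_neutral distrib_right mult_zero_left mult_zero_right)
      moreover have "b i \<bullet> m (b i) = (1 / sqrt 2) * ((1 / sqrt 2) * (
          p * (h (\<alpha> i) \<bullet> sc x (h (\<alpha> i))) + t * (h (\<beta> i) \<bullet> sc x (h (\<beta> i)))
          + r * (h (\<alpha> i) \<bullet> sc x (h (\<beta> i))) + s * (h (\<beta> i) \<bullet> sc x (h (\<alpha> i)))))"
        unfolding m(3) M pop_b[OF m(2)] by (simp add: b_def algebra_simps add_divide_distrib)
      ultimately show "b i \<bullet> m (b i) = 0"
        using \<open>r * _ = 0\<close> \<open>s * _ = 0\<close> by simp
    qed
    show "v = 0" if v: "\<And>i m. m \<in> PZ \<M> Q \<Longrightarrow> v \<bullet> m (b i) = 0" for v
    proof -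
      have vp: "v \<bullet> pop M x (b i) = 0" if "M \<in> \<M>" "x \<in> Q" for M x i
        using v[OF PZ_I[OF that]] .
      have M12: "(1, 0, 0, 1) \<in> \<M>" "(1, 0, 0, - 1) \<in> \<M>" using q by (auto simp: D2_def D4_def Rot_def)
      \<comment> \<open>The identity and the reflection give the sum and the difference of two
        products, which separates the components.\<close>
      have 1: "fst v \<bullet> sc x (h (\<alpha> i)) = 0 \<and> snd v \<bullet> sc x (h (\<beta> i)) = 0" if "x \<in> Q" for x i
        using vp[OF M12(1) that, of i] vp[OF M12(2) that, of i] by (simp add: pop_b[OF that])
      have 2: "fst v \<bullet> sc x (h (\<beta> i)) = 0 \<and> snd v \<bullet> sc x (h (\<alpha> i)) = 0" if "x \<in> Q" "\<M> = D4" for x i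
      proof -
        have M34: "(0, - 1, 1, 0) \<in> \<M>" "(0, 1, 1, 0) \<in> \<M>" using that by (auto simp: D4_def Rot_def)
        show ?thesis
          using vp[OF M34(1) that(1), of i] vp[OF M34(2) that(1), of i] by (simp add: pop_b[OF that(1)])
      qed
      have "fst v \<bullet> sc x (h n) = 0 \<and> snd v \<bullet> sc x (h n) = 0" if "x \<in> Q" for x n
      proof (cases "\<M> = D2")
        case True
        then show ?thesis using 1[OF that, of n] by (simp add: \<alpha>_def \<beta>_def)
      next
        case False
        then have D: "\<M> = D4" using q by blast
        have "n = \<alpha> (n div 2) \<or> n = \<beta> (n div 2)" using False unfolding \<alpha>_def \<beta>_def by simp presburger
        then show ?thesis using 1[OF that, of "n div 2"] 2[OF that D, of "n div 2"] by metis
      qed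
      then have "fst v = 0" "snd v = 0" using h(3) by blast+
      then show ?thesis by (simp add: prod_eq_iff)
    qed
  qed
qed

end

section \<open>Identification of the groups on the double\<close>

context separable_infinite_dim_hilbert_space
begin

lemma reflection_apply: "pop (1, 0, 0, - 1) 1 v = (fst v, - snd v)"
  by (simp add: pop_apply sc_one)

lemma linear_scalars:
  fixes g :: "('h \<times> 'h) \<Rightarrow>\<^sub>L ('h \<times> 'h)"
  assumes "span Q = UNIV" "\<And>q v. q \<in> Q \<Longrightarrow> g (sum_scale sc q v) = sum_scale sc q (g v)"
  shows "g (sum_scale sc a v) = sum_scale sc a (g v)"
proof -
  have "a \<in> span Q" using assms(1) by simp
  then show ?thesis
  proof (induction rule: span_induct_alt)
    case base
    have "sc 0 x = 0" for x using sc_of_real[of 0 x] by simp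
    then show ?case by (simp add: sum_scale_def blinfun.zero_right flip: zero_prod_def)
  next
    case (step r q y)
    have "sum_scale sc (r *\<^sub>R q + y) v = r *\<^sub>R sum_scale sc q v + sum_scale sc y v" for v
      by (simp add: sum_scale_def sc_add_left sc_scaleR_left)
    then show ?case using step assms(2) by (simp add: blin_simps)
  qed
qed

lemma U_indefinite_eq_Gr:
  assumes Q: "unit_group Q Q" and sp: "span Q = UNIV" and pos: "\<And>z :: 'k. star z * z = 0 \<Longrightarrow> z = 0"
  shows "U_indefinite sc ip = free_action.Gr (PZ D2 Q) (PU D2 Q Q)"
proof -
  have a: "admissible D2 Q Q" unfolding admissible_def using Q by blast
  interpret fa: free_action "PZ D2 Q" "PU D2 Q Q" using P_free_action[OF a] .
  note J = reflection_in_V[OF a]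
  have lin: "(\<forall>x\<in>PU D2 Q Q. \<forall>v. g (blinfun_apply x v) = x (g v)) \<longleftrightarrow> (\<forall>a v. g (sum_scale sc a v) = sum_scale sc a (g v))"
    for g :: "('h \<times> 'h) \<Rightarrow>\<^sub>L ('h \<times> 'h)"
  proof
    assume h: "\<forall>x\<in>PU D2 Q Q. \<forall>v. g (blinfun_apply x v) = x (g v)"
    show "\<forall>a v. g (sum_scale sc a v) = sum_scale sc a (g v)"
    proof (intro allI, rule linear_scalars[OF sp])
      fix q v assume q: "q \<in> Q"
      then have "pop (1, 0, 0, 1) q \<in> PU D2 Q Q" by (intro PU_I) (auto simp: D2_def Rot_def)
      moreover have "pop (1, 0, 0, 1) q v = sum_scale sc q v" for v
        using unit_groupD(10)[OF Q q] by (simp add: pop_apply sum_scale_def)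
      ultimately show "g (sum_scale sc q v) = sum_scale sc q (g v)" using h by metis
    qed
  next
    assume h: "\<forall>a v. g (sum_scale sc a v) = sum_scale sc a (g v)"
    show "\<forall>x\<in>PU D2 Q Q. \<forall>v. g (blinfun_apply x v) = x (g v)"
    proof (intro ballI allI)
      fix x v assume xU: "x \<in> PU D2 Q Q"
      obtain M q where x: "x = pop M q" and M0: "M \<in> D2" "q \<in> Q" "M \<in> Rot \<longleftrightarrow> q \<in> Q"
        using xU by (rule PU_E)
      have M: "M \<in> D2" "q \<in> Q" "M \<in> Rot" using M0 by simp_all
      obtain p r s t where prst: "M = (p, r, s, t)" by (cases M)
      have "M = (1, 0, 0, 1) \<or> M = (- 1, 0, 0, - 1)"
        using M(1,3) unfolding D2_def Rot_def prst insert_iff empty_iff prod.inject by (elim disjE conjE) simp_all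
      then have "(\<forall>v. x v = sum_scale sc q v) \<or> (\<forall>v. x v = - sum_scale sc q v)"
        by (elim disjE) (simp_all add: x pop_apply[OF unit_groupD(10)[OF Q M(2)]] sum_scale_def)
      then show "g (x v) = x (g v)"
        using h by (elim disjE) (simp_all add: blinfun.minus_right del: split_paired_All)
    qed
  qed
  have re: "of_real (2 * (v \<bullet> pop (1, 0, 0, - 1) 1 w)) = indefinite_form ip v w + star (indefinite_form ip v w)" for v w
  proof -
    have "star (x - y) = star x - star (y :: 'k)" for x y
      using star_add[of x "- y"] by (simp add: star_uminus)
    then have "indefinite_form ip v w + star (indefinite_form ip v w) =
       of_real (2 * (fst v \<bullet> fst w)) - of_real (2 * (snd v \<bullet> snd w))"
      unfolding ip_inner indefinite_form_def by simp
    then show ?thesis by (simp add: reflection_apply inner_prod_def right_diff_distrib)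
  qed
  have form: "preserves (indefinite_form ip) g \<longleftrightarrow> (\<forall>v w. g v \<bullet> pop (1, 0, 0, - 1) 1 (g w) = v \<bullet> pop (1, 0, 0, - 1) 1 w)"
    if g: "\<forall>a v. g (sum_scale sc a v) = sum_scale sc a (g v)" for g :: "('h \<times> 'h) \<Rightarrow>\<^sub>L ('h \<times> 'h)"
  proof
    assume h: "preserves (indefinite_form ip) g"
    show "\<forall>v w. g v \<bullet> pop (1, 0, 0, - 1) 1 (g w) = v \<bullet> pop (1, 0, 0, - 1) 1 w"
    proof (intro allI)
      fix v w
      have "(of_real (2 * (g v \<bullet> pop (1, 0, 0, - 1) 1 (g w))) :: 'k) = of_real (2 * (v \<bullet> pop (1, 0, 0, - 1) 1 w))"
        unfolding re using h[unfolded preserves_def, rule_format, of v w] by simp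
      then have "2 * (g v \<bullet> pop (1, 0, 0, - 1) 1 (g w)) = 2 * (v \<bullet> pop (1, 0, 0, - 1) 1 w)"
        by (simp only: of_real_eq_iff)
      then show "g v \<bullet> pop (1, 0, 0, - 1) 1 (g w) = v \<bullet> pop (1, 0, 0, - 1) 1 w" by simp
    qed
  next
    assume h: "\<forall>v w. g v \<bullet> pop (1, 0, 0, - 1) 1 (g w) = v \<bullet> pop (1, 0, 0, - 1) 1 w"
    have "indefinite_form ip (g v) (g w) = indefinite_form ip v w" for v w
    proof -
      have sf: "indefinite_form ip (sum_scale sc a x) y = a * indefinite_form ip x y" for a x y
        by (simp add: indefinite_form_def sum_scale_def ip_sc_left right_diff_distrib)
      \<comment> \<open>Only the real part of the form is known to be preserved. Scaling the first
        argument by \<open>star z\<close> turns the discrepancy z into \<open>star z * z\<close>,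
        which equals its own star, so it vanishes and \<open>pos\<close> applies.\<close>
      define z where "z = indefinite_form ip (g v) (g w) - indefinite_form ip v w"
      let ?v = "sum_scale sc (star z) v"
      have "indefinite_form ip (g ?v) (g w) + star (indefinite_form ip (g ?v) (g w)) =
          indefinite_form ip ?v w + star (indefinite_form ip ?v w)"
        unfolding re[symmetric] using h[rule_format, of ?v w] by simp
      then have "star z * indefinite_form ip (g v) (g w) + star (star z * indefinite_form ip (g v) (g w)) =
          star z * indefinite_form ip v w + star (star z * indefinite_form ip v w)"
        by (simp add: sf g[rule_format])
      moreover have "star z * z + star (star z * z) =
         (star z * indefinite_form ip (g v) (g w) + star (star z * indefinite_form ip (g v) (g w)))
         - (star z * indefinite_form ip v w + star (star z * indefinite_form ip v w))"
      proof -
        have d: "star (x - y) = star x - star (y :: 'k)" for x y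
          using star_add[of x "- y"] by (simp add: star_uminus)
        show ?thesis unfolding z_def right_diff_distrib d by (simp add: algebra_simps)
      qed
      ultimately have "star z * z + star (star z * z) = 0" by simp
      then have "2 *\<^sub>R (star z * z) = 0" by (simp add: star_mult star_star scaleR_2)
      then have "star z * z = 0" by simp
      then have "z = 0" by (rule pos)
      then show ?thesis by (simp add: z_def)
    qed
    then show "preserves (indefinite_form ip) g" by (simp add: preserves_def)
  qed
  have "g \<in> U_indefinite sc ip \<longleftrightarrow> g \<in> fa.Gr" for g
    unfolding U_indefinite_def GL_def fa.Gr_iff[OF J] lin using form by blast
  then show ?thesis by blast
qed

abbreviation rot :: "('h \<times> 'h) \<Rightarrow>\<^sub>L ('h \<times> 'h)" where "rot \<equiv> pop (0, - 1, 1, 0) 1"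

lemma rot_apply: "rot v = (- snd v, fst v)"
  by (simp add: pop_apply sc_one)

lemma cx_scale_rot: "cx_scale z v = Re z *\<^sub>R v + Im z *\<^sub>R rot v"
  by (simp add: cx_scale_def rot_apply prod_eq_iff)

lemma cx_linear_iff:
  fixes g :: "('h \<times> 'h) \<Rightarrow>\<^sub>L ('h \<times> 'h)"
  shows
  "(\<forall>a v. g (cx_scale a v) = cx_scale a (g v)) \<longleftrightarrow> (\<forall>v. g (rot v) = rot (g v))"
proof
  assume h: "\<forall>a v. g (cx_scale a v) = cx_scale a (g v)"
  show "\<forall>v. g (rot v) = rot (g v)"
    using h[rule_format, of \<i>] by (simp add: cx_scale_rot)
qed (simp add: cx_scale_rot blin_simps)

text \<open>The imaginary part of the bilinear form is minus its real part after rotating the first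
  argument, so under complex linearity the real part determines the form.\<close>

lemma cx_bilinear_iff:
  fixes g :: "('h \<times> 'h) \<Rightarrow>\<^sub>L ('h \<times> 'h)"
  assumes g: "\<forall>v. g (rot v) = rot (g v)"
  shows "preserves cx_bilinear g \<longleftrightarrow> (\<forall>v w. g v \<bullet> pop (1, 0, 0, - 1) 1 (g w) = v \<bullet> pop (1, 0, 0, - 1) 1 w)"
proof -
  have re: "v \<bullet> pop (1, 0, 0, - 1) 1 w = Re (cx_bilinear v w)" for v w
    by (simp add: reflection_apply inner_prod_def cx_bilinear_def)
  have im: "cx_bilinear v w = Complex (Re (cx_bilinear v w)) (- Re (cx_bilinear (rot v) w))" for v w
    by (simp add: rot_apply cx_bilinear_def)
  show ?thesis
  proof
    assume h: "\<forall>v w. g v \<bullet> pop (1, 0, 0, - 1) 1 (g w) = v \<bullet> pop (1, 0, 0, - 1) 1 w"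
    have R: "Re (cx_bilinear (g v) (g w)) = Re (cx_bilinear v w)" for v w
      using h[rule_format, of v w] unfolding re .
    have "Re (cx_bilinear (rot (g v)) (g w)) = Re (cx_bilinear (rot v) w)" for v w
      using R[of "rot v" w] g by simp
    then show "preserves cx_bilinear g"
      unfolding preserves_def by (subst (1 2) im) (simp add: R)
  qed (simp add: preserves_def re)
qed

end

lemma O_complexified_eq_Gr:
  assumes "separable_infinite_dim_hilbert_space scaleR (inner :: 'h::{real_inner,complete_space} \<Rightarrow> 'h \<Rightarrow> real)"
  shows "(O_complexified :: (('h \<times> 'h) \<Rightarrow>\<^sub>L ('h \<times> 'h)) set) =
    free_action.Gr (separable_infinite_dim_hilbert_space.PZ scaleR D4 {1, - 1})
      (separable_infinite_dim_hilbert_space.PU scaleR D4 {1, - 1} {1, - 1})"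
proof -
  interpret separable_infinite_dim_hilbert_space scaleR "inner :: 'h \<Rightarrow> 'h \<Rightarrow> real" by fact
  let ?Q = "{1, - 1 :: real}"
  have a: "admissible D4 ?Q ?Q" using unit_group_real by (simp add: admissible_def)
  interpret fa: free_action "PZ D4 ?Q" "PU D4 ?Q ?Q" using P_free_action[OF a] .
  note J = reflection_in_V[OF a]
  have lin: "(\<forall>x\<in>PU D4 ?Q ?Q. \<forall>v. g (blinfun_apply x v) = x (g v)) \<longleftrightarrow> (\<forall>v. g (rot v) = rot (g v))"
    for g :: "('h \<times> 'h) \<Rightarrow>\<^sub>L ('h \<times> 'h)"
  proof
    assume h: "\<forall>x\<in>PU D4 ?Q ?Q. \<forall>v. g (blinfun_apply x v) = x (g v)"
    have "rot \<in> PU D4 ?Q ?Q" by (rule PU_I) (auto simp: D4_def Rot_def)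
    then show "\<forall>v. g (rot v) = rot (g v)" using h by blast
  next
    assume h: "\<forall>v. g (rot v) = rot (g v)"
    show "\<forall>x\<in>PU D4 ?Q ?Q. \<forall>v. g (blinfun_apply x v) = x (g v)"
    proof (intro ballI allI)
      fix x v assume xU: "x \<in> PU D4 ?Q ?Q"
      obtain M q where x: "x = pop M q" and M0: "M \<in> D4" "q \<in> ?Q" "M \<in> Rot \<longleftrightarrow> q \<in> ?Q"
        using xU by (rule PU_E)
      have M: "q \<in> ?Q" "M \<in> Rot" using M0 by blast+
      have un: "q * star q = 1" using M(1) by (auto simp: star_real_def)
      have "\<exists>c. (\<forall>v. x v = c *\<^sub>R v) \<or> (\<forall>v. x v = c *\<^sub>R rot v)"
      proof -
        consider "M = (1, 0, 0, 1)" | "M = (- 1, 0, 0, - 1)" | "M = (0, - 1, 1, 0)" | "M = (0, 1, - 1, 0)"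
          using M(2) by (auto simp: Rot_def)
        then show ?thesis
        proof cases
          case 1
          show ?thesis by (intro exI[of _ q]) (simp add: x 1 pop_apply[OF un] prod_eq_iff)
        next
          case 2
          show ?thesis by (intro exI[of _ "- q"]) (simp add: x 2 pop_apply[OF un] prod_eq_iff)
        next
          case 3
          show ?thesis by (intro exI[of _ q]) (simp add: x 3 pop_apply[OF un] rot_apply prod_eq_iff)
        next
          case 4
          show ?thesis by (intro exI[of _ "- q"]) (simp add: x 4 pop_apply[OF un] rot_apply prod_eq_iff)
        qed
      qed
      then show "g (x v) = x (g v)"
        using h by (elim exE disjE conjE) (simp_all add: blinfun.scaleR_right del: split_paired_All)
    qed
  qed
  have "g \<in> O_complexified \<longleftrightarrow> g \<in> fa.Gr" for g :: "('h \<times> 'h) \<Rightarrow>\<^sub>L ('h \<times> 'h)"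
    unfolding O_complexified_def GL_def fa.Gr_iff[OF J] lin cx_linear_iff
    using cx_bilinear_iff by blast
  then show ?thesis by blast
qed

text \<open>\<open>D\<close> is the product of the reflection \<open>?J\<close> and the operator
  \<open>?k\<close>. Once the form of \<open>?J\<close> is preserved, preserving the form of
  \<open>D\<close> amounts to commuting with \<open>?k\<close>.\<close>

lemma O_star_eq_Gr:
  fixes sc :: "complex \<Rightarrow> 'h::{real_inner,complete_space} \<Rightarrow> 'h"
  assumes "separable_infinite_dim_hilbert_space sc ip"
  shows "O_star sc = free_action.Gr (separable_infinite_dim_hilbert_space.PZ sc D4 {1, - 1, \<i>, - \<i>})
      (separable_infinite_dim_hilbert_space.PU sc D4 {1, - 1, \<i>, - \<i>} {1, - 1})"
proof -
  interpret separable_infinite_dim_hilbert_space sc ip by fact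
  let ?Q = "{1, - 1, \<i>, - \<i>}" and ?R = "{1, - 1 :: complex}"
  have a: "admissible D4 ?Q ?R" using unit_group_complex0 by (simp add: admissible_def)
  interpret fa: free_action "PZ D4 ?Q" "PU D4 ?Q ?R" using P_free_action[OF a] .
  let ?J = "pop (1, 0, 0, - 1) 1" and ?k = "pop (0, 1, 1, 0) \<i>"
  note J = reflection_in_V[OF a]
  have ui: "\<i> * star \<i> = 1" by (simp add: star_complex_def)
  have k: "?k v = (sc \<i> (snd v), sc \<i> (fst v))" for v by (simp add: pop_apply[OF ui])
  have lin: "(\<forall>x\<in>PU D4 ?Q ?R. \<forall>v. g (blinfun_apply x v) = x (g v)) \<longleftrightarrow>
      (\<forall>v. g (rot v) = rot (g v)) \<and> (\<forall>v. g (?k v) = ?k (g v))"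
    for g :: "('h \<times> 'h) \<Rightarrow>\<^sub>L ('h \<times> 'h)"
  proof (intro iffI conjI)
    assume h: "\<forall>x\<in>PU D4 ?Q ?R. \<forall>v. g (blinfun_apply x v) = x (g v)"
    have "rot \<in> PU D4 ?Q ?R" "?k \<in> PU D4 ?Q ?R"
      by (rule PU_I; simp add: D4_def Rot_def complex_eq_iff)+
    then show "\<forall>v. g (rot v) = rot (g v)" "\<forall>v. g (?k v) = ?k (g v)" using h by blast+
  next
    assume h: "(\<forall>v. g (rot v) = rot (g v)) \<and> (\<forall>v. g (?k v) = ?k (g v))"
    show "\<forall>x\<in>PU D4 ?Q ?R. \<forall>v. g (blinfun_apply x v) = x (g v)"
    proof (intro ballI allI)
      fix x v assume xU: "x \<in> PU D4 ?Q ?R"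
      obtain M q where x: "x = pop M q" and M: "M \<in> D4" "q \<in> ?Q" "M \<in> Rot \<longleftrightarrow> q \<in> ?R"
        using xU by (rule PU_E)
      have un: "q * star q = 1" using M(2) by (auto simp: star_complex_def)
      \<comment> \<open>Up to real factors the elements of \<open>PU\<close> are the four quaternion
        units 1, \<open>rot\<close>, \<open>?k\<close> and their product.\<close>
      have "\<exists>c. (\<forall>v. x v = c *\<^sub>R v) \<or> (\<forall>v. x v = c *\<^sub>R rot v) \<or> (\<forall>v. x v = c *\<^sub>R ?k v) \<or> (\<forall>v. x v = c *\<^sub>R rot (?k v))"
      proof (cases "M \<in> Rot")
        case True
        then have "\<exists>e. \<forall>w. sc q w = e *\<^sub>R w" using M(3)
          by (auto simp: sc_one sc_uminus intro: exI[of _ 1] exI[of _ "- 1"])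
        then obtain e where e: "\<And>w. sc q w = e *\<^sub>R w" by blast
        consider "M = (1, 0, 0, 1)" | "M = (- 1, 0, 0, - 1)" | "M = (0, - 1, 1, 0)" | "M = (0, 1, - 1, 0)"
          using True by (auto simp: Rot_def)
        then show ?thesis
        proof cases
          case 1
          show ?thesis by (intro exI[of _ e]) (simp add: x 1 pop_apply[OF un] e prod_eq_iff)
        next
          case 2
          show ?thesis by (intro exI[of _ "- e"]) (simp add: x 2 pop_apply[OF un] e prod_eq_iff)
        next
          case 3
          show ?thesis by (intro exI[of _ e]) (simp add: x 3 pop_apply[OF un] e rot_apply prod_eq_iff)
        next
          case 4
          show ?thesis by (intro exI[of _ "- e"]) (simp add: x 4 pop_apply[OF un] e rot_apply prod_eq_iff)
        qed
      next
        case False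
        then have "q = \<i> \<or> q = - \<i>" using M by auto
        then have "\<exists>e. \<forall>w. sc q w = e *\<^sub>R sc \<i> w"
          by (auto simp: sc_uminus intro: exI[of _ 1] exI[of _ "- 1"])
        then obtain e where e: "\<And>w. sc q w = e *\<^sub>R sc \<i> w" by blast
        consider "M = (1, 0, 0, - 1)" | "M = (- 1, 0, 0, 1)" | "M = (0, 1, 1, 0)" | "M = (0, - 1, - 1, 0)"
          using False M(1) by (auto simp: D4_def)
        then show ?thesis
        proof cases
          case 1
          show ?thesis by (intro exI[of _ "- e"]) (simp add: x 1 pop_apply[OF un] e rot_apply k prod_eq_iff)
        next
          case 2
          show ?thesis by (intro exI[of _ e]) (simp add: x 2 pop_apply[OF un] e rot_apply k prod_eq_iff)
        next
          case 3
          show ?thesis by (intro exI[of _ e]) (simp add: x 3 pop_apply[OF un] e k prod_eq_iff)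
        next
          case 4
          show ?thesis by (intro exI[of _ "- e"]) (simp add: x 4 pop_apply[OF un] e k prod_eq_iff)
        qed
      qed
      then show "g (x v) = x (g v)"
        using h by (elim exE disjE conjE) (simp_all add: blinfun.scaleR_right del: split_paired_All)
    qed
  qed
  have ii: "sc \<i> (sc \<i> x) = - x" for x by (simp add: sc_sc sc_one sc_uminus)
  have D: "D_op sc v = (sc \<i> (snd v), - sc \<i> (fst v))" for v
    by (simp add: D_op_def I_ext_def cx_scale_def)
  have DJ: "D_op sc v = ?J (?k v)" for v by (simp add: D reflection_apply k)
  have DD: "D_op sc (D_op sc v) = v" for v by (simp add: D linear_neg[OF linear_sc] ii)
  have invD: "inv (D_op sc) = D_op sc" by (rule inv_equality) (auto simp: DD)
  have isk: "x \<bullet> sc \<i> y = - (sc \<i> x \<bullet> y)" for x y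
    using inner_sc_skew_swap[of \<i> x y] by (simp add: star_complex_def inner_commute)
  have Dadj: "D_op sc v \<bullet> w = v \<bullet> D_op sc w" for v w
    by (simp add: D inner_prod_def isk)
  have UD: "D_op sc \<circ> adjoint (blinfun_apply g) \<circ> inv (D_op sc) = inv (blinfun_apply g) \<longleftrightarrow>
      (\<forall>v w. g v \<bullet> D_op sc (g w) = v \<bullet> D_op sc w)"
    if g: "g o\<^sub>L h = id_blinfun" "h o\<^sub>L g = id_blinfun" and gJ: "\<forall>v w. g v \<bullet> ?J (g w) = v \<bullet> ?J w"
    for g h :: "('h \<times> 'h) \<Rightarrow>\<^sub>L ('h \<times> 'h)"
  proof -
    note gh = blinfun_inverseD[OF g(1)] blinfun_inverseD[OF g(2)]
    have inv: "inv (blinfun_apply g) = blinfun_apply h" by (rule ex_inverse_iff[OF g])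
    have JJ: "?J (?J v) = v" for v by (simp add: reflection_apply)
    \<comment> \<open>\<open>adjoint\<close> is defined by choice, so its characteristic equation
      needs a witness. Conjugating the inverse by \<open>?J\<close> provides one because
      \<open>g\<close> preserves the form of \<open>?J\<close>.\<close>
    have "g v \<bullet> w = v \<bullet> ?J (h (?J w))" for v w
      using gJ[rule_format, of v "h (?J w)"] by (simp add: gh JJ)
    then have adj: "g v \<bullet> w = v \<bullet> adjoint (blinfun_apply g) w" for v w
      using adjoint_unique[of "blinfun_apply g" "\<lambda>w. ?J (h (?J w))"] by simp
    show ?thesis
    proof
      assume "D_op sc \<circ> adjoint (blinfun_apply g) \<circ> inv (D_op sc) = inv (blinfun_apply g)"
      then have "D_op sc (adjoint (blinfun_apply g) (D_op sc w)) = h w" for w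
        unfolding inv invD by (metis comp_apply)
      then have "adjoint (blinfun_apply g) (D_op sc (g w)) = D_op sc w" for w by (metis DD gh(2))
      then show "\<forall>v w. g v \<bullet> D_op sc (g w) = v \<bullet> D_op sc w" by (simp add: adj)
    next
      assume gD: "\<forall>v w. g v \<bullet> D_op sc (g w) = v \<bullet> D_op sc w"
      have "g v \<bullet> w = v \<bullet> D_op sc (h (D_op sc w))" for v w
        using gD[rule_format, of v "h (D_op sc w)"] by (simp add: gh DD)
      then have "adjoint (blinfun_apply g) = (\<lambda>w. D_op sc (h (D_op sc w)))"
        by (intro adjoint_unique) simp
      then show "D_op sc \<circ> adjoint (blinfun_apply g) \<circ> inv (D_op sc) = inv (blinfun_apply g)"
        unfolding inv invD by (auto simp: DD)
    qed
  qed
  have Dk: "(\<forall>v w. g v \<bullet> D_op sc (g w) = v \<bullet> D_op sc w) \<longleftrightarrow> (\<forall>v. g (?k v) = ?k (g v))"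
    if g: "g o\<^sub>L h = id_blinfun" "h o\<^sub>L g = id_blinfun" and gJ: "\<forall>v w. g v \<bullet> ?J (g w) = v \<bullet> ?J w"
    for g h :: "('h \<times> 'h) \<Rightarrow>\<^sub>L ('h \<times> 'h)"
  proof
    note gh = blinfun_inverseD[OF g(1)] blinfun_inverseD[OF g(2)]
    assume gD: "\<forall>v w. g v \<bullet> D_op sc (g w) = v \<bullet> D_op sc w"
    show "\<forall>v. g (?k v) = ?k (g v)"
    proof
      fix v
      have "u \<bullet> ?J (?k (g v) - g (?k v)) = 0" for u
      proof -
        have "g (h u) \<bullet> ?J (?k (g v)) = h u \<bullet> ?J (?k v)" using gD[rule_format, of "h u" v] unfolding DJ .
        also have "\<dots> = g (h u) \<bullet> ?J (g (?k v))" using gJ[rule_format, of "h u" "?k v"] by simp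
        finally show ?thesis by (simp add: gh blinfun.diff_right inner_diff_right)
      qed
      then have "?J (?k (g v) - g (?k v)) = 0" by (metis inner_eq_zero_iff)
      then show "g (?k v) = ?k (g v)" by (simp add: reflection_apply prod_eq_iff)
    qed
  next
    assume gk: "\<forall>v. g (?k v) = ?k (g v)"
    then show "\<forall>v w. g v \<bullet> D_op sc (g w) = v \<bullet> D_op sc w"
      using gJ unfolding DJ by metis
  qed
  have "g \<in> O_star sc \<longleftrightarrow> g \<in> fa.Gr" for g
  proof
    assume g: "g \<in> O_star sc"
    then obtain h where h: "g o\<^sub>L h = id_blinfun" "h o\<^sub>L g = id_blinfun"
      unfolding O_star_def U_D_def GL_def by blast
    have lin': "\<forall>v. g (rot v) = rot (g v)" and "preserves cx_bilinear g"
      and UDg: "D_op sc \<circ> adjoint (blinfun_apply g) \<circ> inv (D_op sc) = inv (blinfun_apply g)"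
      using g unfolding O_star_def U_D_def O_complexified_def GL_def cx_linear_iff by blast+
    then have gJ: "\<forall>v w. g v \<bullet> ?J (g w) = v \<bullet> ?J w" using cx_bilinear_iff by blast
    show "g \<in> fa.Gr"
      unfolding fa.Gr_iff[OF J] lin using h lin' gJ UD[OF h gJ] Dk[OF h gJ] UDg by blast
  next
    assume g: "g \<in> fa.Gr"
    then obtain h where h: "g o\<^sub>L h = id_blinfun" "h o\<^sub>L g = id_blinfun"
      unfolding fa.Gr_iff[OF J] by blast
    have lin': "\<forall>v. g (rot v) = rot (g v)" and gk: "\<forall>v. g (?k v) = ?k (g v)"
      and gJ: "\<forall>v w. g v \<bullet> ?J (g w) = v \<bullet> ?J w"
      using g unfolding fa.Gr_iff[OF J] lin by blast+
    have "preserves cx_bilinear g" using cx_bilinear_iff[OF lin'] gJ by blast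
    moreover have "D_op sc \<circ> adjoint (blinfun_apply g) \<circ> inv (D_op sc) = inv (blinfun_apply g)"
      using UD[OF h gJ] Dk[OF h gJ] gk by blast
    moreover have "g \<in> GL cx_scale" using lin' h unfolding GL_def cx_linear_iff[symmetric] by blast
    ultimately show "g \<in> O_star sc" unfolding O_star_def U_D_def O_complexified_def by blast
  qed
  then show ?thesis by blast
qed

section \<open>Definiteness of the scalars and assembly of the ten cases\<close>

lemma real_star_mult_zero: "star z * z = 0 \<Longrightarrow> z = (0 :: real)"
  and complex_star_mult_zero: "star w * w = 0 \<Longrightarrow> w = (0 :: complex)"
  by (simp_all add: star_real_def star_complex_def)

lemma quat_star_mult_zero: "star z * z = 0 \<Longrightarrow> z = (0 :: quat)"
proof -
  assume "star z * z = 0"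
  then have "cpart (star z * z) = 0" by (simp add: zero_quat_def)
  then have "cnj (cpart z) * cpart z + jpart z * cnj (jpart z) = 0"
    by (simp add: times_quat_def star_quat_def)
  then have "(Re (cpart z))\<^sup>2 + (Im (cpart z))\<^sup>2 + ((Re (jpart z))\<^sup>2 + (Im (jpart z))\<^sup>2) = 0"
    by (simp add: complex_eq_iff power2_eq_square)
  then have "cpart z = 0" "jpart z = 0"
    by (smt (verit) complex_eq_0 sum_power2_ge_zero)+
  then show "z = 0" by (simp add: zero_quat_def quat.expand)
qed

theorem theorem5p8:
  fixes vsc :: "complex \<Rightarrow> 'v::{real_inner,complete_space} \<Rightarrow> 'v"
    and vip :: "'v \<Rightarrow> 'v \<Rightarrow> complex"
  assumes "hilbert_space vsc vip" and "separable (UNIV :: 'v set)"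
  shows "(\<forall>(G :: ('h::{real_inner,complete_space} \<Rightarrow>\<^sub>L 'h) set) K.
            nonunitary_pair G K \<longrightarrow>
              (\<forall>\<pi>. continuous_unitary_rep vsc vip G \<pi> \<longrightarrow> trivial_rep G \<pi>))
       \<and> (\<forall>(G :: (('h \<times> 'h) \<Rightarrow>\<^sub>L ('h \<times> 'h)) set) K.
            nonunitary_pair_double G K \<longrightarrow>
              (\<forall>\<pi>. continuous_unitary_rep vsc vip G \<pi> \<longrightarrow> trivial_rep G \<pi>))"
proof (intro conjI allI impI)
  fix G K :: "('h \<Rightarrow>\<^sub>L 'h) set" and \<pi> :: "('h \<Rightarrow>\<^sub>L 'h) \<Rightarrow> 'v \<Rightarrow>\<^sub>L 'v"
  assume "nonunitary_pair G K" and rep: "continuous_unitary_rep vsc vip G \<pi>"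
  then show "trivial_rep G \<pi>"
  proof cases
    case (GL_complex sc ip)
    interpret separable_infinite_dim_hilbert_space sc ip by fact
    show ?thesis
      by (rule trivial_rep_single[OF assms unit_group_complex unit_group_complex _ rep], unfold GL_complex(1), rule GL_eq_Gr[OF unit_group_complex span_complex])
  next
    case (U_quat_complexified sc ip)
    interpret separable_infinite_dim_hilbert_space sc ip by fact
    show ?thesis
      by (rule trivial_rep_single[OF assms unit_group_quat unit_group_quat0 _ rep], unfold U_quat_complexified(1), rule U_quat_eq_Gr[OF U_quat_complexified(3)])
  next
    case (Sp sc ip)
    interpret separable_infinite_dim_hilbert_space sc ip by fact
    show ?thesis
      by (rule trivial_rep_single[OF assms unit_group_complex unit_group_complex0 _ rep], unfold Sp(1), rule Sp_eq_Gr[OF Sp(3)])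
  next
    case GL_real
    interpret separable_infinite_dim_hilbert_space scaleR "inner :: 'h \<Rightarrow> 'h \<Rightarrow> real" by fact
    show ?thesis
      by (rule trivial_rep_single[OF assms unit_group_real unit_group_real _ rep], unfold GL_real(1), rule GL_eq_Gr[OF unit_group_real span_real])
  next
    case (GL_quat sc ip)
    interpret separable_infinite_dim_hilbert_space sc ip by fact
    show ?thesis
      by (rule trivial_rep_single[OF assms unit_group_quat unit_group_quat _ rep], unfold GL_quat(1), rule GL_eq_Gr[OF unit_group_quat span_quat])
  qed
next
  fix G K :: "(('h \<times> 'h) \<Rightarrow>\<^sub>L ('h \<times> 'h)) set" and \<pi> :: "(('h \<times> 'h) \<Rightarrow>\<^sub>L ('h \<times> 'h)) \<Rightarrow> 'v \<Rightarrow>\<^sub>L 'v"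
  assume "nonunitary_pair_double G K" and rep: "continuous_unitary_rep vsc vip G \<pi>"
  then show "trivial_rep G \<pi>"
  proof cases
    case O_complexified
    interpret separable_infinite_dim_hilbert_space scaleR "inner :: 'h \<Rightarrow> 'h \<Rightarrow> real" by fact
    have a: "admissible D4 {1, - 1 :: real} {1, - 1}" using unit_group_real by (simp add: admissible_def)
    show ?thesis
      by (rule trivial_rep_product[OF assms a unit_group_real _ rep], unfold O_complexified(1), rule O_complexified_eq_Gr[OF O_complexified(3)])
  next
    case (U_indefinite_complex sc ip)
    interpret separable_infinite_dim_hilbert_space sc ip by fact
    have a: "admissible D2 {1, - 1, \<i>, - \<i>} {1, - 1, \<i>, - \<i>}" using unit_group_complex by (simp add: admissible_def)
    show ?thesis
      by (rule trivial_rep_product[OF assms a unit_group_complex _ rep], unfold U_indefinite_complex(1), rule U_indefinite_eq_Gr[OF unit_group_complex span_complex complex_star_mult_zero])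
  next
    case U_indefinite_real
    interpret separable_infinite_dim_hilbert_space scaleR "inner :: 'h \<Rightarrow> 'h \<Rightarrow> real" by fact
    have a: "admissible D2 {1, - 1 :: real} {1, - 1}" using unit_group_real by (simp add: admissible_def)
    show ?thesis
      by (rule trivial_rep_product[OF assms a unit_group_real _ rep], unfold U_indefinite_real(1), rule U_indefinite_eq_Gr[OF unit_group_real span_real real_star_mult_zero])
  next
    case (U_indefinite_quat sc ip)
    interpret separable_infinite_dim_hilbert_space sc ip by fact
    have a: "admissible D2 Q8 Q8" using unit_group_quat by (simp add: admissible_def)
    show ?thesis
      by (rule trivial_rep_product[OF assms a unit_group_quat _ rep], unfold U_indefinite_quat(1), rule U_indefinite_eq_Gr[OF unit_group_quat span_quat quat_star_mult_zero])
  next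
    case (O_star sc ip)
    interpret separable_infinite_dim_hilbert_space sc ip by fact
    have a: "admissible D4 {1, - 1, \<i>, - \<i>} {1, - 1 :: complex}" using unit_group_complex0 by (simp add: admissible_def)
    show ?thesis
      by (rule trivial_rep_product[OF assms a unit_group_complex _ rep], unfold O_star(1), rule O_star_eq_Gr[OF O_star(3)])
  qed
qed

end
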